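(* Let $M$ be a Riemannian Hilbert manifold satisfying the standing assumption given in the context. For every closed subset $C$ of $M$ and every $x\in C$, $$N^P_C(x)=\mathrm{N}(C,x).$$
   Context: A Riemannian Hilbert manifold is a smooth manifold $M$ modelled on a separable Hilbert space $H$ (possibly infinite-dimensional), whose tangent spaces $T_xM$ carry a Hilbert inner product $\langle\cdot,\cdot\rangle_{T_xM}$ with norm $|\cdot|$ (Riemannian metric), endowed with the distance $d(x,y)$ = infimum of lengths of $C^1$ curves joining $x$ to $y$. $\gamma_{x,v}$ is the geodesic with $\gamma_{x,v}(0)=x$, $\dot\gamma_{x,v}(0)=v$ (for the Levi-Civita connection), and $\exp_x(v)=\gamma_{x,v}(1)$. For $x\in M$: the injectivity radius $i_M(x)$ is the supremum of $r>0$ such that $\exp_x$ is a diffeomorphism from $B(0_x,r)\subset T_xM$ onto $B(x,r)$; the convexity radius $c_M(x)$ is the supremum of $r>0$ such that $B(x,r)$ is convex, i.e. any $p,q\in B(x,r)$ are joined by a unique geodesic in $B(x,r)$ of length $d(p,q)$. For bounded $\mathcal{B}\subset M$: $i(\mathcal{B})=\inf_{x\in\mathcal{B}}i_M(x)$, $c(\mathcal{B})=\inf_{x\in\mathcal{B}}c_M(x)$, $K(\mathcal{B})=\sup\{K(\sigma_x): x\in\mathcal{B},\ \sigma_x\subset T_xM \text{ a 2-plane}\}$ where $K(\sigma_x)$ is the sectional curvature, and $\rho(\mathcal{B})=\min\{i(\mathcal{B}),c(\mathcal{B}),\pi/(2\sqrt{|K(\mathcal{B})|})\}$. For $x,y\in\mathcal{B}$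 with $d(x,y)\le\rho(\mathcal{B})$, $L_{x\to y}:T_xM\to T_yM$ is parallel transport along the unique minimizing geodesic from $x$ to $y$. The distance on the tangent bundle is $d_{TM}((y,v),(z,w))=d(y,z)+|L_{y\to z}v-w|_{T_zM}$. Standing assumption on $M$: $M$ is a connected Riemannian Hilbert manifold, metrically complete and geodesically complete (all maximal geodesics are defined on $\mathbb{R}$), and for every bounded $\mathcal{B}\subset M$: $i(\mathcal{B})>0$, $c(\mathcal{B})>0$, and the sectional curvatures are bounded in $\mathcal{B}$ ($|K(\mathcal{B})|<\infty$). Moreover $\exp$ is locally smooth on $TM$, with $\|\exp\|_{C^k(\mathcal{B})}\le L(\mathcal{B})$ for $k\in\{0,1,2\}$ and some $L(\mathcal{B})>0$, and there is $C_e(\mathcal{B})>0$ such that for all $x,y,z\in\mathcal{B}$ with $d(x,y)<\rho(\mathcal{B})$, $d(x,z)<\rho(\mathcal{B})$ and all $v\in T_yM$, $w\in T_zM$: $|\exp_x^{-1}(y)-\exp_x^{-1}(z)|\le C_e(\mathcal{B})d(y,z)$ and $|D\exp_x^{-1}(y)[v]-D\exp_x^{-1}(z)[w]|\le C_e(\mathcal{B})d_{TM}((y,v),(z,w))$. Metric proximal normal cone: for a closed set $C\subset M$, $\mathrm{P}_C(y)=\{z\in C: d(y,z)=\inf_{c\in C}d(y,c)\}$, and for $x\in C$, $\mathrm{N}(C,x)=\{v\in T_xM:\ \exists\varepsilon>0,\ x\in \mathrm{P}_C(\gamma_{x,v}(\varepsilon))\}$. Proximal normal cone via the exponential chart: $N^P_C(x):=N^P_{\exp_x^{-1}(U\cap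 C)}(0_x)$ where $U=\exp_x(V)$ with $V$ an open neighborhood of $0_x$ in $T_xM$ on which $\exp_x$ is a diffeomorphism onto $U$ (and $\exp_x^{-1}:U\to V$ is its inverse); on the right, $N^P_S(s)$ is the usual proximal normal cone in the Hilbert space $T_xM$ to a set $S$ at $s\in S$: the vectors $v$ for which there are $\sigma>0$ and a neighborhood $W$ of $s$ with $\langle v,s'-s\rangle\le\sigma|s'-s|^2$ for all $s'\in S\cap W$.
   Formalization: In N(C,x) the number ε is also required to satisfy d(x,γ_{x,v}(ε)) = ε|v|; without this the equality is false: on the flat torus R²/Z² with C = M, v = (1,0), ε = 1 one has γ_{x,v}(1) = x, so v lies in N(C,x), but N^P_C(x) = {0}. *)

theory Defs
  imports "HOL-Analysis.Analysis"
begin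

section \<open>Smooth maps between normed spaces\<close>

text \<open>
  \<^term>\<open>D k x\<close> is the \<^term>\<open>k\<close>-th derivative at \<^term>\<open>x\<close>, a bounded multilinear map on lists of length
  \<^term>\<open>k\<close>; \<^term>\<open>D (Suc k)\<close> is the Frechet derivative of \<^term>\<open>D k\<close> with respect to the operator norm
  of multilinear maps, so this is the usual notion of a smooth map also in infinite dimension.
\<close>

definition bounded_multilinear :: "nat \<Rightarrow> ('a::real_normed_vector list \<Rightarrow> 'b::real_normed_vector) \<Rightarrow> bool" where
  "bounded_multilinear k T \<longleftrightarrow>
     (\<forall>us vs. length us + length vs + 1 = k \<longrightarrow> linear (\<lambda>u. T (us @ u # vs))) \<and>
     (\<exists>K. \<forall>vs. length vs = k \<longrightarrow> norm (T vs) \<le> K * (\<Prod>v\<leftarrow>vs. norm v))"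

definition smooth_on :: "'a::real_normed_vector set \<Rightarrow> ('a \<Rightarrow> 'b::real_normed_vector) \<Rightarrow> bool" where
  "smooth_on S f \<longleftrightarrow> open S \<and>
     (\<exists>D :: nat \<Rightarrow> 'a \<Rightarrow> 'a list \<Rightarrow> 'b.
        (\<forall>x\<in>S. D 0 x [] = f x) \<and>
        (\<forall>k. \<forall>x\<in>S. bounded_multilinear k (D k x)) \<and>
        (\<forall>k. \<forall>x\<in>S. \<forall>e>0. \<exists>d>0. \<forall>h. norm h < d \<longrightarrow>
           (\<forall>vs. length vs = k \<longrightarrow>
              norm (D k (x + h) vs - D k x vs - D (Suc k) x (h # vs))
                \<le> e * norm h * (\<Prod>v\<leftarrow>vs. norm v))))"


section \<open>Riemannian Hilbert manifolds\<close>

text \<open>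
  The points of the manifold are all elements of the type \<^typ>\<open>'m\<close>, which carries the manifold topology.
  A chart is a pair (domain, coordinate map). For each point a preferred chart is selected, and
  the tangent space at \<^term>\<open>x\<close> is identified with the model space \<^typ>\<open>'h\<close> through the preferred chart at
  \<^term>\<open>x\<close>; \<^term>\<open>rmetric M x\<close> is the inner product of the tangent space at \<^term>\<open>x\<close> under this identification.
\<close>

type_synonym ('m, 'h) chart = "'m set \<times> ('m \<Rightarrow> 'h)"

record ('m, 'h) riemannian =
  atlas :: "('m, 'h) chart set"
  rmetric :: "'m \<Rightarrow> 'h \<Rightarrow> 'h \<Rightarrow> real"

definition chart_inv :: "('m, 'h) chart \<Rightarrow> 'h \<Rightarrow> 'm" where
  "chart_inv c = inv_into (fst c) (snd c)"

definition is_chart :: "('m::t2_space, 'h::real_inner) chart \<Rightarrow> bool" where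
  "is_chart c \<longleftrightarrow> open (fst c) \<and> open (snd c ` fst c) \<and>
     homeomorphism (fst c) (snd c ` fst c) (snd c) (chart_inv c)"

definition smooth_atlas :: "('m::t2_space, 'h::real_inner) chart set \<Rightarrow> bool" where
  "smooth_atlas A \<longleftrightarrow>
     (\<forall>c\<in>A. is_chart c) \<and> (\<Union>c\<in>A. fst c) = UNIV \<and>
     (\<forall>c\<in>A. \<forall>c'\<in>A. smooth_on (snd c ` (fst c \<inter> fst c')) (snd c' \<circ> chart_inv c))"

definition chart_at :: "('m, 'h) riemannian \<Rightarrow> 'm \<Rightarrow> ('m, 'h) chart" where
  "chart_at M x = (SOME c. c \<in> atlas M \<and> x \<in> fst c)"

text \<open>Coordinates with respect to \<^term>\<open>c'\<close> of the tangent vector at \<^term>\<open>x\<close> with coordinates \<^term>\<open>v\<close> with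
  respect to \<^term>\<open>c\<close>.\<close>

definition coord_change ::
    "('m, 'h::real_inner) chart \<Rightarrow> ('m, 'h) chart \<Rightarrow> 'm \<Rightarrow> 'h \<Rightarrow> 'h" where
  "coord_change c c' x v = frechet_derivative (snd c' \<circ> chart_inv c) (at (snd c x)) v"

definition tnorm :: "('m, 'h) riemannian \<Rightarrow> 'm \<Rightarrow> 'h \<Rightarrow> real" where
  "tnorm M x v = sqrt (rmetric M x v v)"

definition local_metric ::
    "('m, 'h::real_inner) riemannian \<Rightarrow> ('m, 'h) chart \<Rightarrow> 'h \<Rightarrow> 'h \<Rightarrow>\<^sub>L 'h \<Rightarrow>\<^sub>L real" where
  "local_metric M c p = (let x = chart_inv c p; T = coord_change c (chart_at M x) x in
     Blinfun (\<lambda>u. Blinfun (\<lambda>v. rmetric M x (T u) (T v))))"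

text \<open>The last inequality states that the inner product of the tangent space induces its topology, so
  that the tangent space is a Hilbert space.\<close>

definition hilbert_inner :: "('h::real_inner \<Rightarrow> 'h \<Rightarrow> real) \<Rightarrow> bool" where
  "hilbert_inner b \<longleftrightarrow> bounded_bilinear b \<and> (\<forall>u v. b u v = b v u) \<and>
     (\<exists>m>0. \<forall>v. m * (norm v)\<^sup>2 \<le> b v v)"

definition riemannian_hilbert_manifold ::
    "('m::t2_space, 'h::{real_inner, banach, second_countable_topology}) riemannian \<Rightarrow> bool" where
  "riemannian_hilbert_manifold M \<longleftrightarrow>
     smooth_atlas (atlas M) \<and>
     (\<forall>x. hilbert_inner (rmetric M x)) \<and>
     (\<forall>c\<in>atlas M. smooth_on (snd c ` fst c) (local_metric M c))"


section \<open>Riemannian distance\<close>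

definition velocity_within ::
    "('m, 'h::real_inner) riemannian \<Rightarrow> (real \<Rightarrow> 'm) \<Rightarrow> real set \<Rightarrow> real \<Rightarrow> 'h" where
  "velocity_within M \<gamma> S t = vector_derivative (snd (chart_at M (\<gamma> t)) \<circ> \<gamma>) (at t within S)"

definition C1_curve ::
    "('m::t2_space, 'h::real_inner) riemannian \<Rightarrow> (real \<Rightarrow> 'm) \<Rightarrow> bool" where
  "C1_curve M \<gamma> \<longleftrightarrow> continuous_on {0..1} \<gamma> \<and>
     (\<forall>c\<in>atlas M. let J = {t\<in>{0..1}. \<gamma> t \<in> fst c} in
        (\<forall>t\<in>J. (snd c \<circ> \<gamma>) differentiable (at t within {0..1})) \<and>
        continuous_on J (\<lambda>t. vector_derivative (snd c \<circ> \<gamma>) (at t within {0..1})))"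

definition curve_length ::
    "('m, 'h::real_inner) riemannian \<Rightarrow> (real \<Rightarrow> 'm) \<Rightarrow> real" where
  "curve_length M \<gamma> = integral {0..1} (\<lambda>t. tnorm M (\<gamma> t) (velocity_within M \<gamma> {0..1} t))"

definition rdist ::
    "('m::t2_space, 'h::real_inner) riemannian \<Rightarrow> 'm \<Rightarrow> 'm \<Rightarrow> real" where
  "rdist M x y = Inf {curve_length M \<gamma> |\<gamma>. C1_curve M \<gamma> \<and> \<gamma> 0 = x \<and> \<gamma> 1 = y}"

definition rball ::
    "('m::t2_space, 'h::real_inner) riemannian \<Rightarrow> 'm \<Rightarrow> real \<Rightarrow> 'm set" where
  "rball M x r = {y. rdist M x y < r}"

definition tball :: "('m, 'h::real_inner) riemannian \<Rightarrow> 'm \<Rightarrow> real \<Rightarrow> 'h set" where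
  "tball M x r = {v. tnorm M x v < r}"

definition rbounded ::
    "('m::t2_space, 'h::real_inner) riemannian \<Rightarrow> 'm set \<Rightarrow> bool" where
  "rbounded M B \<longleftrightarrow> (\<exists>a r. \<forall>x\<in>B. rdist M a x \<le> r)"


section \<open>Levi-Civita connection, geodesics, curvature\<close>

text \<open>The Levi-Civita connection in a chart, given by its Christoffel map \<^term>\<open>\<Gamma>\<close>: the covariant
  derivative of the constant field \<^term>\<open>v\<close> in direction \<^term>\<open>u\<close> is \<^term>\<open>\<Gamma> u v\<close>. It is the unique connection that
  is torsion-free (first condition) and compatible with the metric (second condition).\<close>

definition christoffel ::
    "('m, 'h::real_inner) riemannian \<Rightarrow> ('m, 'h) chart \<Rightarrow> 'h \<Rightarrow> 'h \<Rightarrow> 'h \<Rightarrow> 'h" where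
  "christoffel M c p = (let G = local_metric M c in
     (THE \<Gamma>. (\<forall>u v. \<Gamma> u v = \<Gamma> v u) \<and>
        (\<forall>u v w. blinfun_apply (blinfun_apply (frechet_derivative G (at p) u) v) w
           = blinfun_apply (blinfun_apply (G p) (\<Gamma> u v)) w
             + blinfun_apply (blinfun_apply (G p) v) (\<Gamma> u w))))"

definition geodesic_on ::
    "('m::t2_space, 'h::real_inner) riemannian \<Rightarrow> real set \<Rightarrow> (real \<Rightarrow> 'm) \<Rightarrow> bool" where
  "geodesic_on M J \<gamma> \<longleftrightarrow> open J \<and> is_interval J \<and> J \<noteq> {} \<and> continuous_on J \<gamma> \<and>
     (\<forall>c\<in>atlas M. \<forall>t\<in>J. \<gamma> t \<in> fst c \<longrightarrow>
        (let q = snd c \<circ> \<gamma>; q' = (\<lambda>s. vector_derivative q (at s)) in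
           q differentiable (at t) \<and>
           (q' has_vector_derivative (- christoffel M c (q t) (q' t) (q' t))) (at t)))"

definition maximal_geodesic ::
    "('m::t2_space, 'h::real_inner) riemannian \<Rightarrow> real set \<Rightarrow> (real \<Rightarrow> 'm) \<Rightarrow> bool" where
  "maximal_geodesic M J \<gamma> \<longleftrightarrow> geodesic_on M J \<gamma> \<and>
     (\<forall>J' \<gamma>'. geodesic_on M J' \<gamma>' \<and> J \<subseteq> J' \<and> (\<forall>t\<in>J. \<gamma>' t = \<gamma> t) \<longrightarrow> J' = J)"

definition geod ::
    "('m::t2_space, 'h::real_inner) riemannian \<Rightarrow> 'm \<Rightarrow> 'h \<Rightarrow> real \<Rightarrow> 'm" where
  "geod M x v = (THE \<gamma>. geodesic_on M UNIV \<gamma> \<and> \<gamma> 0 = x \<and> velocity_within M \<gamma> UNIV 0 = v)"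

definition rexp ::
    "('m::t2_space, 'h::real_inner) riemannian \<Rightarrow> 'm \<Rightarrow> 'h \<Rightarrow> 'm" where
  "rexp M x v = geod M x v 1"

text \<open>\<^term>\<open>V t\<close> is a tangent vector at \<^term>\<open>\<gamma> t\<close>, given in the preferred chart at that point.\<close>

definition parallel_along ::
    "('m::t2_space, 'h::real_inner) riemannian \<Rightarrow> (real \<Rightarrow> 'm) \<Rightarrow> (real \<Rightarrow> 'h) \<Rightarrow> bool" where
  "parallel_along M \<gamma> V \<longleftrightarrow>
     (\<forall>c\<in>atlas M. \<forall>t. \<gamma> t \<in> fst c \<longrightarrow>
        (let q = snd c \<circ> \<gamma>; W = (\<lambda>s. coord_change (chart_at M (\<gamma> s)) c (\<gamma> s) (V s)) in
           (W has_vector_derivative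
              (- christoffel M c (q t) (vector_derivative q (at t)) (W t))) (at t)))"

text \<open>Parallel transport of \<^term>\<open>v\<close> along the geodesic \<^term>\<open>geod M x h\<close> from time 0 to time \<^term>\<open>s\<close>.\<close>

definition geod_transport ::
    "('m::t2_space, 'h::real_inner) riemannian \<Rightarrow> 'm \<Rightarrow> 'h \<Rightarrow> real \<Rightarrow> 'h \<Rightarrow> 'h" where
  "geod_transport M x h s v = (THE V. parallel_along M (geod M x h) V \<and> V 0 = v) s"

text \<open>The map written as L with index x to y in the literature: parallel transport along the
  unique minimizing geodesic.\<close>

definition min_transport ::
    "('m::t2_space, 'h::real_inner) riemannian \<Rightarrow> 'm \<Rightarrow> 'm \<Rightarrow> 'h \<Rightarrow> 'h" where
  "min_transport M x y v =
     geod_transport M x (THE u. rexp M x u = y \<and> tnorm M x u = rdist M x y) 1 v"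

definition dist_TM ::
    "('m::t2_space, 'h::real_inner) riemannian \<Rightarrow> 'm \<times> 'h \<Rightarrow> 'm \<times> 'h \<Rightarrow> real" where
  "dist_TM M = (\<lambda>(y, v) (z, w). rdist M y z + tnorm M z (min_transport M y z v - w))"

definition covariant_acceleration ::
    "('m, 'h::real_inner) riemannian \<Rightarrow> (real \<Rightarrow> 'm) \<Rightarrow> real \<Rightarrow> 'h" where
  "covariant_acceleration M \<gamma> t =
     (let c = chart_at M (\<gamma> t); q = snd c \<circ> \<gamma>; q' = (\<lambda>s. vector_derivative q (at s)) in
        vector_derivative q' (at t) + christoffel M c (q t) (q' t) (q' t))"

definition curvature_tensor ::
    "('m, 'h::real_inner) riemannian \<Rightarrow> 'm \<Rightarrow> 'h \<Rightarrow> 'h \<Rightarrow> 'h \<Rightarrow> 'h" where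
  "curvature_tensor M x u v w =
     (let c = chart_at M x; p = snd c x; \<Gamma> = christoffel M c in
        frechet_derivative (\<lambda>q. \<Gamma> q v w) (at p) u - frechet_derivative (\<lambda>q. \<Gamma> q u w) (at p) v
        + \<Gamma> p u (\<Gamma> p v w) - \<Gamma> p v (\<Gamma> p u w))"

text \<open>Sectional curvature of the 2-plane spanned by \<^term>\<open>u\<close> and \<^term>\<open>v\<close>.\<close>

definition sectional ::
    "('m, 'h::real_inner) riemannian \<Rightarrow> 'm \<Rightarrow> 'h \<Rightarrow> 'h \<Rightarrow> real" where
  "sectional M x u v = rmetric M x (curvature_tensor M x u v v) u
     / (rmetric M x u u * rmetric M x v v - (rmetric M x u v)\<^sup>2)"

definition sectional_values ::
    "('m, 'h::real_inner) riemannian \<Rightarrow> 'm set \<Rightarrow> real set" where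
  "sectional_values M B = {sectional M x u v |x u v. x \<in> B \<and> u \<noteq> v \<and> independent {u, v}}"


section \<open>Radii\<close>

text \<open>The set \<^term>\<open>V\<close> lies in the tangent space at a point.\<close>

definition diffeo_onto ::
    "('m::t2_space, 'h::real_inner) riemannian \<Rightarrow> ('h \<Rightarrow> 'm) \<Rightarrow> 'h set \<Rightarrow> 'm set \<Rightarrow> bool" where
  "diffeo_onto M f V U \<longleftrightarrow> open V \<and> open U \<and> bij_betw f V U \<and>
     (\<forall>c\<in>atlas M. smooth_on {v\<in>V. f v \<in> fst c} (snd c \<circ> f) \<and>
        smooth_on (snd c ` (U \<inter> fst c)) (inv_into V f \<circ> chart_inv c))"

definition inj_radius ::
    "('m::t2_space, 'h::real_inner) riemannian \<Rightarrow> 'm \<Rightarrow> ereal" where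
  "inj_radius M x =
     Sup (ereal ` {r. r > 0 \<and> diffeo_onto M (rexp M x) (tball M x r) (rball M x r)})"

text \<open>Geodesics joining \<^term>\<open>p\<close> to \<^term>\<open>q\<close> are parametrized by [0,1] and determined by their initial
  velocity \<^term>\<open>u\<close>, whose norm is their length.\<close>

definition convex_ball ::
    "('m::t2_space, 'h::real_inner) riemannian \<Rightarrow> 'm \<Rightarrow> real \<Rightarrow> bool" where
  "convex_ball M x r \<longleftrightarrow> (\<forall>p\<in>rball M x r. \<forall>q\<in>rball M x r.
     \<exists>!u. geod M p u 1 = q \<and> (\<forall>t\<in>{0..1}. geod M p u t \<in> rball M x r) \<and>
          tnorm M p u = rdist M p q)"

definition conv_radius ::
    "('m::t2_space, 'h::real_inner) riemannian \<Rightarrow> 'm \<Rightarrow> ereal" where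
  "conv_radius M x = Sup (ereal ` {r. r > 0 \<and> convex_ball M x r})"

definition inj_radius_on ::
    "('m::t2_space, 'h::real_inner) riemannian \<Rightarrow> 'm set \<Rightarrow> ereal" where
  "inj_radius_on M B = (INF x\<in>B. inj_radius M x)"

definition conv_radius_on ::
    "('m::t2_space, 'h::real_inner) riemannian \<Rightarrow> 'm set \<Rightarrow> ereal" where
  "conv_radius_on M B = (INF x\<in>B. conv_radius M x)"

text \<open>If there are no 2-planes (dimension at most 1), the curvature bound is 0 by convention; if the
  curvature bound is 0, the third term of \<^term>\<open>rho\<close> is infinite.\<close>

definition curv_sup ::
    "('m, 'h::real_inner) riemannian \<Rightarrow> 'm set \<Rightarrow> real" where
  "curv_sup M B = (if sectional_values M B = {} then 0 else Sup (sectional_values M B))"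

definition rho ::
    "('m::t2_space, 'h::real_inner) riemannian \<Rightarrow> 'm set \<Rightarrow> ereal" where
  "rho M B = min (min (inj_radius_on M B) (conv_radius_on M B))
     (if curv_sup M B = 0 then \<infinity> else ereal (pi / (2 * sqrt \<bar>curv_sup M B\<bar>)))"


section \<open>Standing assumption\<close>

text \<open>\<^term>\<open>(p, u)\<close> are the coordinates induced by \<^term>\<open>c\<close> on the tangent bundle.\<close>

definition exp_smooth ::
    "('m::t2_space, 'h::real_inner) riemannian \<Rightarrow> bool" where
  "exp_smooth M \<longleftrightarrow> (\<forall>c\<in>atlas M. \<forall>c'\<in>atlas M.
     let F = (\<lambda>(p, u). let x = chart_inv c p in rexp M x (coord_change c (chart_at M x) x u)) in
       smooth_on {z. fst z \<in> snd c ` fst c \<and> F z \<in> fst c'} (snd c' \<circ> F))"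

text \<open>
  Bounds for the exponential map and its first two derivatives on the bounded sets of the
  tangent bundle over \<^term>\<open>B\<close>. The derivatives are taken along the curve \<^term>\<open>E\<close>, the image of
  the curve in the tangent bundle that starts at \<^term>\<open>(x, v)\<close> with horizontal velocity \<^term>\<open>h\<close> and
  vertical velocity \<^term>\<open>w\<close> and is a geodesic for the connection induced on the tangent bundle; by
  polarization this bounds the full first and second (covariant) derivatives.
\<close>

definition exp_C2_bounded ::
    "('m::t2_space, 'h::real_inner) riemannian \<Rightarrow> 'm set \<Rightarrow> bool" where
  "exp_C2_bounded M B \<longleftrightarrow> (\<forall>R>0. \<exists>L>0. \<forall>x\<in>B. \<forall>v h w. tnorm M x v \<le> R \<longrightarrow>
     (let y = rexp M x v;
          E = (\<lambda>s. rexp M (geod M x h s) (geod_transport M x h s (v + s *\<^sub>R w)))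
      in rdist M x y \<le> L \<and>
         tnorm M y (velocity_within M E UNIV 0) \<le> L * (tnorm M x h + tnorm M x w) \<and>
         tnorm M y (covariant_acceleration M E 0) \<le> L * (tnorm M x h + tnorm M x w)\<^sup>2))"

definition exp_inv ::
    "('m::t2_space, 'h::real_inner) riemannian \<Rightarrow> ereal \<Rightarrow> 'm \<Rightarrow> 'm \<Rightarrow> 'h" where
  "exp_inv M r x = inv_into {v. ereal (tnorm M x v) < r} (rexp M x)"

definition D_exp_inv ::
    "('m::t2_space, 'h::real_inner) riemannian \<Rightarrow> ereal \<Rightarrow> 'm \<Rightarrow> 'm \<Rightarrow> 'h \<Rightarrow> 'h" where
  "D_exp_inv M r x y v = (let c = chart_at M y in
     frechet_derivative (exp_inv M r x \<circ> chart_inv c) (at (snd c y)) v)"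

text \<open>The second estimate involves parallel transport from \<^term>\<open>y\<close> to \<^term>\<open>z\<close>, which is only
  defined for points at distance at most \<^term>\<open>rho M B\<close>.\<close>

definition exp_inv_lipschitz ::
    "('m::t2_space, 'h::real_inner) riemannian \<Rightarrow> 'm set \<Rightarrow> bool" where
  "exp_inv_lipschitz M B \<longleftrightarrow> (\<exists>C>0. \<forall>x\<in>B. \<forall>y\<in>B. \<forall>z\<in>B.
     ereal (rdist M x y) < rho M B \<and> ereal (rdist M x z) < rho M B \<longrightarrow>
       tnorm M x (exp_inv M (rho M B) x y - exp_inv M (rho M B) x z) \<le> C * rdist M y z \<and>
       (ereal (rdist M y z) \<le> rho M B \<longrightarrow>
          (\<forall>v w. tnorm M x (D_exp_inv M (rho M B) x y v - D_exp_inv M (rho M B) x z w)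
             \<le> C * dist_TM M (y, v) (z, w))))"

definition standing_assumption ::
    "('m::t2_space, 'h::{real_inner, banach, second_countable_topology}) riemannian \<Rightarrow> bool" where
  "standing_assumption M \<longleftrightarrow>
     riemannian_hilbert_manifold M \<and>
     connected (UNIV :: 'm set) \<and>
     Metric_space.mcomplete UNIV (rdist M) \<and>
     (\<forall>J \<gamma>. maximal_geodesic M J \<gamma> \<longrightarrow> J = UNIV) \<and>
     exp_smooth M \<and>
     (\<forall>B. rbounded M B \<longrightarrow>
        inj_radius_on M B > 0 \<and> conv_radius_on M B > 0 \<and>
        (\<exists>k. \<forall>K\<in>sectional_values M B. \<bar>K\<bar> \<le> k) \<and>
        exp_C2_bounded M B \<and> exp_inv_lipschitz M B)"


section \<open>Proximal normal cones\<close>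

definition metric_proj ::
    "('m::t2_space, 'h::real_inner) riemannian \<Rightarrow> 'm set \<Rightarrow> 'm \<Rightarrow> 'm set" where
  "metric_proj M C y = {z\<in>C. rdist M y z = (INF c\<in>C. rdist M y c)}"

text \<open>
  The point \<^term>\<open>geod M x v \<epsilon>\<close> is required to be reached from \<^term>\<open>x\<close> by a minimizing geodesic segment, as
  is automatic for small \<^term>\<open>\<epsilon>\<close>. Without this, the cone would contain every initial velocity of
  a closed geodesic through \<^term>\<open>x\<close> (take \<^term>\<open>\<epsilon>\<close> to be a period), for every set containing \<^term>\<open>x\<close>.
\<close>

definition metric_normal_cone ::
    "('m::t2_space, 'h::real_inner) riemannian \<Rightarrow> 'm set \<Rightarrow> 'm \<Rightarrow> 'h set" where
  "metric_normal_cone M C x = {v. \<exists>\<epsilon>>0. rdist M x (geod M x v \<epsilon>) = \<epsilon> * tnorm M x v \<and>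
     x \<in> metric_proj M C (geod M x v \<epsilon>)}"

text \<open>The usual proximal normal cone in a Hilbert space with inner product \<^term>\<open>b\<close>.\<close>

definition proximal_cone :: "('h::real_inner \<Rightarrow> 'h \<Rightarrow> real) \<Rightarrow> 'h set \<Rightarrow> 'h \<Rightarrow> 'h set" where
  "proximal_cone b S s = {v. \<exists>\<sigma>>0. \<exists>W. open W \<and> s \<in> W \<and>
     (\<forall>s'\<in>S \<inter> W. b v (s' - s) \<le> \<sigma> * b (s' - s) (s' - s))}"

definition exp_chart_domain ::
    "('m::t2_space, 'h::real_inner) riemannian \<Rightarrow> 'm \<Rightarrow> 'h set \<Rightarrow> bool" where
  "exp_chart_domain M x V \<longleftrightarrow> 0 \<in> V \<and> diffeo_onto M (rexp M x) V (rexp M x ` V)"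

definition exp_proximal_cone ::
    "('m::t2_space, 'h::real_inner) riemannian \<Rightarrow> 'h set \<Rightarrow> 'm set \<Rightarrow> 'm \<Rightarrow> 'h set" where
  "exp_proximal_cone M V C x =
     proximal_cone (rmetric M x) (inv_into V (rexp M x) ` (rexp M x ` V \<inter> C)) 0"

end

theory Submission
  imports Defs
begin

text \<open>
  Work in the preferred chart at \<open>x\<close>. Let \<open>g\<close> be the geodesic with initial velocity \<open>w = \<epsilon> v\<close>, of length
  \<open>a = \<epsilon> |v|\<close>, and let \<open>z\<close> be a point with coordinates \<open>\<xi>\<close> relative to \<open>x\<close>. The geodesic equation says that
  the momentum \<open>\<langle>g', \<cdot>\<rangle>\<close> has derivative half the derivative of the metric, which is the first variation
  formula. Varying \<open>g\<close> near its starting point gives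
  \<open>d(z, g 1) \<le> a + (C |\<xi>|\<^sup>2 - 2 \<langle>w, \<xi>\<rangle>) / (2 a)\<close>; for small \<open>\<epsilon>\<close>, expanding the energy of an arbitrary curve
  around \<open>g\<close> gives \<open>d(z, g 1)\<^sup>2 \<ge> a\<^sup>2 - 2 \<langle>w, \<xi>\<rangle> + c |\<xi>|\<^sup>2\<close> with \<open>c > 0\<close> independent of \<open>\<epsilon>\<close>. Since
  \<open>\<xi> = s + O(|s|\<^sup>2)\<close> for \<open>z = exp s\<close>, the first estimate shows that metric normals are proximal
  normals, and the second one, with \<open>\<epsilon>\<close> so small that \<open>c |\<xi>|\<^sup>2\<close> absorbs the quadratic error
  \<open>2 \<epsilon> \<sigma> |\<xi>|\<^sup>2\<close>, gives the converse.
\<close>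

section \<open>Smooth maps and the Riesz representation\<close>

text \<open>Balls in the model space need not be compact, so a shortest curve from \<open>z\<close>
  to \<open>g 1\<close> cannot be obtained by compactness and then compared with \<open>g\<close>.
  The lower bound is therefore proved for every competing curve, from coercivity of the metric
  alone. Its constant \<open>c = lam / 16\<close> depends only on the metric near \<open>x\<close>,
  which is what allows \<open>\<epsilon>\<close> to be chosen afterwards; the constant
  \<open>C\<close> of the upper bound may depend on \<open>w\<close>. A second obstacle is that
  distances are infima over C^1 curves: gluing two curves can create a corner, so no triangle
  inequality is invoked. Instead the start of a single curve is moved inside a chart by a C^1
  cutoff. The lower bound at \<open>z = x\<close> shows at the same time that \<open>g\<close> is
  minimizing, which takes the place of the Gauss lemma. Momenta have a further benefit: they turn
  the geodesic equation into a first-order system that is Lipschitz as soon as the metric is C^1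
  with Lipschitz derivative. Uniqueness of geodesics follows without estimates on the Christoffel
  map.\<close>

lemma smooth_on_locally_C11:
  fixes f :: "'a::real_normed_vector \<Rightarrow> 'b::real_normed_vector"
  assumes "smooth_on S f" "x \<in> S"
  obtains r K f' where "r > 0" "K > 0" "ball x r \<subseteq> S"
    "\<And>y. y \<in> ball x r \<Longrightarrow> (f has_derivative f' y) (at y)"
    "\<And>y v. y \<in> ball x r \<Longrightarrow> norm (f' y v) \<le> K * norm v"
    "\<And>y z v. y \<in> ball x r \<Longrightarrow> z \<in> ball x r \<Longrightarrow> norm (f' y v - f' z v) \<le> K * norm (y - z) * norm v"
proof -
  from assms(1) have S: "open S" by (simp add: smooth_on_def)
  obtain D :: "nat \<Rightarrow> 'a \<Rightarrow> 'a list \<Rightarrow> 'b" where D: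
    "(\<forall>x\<in>S. D 0 x [] = f x) \<and> (\<forall>k. \<forall>x\<in>S. bounded_multilinear k (D k x)) \<and>
     (\<forall>k. \<forall>x\<in>S. \<forall>e>0. \<exists>d>0. \<forall>h. norm h < d \<longrightarrow>
           (\<forall>vs. length vs = k \<longrightarrow>
              norm (D k (x + h) vs - D k x vs - D (Suc k) x (h # vs))
                \<le> e * norm h * (\<Prod>v\<leftarrow>vs. norm v)))"
    using assms(1)[unfolded smooth_on_def, THEN conjunct2] by (rule exE)
  have D0: "D 0 x [] = f x" if "x \<in> S" for x using D that by simp
  have bm: "bounded_multilinear k (D k x)" if "x \<in> S" for k x using D that by simp
  have DD: "\<exists>d>0. \<forall>h. norm h < d \<longrightarrow>
           (\<forall>vs. length vs = k \<longrightarrow>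
              norm (D k (x + h) vs - D k x vs - D (Suc k) x (h # vs))
                \<le> e * norm h * (\<Prod>v\<leftarrow>vs. norm v))" if "x \<in> S" "e > 0" for k x e
    using conjunct2[OF conjunct2[OF D], rule_format, OF that] .
  have lin1: "linear (\<lambda>u. D 1 y [u])" if "y \<in> S" for y
  proof -
    have "\<forall>us vs. length us + length vs + 1 = 1 \<longrightarrow> linear (\<lambda>u. D 1 y (us @ u # vs))"
      using bm[OF that, of 1] unfolding bounded_multilinear_def by (rule conjunct1)
    from this[rule_format, of "[]" "[]"] show ?thesis by simp
  qed
  have lin2: "linear (\<lambda>u. D 2 y [u, v])" if "y \<in> S" for y v
  proof -
    have "\<forall>us vs. length us + length vs + 1 = 2 \<longrightarrow> linear (\<lambda>u. D 2 y (us @ u # vs))"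
      using bm[OF that, of 2] unfolding bounded_multilinear_def by (rule conjunct1)
    from this[rule_format, of "[]" "[v]"] show ?thesis by simp
  qed
  have bnd: "\<exists>K>0. \<forall>vs. length vs = k \<longrightarrow> norm (D k y vs) \<le> K * (\<Prod>v\<leftarrow>vs. norm v)"
    if y: "y \<in> S" for k y
  proof -
    obtain K where K: "\<forall>vs. length vs = k \<longrightarrow> norm (D k y vs) \<le> K * (\<Prod>v\<leftarrow>vs. norm v)"
      using bm[OF y, of k] unfolding bounded_multilinear_def by blast
    have "norm (D k y vs) \<le> (\<bar>K\<bar> + 1) * (\<Prod>v\<leftarrow>vs. norm v)" if "length vs = k" for vs
    proof -
      have "0 \<le> (\<Prod>v\<leftarrow>vs. norm v)" by (rule prod_list_nonneg) auto
      then have "K * (\<Prod>v\<leftarrow>vs. norm v) \<le> (\<bar>K\<bar> + 1) * (\<Prod>v\<leftarrow>vs. norm v)"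
        by (intro mult_right_mono) auto
      then show ?thesis using K that by force
    qed
    then show ?thesis by (intro exI[of _ "\<bar>K\<bar> + 1"]) auto
  qed
  \<comment> \<open>The expansion of \<open>D k\<close> at \<open>x\<close> with error constant 1,
    combined with the bounds for \<open>D k x\<close> and \<open>D (Suc k) x\<close>, already bounds
    \<open>D k\<close> on a whole ball. Keeping \<open>norm h \<le> 1\<close> turns the terms linear
    in \<open>h\<close> into constants.\<close>
  have locbnd: "\<exists>r>0. \<exists>K>0. ball x r \<subseteq> S \<and> (\<forall>y\<in>ball x r. \<forall>vs. length vs = k \<longrightarrow> norm (D k y vs) \<le> K * (\<Prod>v\<leftarrow>vs. norm v))"
    for k
  proof -
    obtain d where d: "d > 0" "\<forall>h. norm h < d \<longrightarrow>
           (\<forall>vs. length vs = k \<longrightarrow> norm (D k (x + h) vs - D k x vs - D (Suc k) x (h # vs))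
                \<le> 1 * norm h * (\<Prod>v\<leftarrow>vs. norm v))"
      using DD[OF assms(2) zero_less_one, of k] by blast
    obtain K0 where K0: "K0 > 0" "\<forall>vs. length vs = k \<longrightarrow> norm (D k x vs) \<le> K0 * (\<Prod>v\<leftarrow>vs. norm v)"
      using bnd[OF assms(2)] by blast
    obtain K1 where K1: "K1 > 0" "\<forall>vs. length vs = Suc k \<longrightarrow> norm (D (Suc k) x vs) \<le> K1 * (\<Prod>v\<leftarrow>vs. norm v)"
      using bnd[OF assms(2)] by blast
    obtain r0 where r0: "r0 > 0" "ball x r0 \<subseteq> S" using S assms(2) openE by blast
    let ?r = "min r0 (min d 1)"
    have "norm (D k y vs) \<le> (1 + K0 + K1) * (\<Prod>v\<leftarrow>vs. norm v)" if y: "y \<in> ball x ?r" and l: "length vs = k" for y vs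
    proof -
      define h where "h = y - x"
      have h: "norm h < d" "norm h \<le> 1" and yh: "y = x + h"
        using y by (auto simp: h_def dist_norm norm_minus_commute)
      let ?p = "\<Prod>v\<leftarrow>vs. norm v"
      have p: "0 \<le> ?p" by (rule prod_list_nonneg) auto
      have a: "norm (D k y vs - D k x vs - D (Suc k) x (h # vs)) \<le> 1 * norm h * ?p"
        using d h l yh by blast
      have b: "1 * norm h * ?p \<le> 1 * ?p" using h p by (intro mult_right_mono) auto
      have c: "norm (D k x vs) \<le> K0 * ?p" using K0 l by auto
      have "norm (D (Suc k) x (h # vs)) \<le> K1 * (norm h * ?p)" using K1(2)[rule_format, of "h#vs"] l by auto
      also have "\<dots> \<le> K1 * (1 * ?p)" using h p K1 by (intro mult_left_mono mult_right_mono) auto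
      finally have e: "norm (D (Suc k) x (h # vs)) \<le> K1 * ?p" by simp
      have "norm (D k y vs) \<le> norm (D k y vs - D k x vs - D (Suc k) x (h # vs)) + norm (D k x vs) + norm (D (Suc k) x (h # vs))"
        using norm_triangle_ineq[of "D k y vs - D k x vs - D (Suc k) x (h # vs)" "D k x vs + D (Suc k) x (h # vs)"]
          norm_triangle_ineq[of "D k x vs" "D (Suc k) x (h # vs)"] by (simp add: algebra_simps)
      also have "\<dots> \<le> 1 * ?p + K0 * ?p + K1 * ?p" using a b c e by linarith
      finally show ?thesis by (simp add: algebra_simps)
    qed
    then show ?thesis using r0 d K0 K1 by (intro exI[of _ ?r] conjI exI[of _ "1+K0+K1"]) auto
  qed
  have der0: "(f has_derivative (\<lambda>v. D 1 y [v])) (at y)" if y: "y \<in> S" for y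
  proof (rule has_derivativeI)
    obtain K where K: "\<forall>vs. length vs = 1 \<longrightarrow> norm (D 1 y vs) \<le> K * (\<Prod>v\<leftarrow>vs. norm v)"
      using bnd[OF y] by metis
    show "bounded_linear (\<lambda>v. D 1 y [v])"
      using K[rule_format, of "[_]"] linear_add[OF lin1[OF y]] linear_scale[OF lin1[OF y]]
      by (intro bounded_linear_intro[of _ K]) (auto simp: mult.commute)
    obtain r0 where r0: "r0 > 0" "ball y r0 \<subseteq> S" using S y openE by blast
    show "((\<lambda>z. (f z - f y - D 1 y [z - y]) /\<^sub>R norm (z - y)) \<longlongrightarrow> 0) (at y)"
    proof (rule LIM_I)
      fix e :: real assume "e > 0"
      then obtain d where d: "d > 0" "\<forall>h. norm h < d \<longrightarrow>
           (\<forall>vs. length vs = 0 \<longrightarrow> norm (D 0 (y + h) vs - D 0 y vs - D (Suc 0) y (h # vs))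
                \<le> e/2 * norm h * (\<Prod>v\<leftarrow>vs. norm v))"
        using DD[OF y, of "e/2" 0] by (metis half_gt_zero)
      have "norm ((f z - f y - D 1 y [z - y]) /\<^sub>R norm (z - y) - 0) < e"
        if z: "z \<noteq> y" "norm (z - y) < min d r0" for z
      proof -
        have zS: "z \<in> S" using r0 z by (auto simp: dist_norm norm_minus_commute)
        have "norm (D 0 (y + (z - y)) [] - D 0 y [] - D (Suc 0) y [z - y]) \<le> e/2 * norm (z - y)"
          using d(2)[rule_format, of "z - y" "[]"] z by simp
        then have "norm (f z - f y - D 1 y [z - y]) \<le> e/2 * norm (z - y)"
          using D0[OF zS] D0[OF y] by simp
        also have "\<dots> < e * norm (z - y)" using \<open>e > 0\<close> z by simp
        finally have "norm (f z - f y - D 1 y [z - y]) < e * norm (z - y)" .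
        then show ?thesis using z unfolding diff_0_right norm_scaleR
          by (simp add: divide_inverse_commute[symmetric] divide_less_eq)
      qed
      then show "\<exists>s>0. \<forall>z. z \<noteq> y \<and> norm (z - y) < s \<longrightarrow> norm ((f z - f y - D 1 y [z - y]) /\<^sub>R norm (z - y) - 0) < e"
        using d r0 by (intro exI[of _ "min d r0"]) auto
    qed
  qed
  have der1: "((\<lambda>y. D 1 y [v]) has_derivative (\<lambda>h. D 2 y [h, v])) (at y)" if y: "y \<in> S" for y v
  proof (rule has_derivativeI)
    obtain K where K: "K>0" "\<forall>vs. length vs = 2 \<longrightarrow> norm (D 2 y vs) \<le> K * (\<Prod>v\<leftarrow>vs. norm v)"
      using bnd[OF y] by metis
    show "bounded_linear (\<lambda>h. D 2 y [h, v])"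
      using K(2)[rule_format, of "[_,v]"] linear_add[OF lin2[OF y, of v]] linear_scale[OF lin2[OF y, of v]]
      by (intro bounded_linear_intro[of _ "K * norm v"]) (auto simp: mult_ac)
    show "((\<lambda>z. (D 1 z [v] - D 1 y [v] - D 2 y [z - y, v]) /\<^sub>R norm (z - y)) \<longlongrightarrow> 0) (at y)"
    proof (rule LIM_I)
      fix e :: real assume e: "e > 0"
      \<comment> \<open>The added 1 keeps the quotient defined for \<open>v = 0\<close> and makes
        \<open>e' * norm v\<close> strictly smaller than \<open>e\<close>.\<close>
      define e' where "e' = e / (norm v + 1)"
      have np: "norm v + 1 > 0" by (simp add: add_nonneg_pos)
      have e': "e' > 0" "e' * norm v < e"
        using e np by (auto simp: e'_def field_simps)
      then obtain d where d: "d > 0" "\<forall>h. norm h < d \<longrightarrow>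
           (\<forall>vs. length vs = 1 \<longrightarrow> norm (D 1 (y + h) vs - D 1 y vs - D (Suc 1) y (h # vs))
                \<le> e' * norm h * (\<Prod>v\<leftarrow>vs. norm v))"
        using DD[OF y, of e' 1] by blast
      have "norm ((D 1 z [v] - D 1 y [v] - D 2 y [z - y, v]) /\<^sub>R norm (z - y) - 0) < e"
        if z: "z \<noteq> y" "norm (z - y) < d" for z
      proof -
        have "norm (D 1 (y + (z - y)) [v] - D 1 y [v] - D (Suc 1) y [z - y, v]) \<le> e' * norm (z - y) * norm v"
          using d(2)[rule_format, of "z - y" "[v]"] z by simp
        then have "norm (D 1 z [v] - D 1 y [v] - D 2 y [z - y, v]) \<le> (e' * norm v) * norm (z - y)"
          by (simp add: mult_ac numeral_2_eq_2)
        also have "\<dots> < e * norm (z - y)" using e' z by (intro mult_strict_right_mono) auto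
        finally show ?thesis using z unfolding diff_0_right norm_scaleR
          by (simp add: divide_inverse_commute[symmetric] divide_less_eq)
      qed
      then show "\<exists>s>0. \<forall>z. z \<noteq> y \<and> norm (z - y) < s \<longrightarrow> norm ((D 1 z [v] - D 1 y [v] - D 2 y [z - y, v]) /\<^sub>R norm (z - y) - 0) < e"
        using d by blast
    qed
  qed
  obtain r1 K1 where r1: "r1 > 0" "K1 > 0" "ball x r1 \<subseteq> S"
    "\<forall>y\<in>ball x r1. \<forall>vs. length vs = 1 \<longrightarrow> norm (D 1 y vs) \<le> K1 * (\<Prod>v\<leftarrow>vs. norm v)"
    using locbnd[of 1] by (elim exE conjE)
  obtain r2 K2 where r2: "r2 > 0" "K2 > 0" "ball x r2 \<subseteq> S"
    "\<forall>y\<in>ball x r2. \<forall>vs. length vs = 2 \<longrightarrow> norm (D 2 y vs) \<le> K2 * (\<Prod>v\<leftarrow>vs. norm v)"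
    using locbnd[of 2] by (elim exE conjE)
  let ?r = "min r1 r2" and ?K = "max K1 K2"
  show thesis
  proof (rule that[of ?r ?K "\<lambda>y v. D 1 y [v]"])
    show "norm (D 1 y [v]) \<le> ?K * norm v" if "y \<in> ball x ?r" for y v
    proof -
      have "norm (D 1 y [v]) \<le> K1 * norm v" using r1(4)[rule_format, of y "[v]"] that by simp
      also have "\<dots> \<le> ?K * norm v" by (intro mult_right_mono) auto
      finally show ?thesis .
    qed
    show "norm (D 1 y [v] - D 1 z [v]) \<le> ?K * norm (y - z) * norm v"
      if y: "y \<in> ball x ?r" and z: "z \<in> ball x ?r" for y z v
    proof -
      \<comment> \<open>The ball is convex, so the mean value inequality converts the bound on
        \<open>D 2\<close> into a Lipschitz constant for \<open>D 1\<close>.\<close>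
      have "norm (D 1 y [v] - D 1 z [v]) \<le> (K2 * norm v) * norm (y - z)"
      proof (rule differentiable_bound[of "ball x ?r" "\<lambda>y. D 1 y [v]" "\<lambda>y h. D 2 y [h, v]"])
        show "((\<lambda>y. D 1 y [v]) has_derivative (\<lambda>h. D 2 w [h, v])) (at w within ball x ?r)"
          if "w \<in> ball x ?r" for w
          using der1[of w v] that r1(3) has_derivative_at_withinI by fastforce
        show "onorm (\<lambda>h. D 2 w [h, v]) \<le> K2 * norm v" if "w \<in> ball x ?r" for w
          using r2(4)[rule_format, of w "[_,v]"] that r2(2)
          by (intro onorm_bound) (auto simp: mult_ac)
      qed (use y z in auto)
      also have "\<dots> = K2 * (norm (y - z) * norm v)" by simp
      also have "\<dots> \<le> ?K * (norm (y - z) * norm v)" by (intro mult_right_mono) auto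
      also have "\<dots> = ?K * norm (y - z) * norm v" by simp
      finally show ?thesis .
    qed
  qed (use r1 r2 der0 in auto)
qed

text \<open>A minimizing sequence of \<open>w \<mapsto> b w w - 2 f w\<close> is Cauchy by the parallelogram identity.\<close>

lemma Riesz_coercive:
  fixes b :: "'h::{real_inner, banach} \<Rightarrow> 'h \<Rightarrow> real"
  assumes b: "hilbert_inner b" and f: "bounded_linear f"
  shows "\<exists>w. \<forall>v. b w v = f v"
proof -
  interpret b: bounded_bilinear b using b by (simp add: hilbert_inner_def)
  interpret f: bounded_linear f by fact
  have sym: "b u v = b v u" for u v using b by (simp add: hilbert_inner_def)
  obtain m where m: "m > 0" "\<And>v. m * (norm v)\<^sup>2 \<le> b v v" using b by (auto simp: hilbert_inner_def)
  obtain F where F: "F \<ge> 0" "\<And>v. norm (f v) \<le> norm v * F" using f.nonneg_bounded by blast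
  define J where "J w = b w w - 2 * f w" for w
  have lower: "J w \<ge> - (F\<^sup>2 / m)" for w
  proof -
    have "f w \<le> norm w * F" using F(2)[of w] by auto
    moreover have "0 \<le> (m * norm w - F)\<^sup>2 / m" using m by simp
    moreover have "(m * norm w - F)\<^sup>2 / m = m * (norm w)\<^sup>2 - 2 * (norm w * F) + F\<^sup>2 / m"
      using m by (simp add: power2_eq_square field_simps)
    ultimately show ?thesis using m(2)[of w] unfolding J_def by linarith
  qed
  define I where "I = (INF w. J w)"
  have bdd: "bdd_below (range J)" using lower by (meson bdd_belowI2)
  have I: "I \<le> J w" for w unfolding I_def by (rule cINF_lower[OF bdd]) simp
  have "\<exists>w. J w < I + 1 / real (Suc n)" for n
    using cINF_less_iff[of UNIV J "I + 1 / real (Suc n)"] bdd unfolding I_def by simp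
  then obtain w where w: "\<And>n. J (w n) < I + 1 / real (Suc n)" by metis
  have par: "m * (norm (u - v))\<^sup>2 \<le> 2 * (J u - I) + 2 * (J v - I)" for u v
  proof -
    have "J u + J v = 2 * J ((1/2) *\<^sub>R (u + v)) + b (u - v) (u - v) / 2"
      unfolding J_def by (simp add: b.add_left b.add_right b.diff_left b.diff_right b.scaleR_left b.scaleR_right f.add f.scaleR sym[of v u] field_simps)
    then show ?thesis using m(2)[of "u - v"] I[of "(1/2) *\<^sub>R (u + v)"] by simp
  qed
  have "Cauchy w"
  proof (rule metric_CauchyI)
    fix e :: real assume e: "e > 0"
    obtain N where N: "1 / real (Suc N) < m * e\<^sup>2 / 4"
      using reals_Archimedean[of "m * e\<^sup>2 / 4"] e m by (auto simp: inverse_eq_divide)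
    have "dist (w i) (w j) < e" if "i \<ge> N" "j \<ge> N" for i j
    proof -
      have *: "J (w k) - I < m * e\<^sup>2 / 4" if "k \<ge> N" for k
      proof -
        have "1 / real (Suc k) \<le> 1 / real (Suc N)" using that by (simp add: frac_le)
        then show ?thesis using w[of k] N by linarith
      qed
      have "m * (norm (w i - w j))\<^sup>2 < m * e\<^sup>2" using par[of "w i" "w j"] *[OF that(1)] *[OF that(2)] by (simp add: field_simps)
      then show ?thesis using m e by (simp add: dist_norm power_less_imp_less_base)
    qed
    then show "\<exists>M. \<forall>i\<ge>M. \<forall>j\<ge>M. dist (w i) (w j) < e" by blast
  qed
  then obtain l where l: "w \<longlonglongrightarrow> l" using Cauchy_convergent_iff convergent_def by blast
  have "(\<lambda>n. J (w n)) \<longlonglongrightarrow> J l" unfolding J_def using l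
    by (intro tendsto_intros b.tendsto f.tendsto)
  moreover have "(\<lambda>n. I + 1 / real (Suc n)) \<longlonglongrightarrow> I + 0"
    by (intro tendsto_intros LIMSEQ_Suc[OF lim_1_over_n])
  ultimately have "J l \<le> I + 0"
    by (rule LIMSEQ_le) (use w in \<open>auto intro: less_imp_le\<close>)
  then have min: "J l \<le> J u" for u using I[of u] by simp
  have "b l v = f v" for v
  proof (rule ccontr)
    assume ne: "b l v \<noteq> f v"
    define d where "d = b l v - f v"
    have vv: "b v v \<ge> 0" using m(2)[of v] m(1) by (smt (verit) mult_nonneg_nonneg zero_le_power2)
    \<comment> \<open>Up to the added 1, which avoids dividing by zero, this is the minimizer of
      \<open>J\<close> on the line through \<open>l\<close> in direction \<open>v\<close>; it would
      give a value below the minimum.\<close>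
    define t where "t = - d / (b v v + 1)"
    have "J (l + t *\<^sub>R v) = J l + t\<^sup>2 * b v v + 2 * t * d"
      unfolding J_def d_def by (simp add: b.add_left b.add_right b.scaleR_left b.scaleR_right f.add f.scaleR sym[of v l] algebra_simps power2_eq_square)
    then have "0 \<le> t\<^sup>2 * b v v + 2 * t * d" using min[of "l + t *\<^sub>R v"] by simp
    also have "\<dots> \<le> t\<^sup>2 * (b v v + 1) + 2 * t * d" by (simp add: algebra_simps)
    also have "\<dots> = t * (t * (b v v + 1)) + 2 * t * d" by (simp add: power2_eq_square)
    also have "\<dots> = t * d" using vv unfolding t_def by simp
    also have "\<dots> = - (d\<^sup>2 / (b v v + 1))"
      unfolding t_def by (simp add: power2_eq_square)
    finally show False using ne vv unfolding d_def by (simp add: field_simps not_le)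
  qed
  then show ?thesis by blast
qed

section \<open>Energy and length in coordinates\<close>

text \<open>Along the segment the derivative differs from its value at \<open>p\<close> by at most
  \<open>K * norm (p' - p)\<close>, and the mean value inequality for \<open>f\<close> minus its
  linear part multiplies this by the length of the segment once more.\<close>

lemma C11_taylor:
  fixes f :: "'a::real_normed_vector \<Rightarrow> 'b::real_normed_vector"
  assumes K: "K \<ge> 0"
    and der: "\<And>y. y \<in> ball p0 r \<Longrightarrow> (f has_derivative f' y) (at y)"
    and lip: "\<And>y z h. y \<in> ball p0 r \<Longrightarrow> z \<in> ball p0 r \<Longrightarrow> norm (f' y h - f' z h) \<le> K * norm (y - z) * norm h"
    and p: "p \<in> ball p0 r" "p' \<in> ball p0 r"
  shows "norm (f p' - f p - f' p (p' - p)) \<le> K * (norm (p' - p))\<^sup>2"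
proof -
  have seg: "closed_segment p p' \<subseteq> ball p0 r" using p by (simp add: closed_segment_subset)
  have "norm (f p' - f p - f' p (p' - p)) \<le> norm (p' - p) * (K * norm (p' - p))"
  proof (rule differentiable_bound_linearization[where S = "closed_segment p p'" and f' = f'])
    show "p + t *\<^sub>R (p' - p) \<in> closed_segment p p'" if "t \<in> {0..1}" for t
      using that by (auto simp: in_segment algebra_simps intro!: exI[of _ t])
    show "(f has_derivative f' x) (at x within closed_segment p p')" if "x \<in> closed_segment p p'" for x
      using that seg der has_derivative_at_withinI by blast
    show "onorm (f' x - f' p) \<le> K * norm (p' - p)" if x: "x \<in> closed_segment p p'" for x
      unfolding fun_diff_def
    proof (rule onorm_bound)
      fix h
      have "norm (f' x h - f' p h) \<le> K * norm (x - p) * norm h"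
        using x seg p by (intro lip) auto
      also have "\<dots> \<le> K * norm (p' - p) * norm h"
        using segment_bound(1)[OF x] K by (intro mult_right_mono mult_left_mono) auto
      finally show "norm (f' x h - f' p h) \<le> K * norm (p' - p) * norm h" .
    qed (use K in auto)
  qed auto
  then show ?thesis by (simp add: power2_eq_square mult_ac)
qed

lemma bilin_bound:
  fixes B :: "'a::real_normed_vector \<Rightarrow>\<^sub>L 'b::real_normed_vector \<Rightarrow>\<^sub>L real"
  assumes "norm B \<le> c"
  shows "\<bar>B u v\<bar> \<le> c * norm u * norm v"
proof -
  have "\<bar>B u v\<bar> \<le> norm (B u) * norm v" using norm_blinfun[of "B u" v] by simp
  also have "\<dots> \<le> (norm B * norm u) * norm v" by (intro mult_right_mono norm_blinfun) auto
  also have "\<dots> \<le> (c * norm u) * norm v" by (intro mult_right_mono assms) auto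
  finally show ?thesis .
qed

text \<open>A Riemannian metric on a ball of the model space, separated from the manifold. One
  constant \<open>K\<close> serves as bound for \<open>G\<close>, bound for \<open>DG\<close> and
  Lipschitz constant of \<open>DG\<close>, so that all later estimates involve only \<open>K\<close>
  and the coercivity constant \<open>lam\<close>.\<close>

locale metric_ball =
  fixes G :: "'h::real_inner \<Rightarrow> 'h \<Rightarrow>\<^sub>L 'h \<Rightarrow>\<^sub>L real" and DG :: "'h \<Rightarrow> 'h \<Rightarrow> 'h \<Rightarrow>\<^sub>L 'h \<Rightarrow>\<^sub>L real"
    and p0 :: 'h and r K lam :: real
  assumes r_pos: "r > 0" and K_pos: "K > 0" and lam_pos: "lam > 0"
    and G_deriv: "p \<in> ball p0 r \<Longrightarrow> (G has_derivative DG p) (at p)"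
    and DG_bound: "p \<in> ball p0 r \<Longrightarrow> norm (DG p h) \<le> K * norm h"
    and DG_lip: "p \<in> ball p0 r \<Longrightarrow> p' \<in> ball p0 r \<Longrightarrow> norm (DG p h - DG p' h) \<le> K * norm (p - p') * norm h"
    and G_bound: "p \<in> ball p0 r \<Longrightarrow> norm (G p) \<le> K"
    and G_sym: "p \<in> ball p0 r \<Longrightarrow> G p u v = G p v u"
    and G_coercive: "p \<in> ball p0 r \<Longrightarrow> lam * (norm u)\<^sup>2 \<le> G p u u"
begin

lemma G_apply_bound: "p \<in> ball p0 r \<Longrightarrow> \<bar>G p u v\<bar> \<le> K * norm u * norm v"
  by (rule bilin_bound[OF G_bound])

lemma G_apply_deriv:
  assumes "p \<in> ball p0 r"
  shows "((\<lambda>p. G p u v) has_derivative (\<lambda>h. DG p h u v)) (at p)"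
  by (intro bounded_linear.has_derivative[OF blinfun.bounded_linear_left] G_deriv assms)

text \<open>Symmetry of \<open>G\<close> holds on an open ball and can be differentiated
  there.\<close>

lemma DG_sym:
  assumes p: "p \<in> ball p0 r"
  shows "DG p h u v = DG p h v u"
proof -
  have "((\<lambda>p. G p v u) has_derivative (\<lambda>h. DG p h u v)) (at p)"
    by (rule has_derivative_transform_within_open[OF G_apply_deriv[OF p, of u v] open_ball p]) (rule G_sym)
  from has_derivative_unique[OF this G_apply_deriv[OF p, of v u]] show ?thesis by metis
qed

lemma G_lip:
  assumes "p \<in> ball p0 r" "p' \<in> ball p0 r"
  shows "norm (G p - G p') \<le> K * norm (p - p')"
proof (rule differentiable_bound[of "ball p0 r" G DG])
  show "onorm (DG x) \<le> K" if "x \<in> ball p0 r" for x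
    using DG_bound[OF that] K_pos by (intro onorm_bound) auto
qed (use assms in \<open>auto intro: has_derivative_at_withinI[OF G_deriv]\<close>)

lemma G_taylor:
  assumes p: "p \<in> ball p0 r" "p' \<in> ball p0 r"
  shows "norm (G p' - G p - DG p (p' - p)) \<le> K * (norm (p' - p))\<^sup>2"
  by (rule C11_taylor[OF _ G_deriv DG_lip p]) (use K_pos in auto)

text \<open>The term \<open>G (p + e) h h\<close> stays unexpanded at the displaced point, so that
  coercivity can bound it from below and \<open>G_apply_bound\<close> from above. The two errors are
  the Taylor remainder of \<open>G\<close> and the change of \<open>G\<close> in the cross
  term.\<close>

lemma energy_expand:
  assumes p: "p \<in> ball p0 r" "p + e \<in> ball p0 r" and u: "norm u \<le> b"
  shows "\<bar>G (p + e) (u + h) (u + h) - (G p u u + DG p e u u + 2 * G p u h + G (p + e) h h)\<bar>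
    \<le> K * (norm e)\<^sup>2 * b\<^sup>2 + 2 * (K * b * norm e * norm h)"
proof -
  have b: "b \<ge> 0" using u norm_ge_zero[of u] by linarith
  have eq: "G (p + e) (u + h) (u + h) - (G p u u + DG p e u u + 2 * G p u h + G (p + e) h h)
    = (G (p + e) - G p - DG p e) u u + 2 * (G (p + e) - G p) u h"
    by (simp add: blinfun.add_left blinfun.add_right blinfun.diff_left G_sym[OF p(2), of h u])
  have "\<bar>(G (p + e) - G p - DG p e) u u\<bar> \<le> K * (norm e)\<^sup>2 * norm u * norm u"
    using G_taylor[OF p] by (intro bilin_bound) simp
  also have "\<dots> \<le> K * (norm e)\<^sup>2 * b * b"
    using u b K_pos by (intro mult_mono) auto
  finally have 1: "\<bar>(G (p + e) - G p - DG p e) u u\<bar> \<le> K * (norm e)\<^sup>2 * b\<^sup>2"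
    by (simp add: power2_eq_square)
  have "\<bar>(G (p + e) - G p) u h\<bar> \<le> K * norm e * norm u * norm h"
    using G_lip[OF p(2,1)] by (intro bilin_bound) simp
  also have "\<dots> \<le> K * norm e * b * norm h"
    using u K_pos by (intro mult_right_mono mult_left_mono) auto
  finally have 2: "\<bar>(G (p + e) - G p) u h\<bar> \<le> K * b * norm e * norm h" by (simp add: mult_ac)
  show ?thesis unfolding eq using 1 2 by linarith
qed

text \<open>The gain \<open>lam * (norm h)\<^sup>2\<close> is split in two: one half absorbs the
  cross error by Young's inequality, the other half absorbs \<open>2 * k * inner e h\<close>. Each
  half costs \<open>lam / 32 * (norm e)\<^sup>2\<close>, the first because \<open>b\<close> is small
  and the second because \<open>k \<le> lam / 8\<close>. Together they give the
  \<open>lam / 16\<close>.\<close>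

lemma energy_lower:
  assumes p: "p \<in> ball p0 r" "p + e \<in> ball p0 r" and u: "norm u \<le> b"
    and b: "K * b\<^sup>2 + 2 * K\<^sup>2 * b\<^sup>2 / lam \<le> lam / 32" and k: "0 \<le> k" "k \<le> lam / 8"
  shows "G p u u + DG p e u u + 2 * G p u h - (lam / 16 * (norm e)\<^sup>2 + 2 * k * inner e h)
    \<le> G (p + e) (u + h) (u + h)"
proof -
  let ?E = "norm e" and ?H = "norm h"
  have 1: "G p u u + DG p e u u + 2 * G p u h + G (p + e) h h - (K * ?E\<^sup>2 * b\<^sup>2 + 2 * (K * b * ?E * ?H))
     \<le> G (p + e) (u + h) (u + h)"
    using energy_expand[OF p u, of h] by linarith
  have 2: "lam * ?H\<^sup>2 \<le> G (p + e) h h" by (rule G_coercive[OF p(2)])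
  have "0 \<le> (lam * ?H - 2 * K * b * ?E)\<^sup>2 / (2 * lam)" using lam_pos by simp
  also have "\<dots> = lam / 2 * ?H\<^sup>2 - 2 * (K * b * ?E * ?H) + 2 * K\<^sup>2 * b\<^sup>2 / lam * ?E\<^sup>2"
    using lam_pos by (simp add: power2_eq_square field_simps)
  finally have 3: "2 * (K * b * ?E * ?H) \<le> lam / 2 * ?H\<^sup>2 + 2 * K\<^sup>2 * b\<^sup>2 / lam * ?E\<^sup>2" by simp
  have "(K * b\<^sup>2 + 2 * K\<^sup>2 * b\<^sup>2 / lam) * ?E\<^sup>2 \<le> lam / 32 * ?E\<^sup>2"
    by (intro mult_right_mono b) auto
  then have 4: "K * ?E\<^sup>2 * b\<^sup>2 + 2 * K\<^sup>2 * b\<^sup>2 / lam * ?E\<^sup>2 \<le> lam / 32 * ?E\<^sup>2" by (simp add: algebra_simps)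
  have "\<bar>inner e h\<bar> \<le> ?E * ?H" by (rule Cauchy_Schwarz_ineq2)
  then have "2 * k * \<bar>inner e h\<bar> \<le> 2 * (lam / 8) * (?E * ?H)"
    using k by (intro mult_mono) auto
  moreover have "- (2 * k * inner e h) \<le> 2 * k * \<bar>inner e h\<bar>"
    using k mult_left_mono[of "- inner e h" "\<bar>inner e h\<bar>" "2 * k"] by simp
  ultimately have 5: "- (2 * k * inner e h) \<le> lam / 4 * (?E * ?H)" by simp
  have "0 \<le> lam / 2 * (?H - ?E / 4)\<^sup>2" using lam_pos by simp
  also have "\<dots> = lam / 2 * ?H\<^sup>2 - lam / 4 * (?E * ?H) + lam / 32 * ?E\<^sup>2"
    by (simp add: power2_eq_square algebra_simps)
  finally have 6: "lam / 4 * (?E * ?H) \<le> lam / 2 * ?H\<^sup>2 + lam / 32 * ?E\<^sup>2" by simp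
  have 7: "lam / 16 * ?E\<^sup>2 = lam / 32 * ?E\<^sup>2 + lam / 32 * ?E\<^sup>2" "lam * ?H\<^sup>2 = lam / 2 * ?H\<^sup>2 + lam / 2 * ?H\<^sup>2" by simp_all
  show ?thesis using 1 2 3 4 5 6 7 by linarith
qed

text \<open>Under the scaling \<open>norm e \<le> c\<close>, \<open>norm h \<le> X * c\<close> every
  remainder is quadratic in \<open>c\<close>, and the three coefficients add up to the square
  \<open>K * (b + X)\<^sup>2\<close>.\<close>

lemma energy_upper:
  assumes p: "p \<in> ball p0 r" "p + e \<in> ball p0 r" and u: "norm u \<le> b"
    and e: "norm e \<le> c" and h: "norm h \<le> X * c" and X: "X \<ge> 0"
  shows "G (p + e) (u + h) (u + h) \<le> G p u u + DG p e u u + 2 * G p u h + K * (b + X)\<^sup>2 * c\<^sup>2"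
proof -
  have b: "b \<ge> 0" using u norm_ge_zero[of u] by linarith
  have c: "c \<ge> 0" using e norm_ge_zero[of e] by linarith
  have "G (p + e) h h \<le> K * norm h * norm h" using G_apply_bound[OF p(2), of h h] by simp
  also have "\<dots> \<le> K * (X * c) * (X * c)" using h K_pos c X by (intro mult_mono) auto
  finally have 1: "G (p + e) h h \<le> K * X\<^sup>2 * c\<^sup>2" by (simp add: power2_eq_square mult_ac)
  have 2: "K * (norm e)\<^sup>2 * b\<^sup>2 \<le> K * c\<^sup>2 * b\<^sup>2"
    using e K_pos by (intro mult_right_mono mult_left_mono power_mono) auto
  have "K * b * norm e * norm h \<le> K * b * c * (X * c)"
    using e h K_pos b c by (intro mult_mono) auto
  then have 3: "2 * (K * b * norm e * norm h) \<le> 2 * K * b * X * c\<^sup>2" by (simp add: power2_eq_square mult_ac)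
  have 4: "K * (b + X)\<^sup>2 * c\<^sup>2 = K * c\<^sup>2 * b\<^sup>2 + 2 * K * b * X * c\<^sup>2 + K * X\<^sup>2 * c\<^sup>2"
    by (simp add: power2_eq_square algebra_simps)
  show ?thesis using energy_expand[OF p u, of h] 1 2 3 4 by linarith
qed

end

section \<open>Monotonicity and a Gronwall argument on compact intervals\<close>

lemma Icc_mono_from_deriv:
  fixes f :: "real \<Rightarrow> real"
  assumes "a \<le> b" and der: "\<And>t. t \<in> {a..b} \<Longrightarrow> (f has_real_derivative f' t) (at t within {a..b})"
    and nonneg: "\<And>t. t \<in> {a..b} \<Longrightarrow> 0 \<le> f' t"
  shows "f a \<le> f b"
proof (rule DERIV_nonneg_imp_increasing_open[OF \<open>a \<le> b\<close>])
  show "\<exists>y. (f has_real_derivative y) (at t) \<and> 0 \<le> y" if "a < t" "t < b" for t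
    using der[of t] nonneg[of t] that by (auto simp: at_within_Icc_at intro!: exI[of _ "f' t"])
  show "continuous_on {a..b} f"
    using der by (meson DERIV_continuous continuous_on_eq_continuous_within)
qed

text \<open>On an interval of half-length at most \<open>1 / (2 * C)\<close> the mean value
  inequality bounds the maximum of \<open>norm (f t)\<close> by half of itself, so the maximum is
  0.\<close>

lemma gronwall_zero:
  fixes f :: "real \<Rightarrow> 'a::real_normed_vector"
  assumes d: "d > 0" and C: "C > 0"
    and der: "\<And>t. \<bar>t - t0\<bar> \<le> d \<Longrightarrow> (f has_vector_derivative f' t) (at t)"
    and bnd: "\<And>t. \<bar>t - t0\<bar> \<le> d \<Longrightarrow> norm (f' t) \<le> C * norm (f t)"
    and "f t0 = 0"
  shows "\<exists>e>0. \<forall>t. \<bar>t - t0\<bar> \<le> e \<longrightarrow> f t = 0"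
proof -
  define e where "e = min d (1 / (2 * C))"
  have e: "e > 0" "e \<le> d" "C * e \<le> 1 / 2" using d C by (auto simp: e_def field_simps min_def)
  let ?I = "{t0 - e..t0 + e}"
  have I: "\<bar>t - t0\<bar> \<le> d" if "t \<in> ?I" for t using that e by auto
  have "continuous_on ?I f"
    using der[OF I] by (meson continuous_at_imp_continuous_on has_vector_derivative_continuous)
  then obtain t1 where t1: "t1 \<in> ?I" "\<And>t. t \<in> ?I \<Longrightarrow> norm (f t) \<le> norm (f t1)"
    using continuous_attains_sup[of ?I "\<lambda>t. norm (f t)"] e continuous_on_norm by fastforce
  have "norm (f t1 - f t0) \<le> (C * norm (f t1)) * norm (t1 - t0)"
  proof (rule differentiable_bound[of ?I f "\<lambda>t h. h *\<^sub>R f' t"])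
    show "(f has_derivative (\<lambda>h. h *\<^sub>R f' t)) (at t within ?I)" if "t \<in> ?I" for t
      using der[OF I[OF that]] by (simp add: has_vector_derivative_def has_derivative_at_withinI)
    show "onorm (\<lambda>h. h *\<^sub>R f' t) \<le> C * norm (f t1)" if t: "t \<in> ?I" for t
    proof (rule onorm_bound)
      fix h :: real
      have "norm (f' t) \<le> C * norm (f t)" by (rule bnd[OF I[OF t]])
      also have "\<dots> \<le> C * norm (f t1)" using t1(2)[OF t] C by (intro mult_left_mono) auto
      finally show "norm (h *\<^sub>R f' t) \<le> C * norm (f t1) * norm h"
        by (simp add: mult.commute mult_left_mono)
    qed (use C in auto)
  qed (use t1 e in auto)
  also have "\<dots> \<le> (C * norm (f t1)) * e" using t1(1) C by (intro mult_left_mono) (auto simp: abs_le_iff)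
  also have "\<dots> = (C * e) * norm (f t1)" by simp
  also have "\<dots> \<le> 1 / 2 * norm (f t1)" by (intro mult_right_mono e) auto
  finally have "norm (f t1) = 0" using \<open>f t0 = 0\<close> by simp
  then have "f t = 0" if "\<bar>t - t0\<bar> \<le> e" for t
    using t1(2)[of t] that by (simp add: abs_le_iff)
  then show ?thesis using e by blast
qed

section \<open>Uniqueness and length comparison for the momentum equation\<close>

context metric_ball
begin

lemma G_continuous: "continuous_on (ball p0 r) G"
  using G_deriv by (meson continuous_at_imp_continuous_on has_derivative_continuous)

text \<open>Gronwall's argument is applied to the pair of differences of positions and momenta, the
  canonical variables of the geodesic flow. Indexing the two solutions by a boolean states their
  common hypotheses once.\<close>

lemma momentum_unique:
  assumes d: "d > 0" and b: "b > 0"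
    and q: "\<And>i t. \<bar>t - t0\<bar> \<le> d \<Longrightarrow> q i t \<in> ball p0 r"
      "\<And>i t. \<bar>t - t0\<bar> \<le> d \<Longrightarrow> (q i has_vector_derivative q' i t) (at t)"
      "\<And>i t. \<bar>t - t0\<bar> \<le> d \<Longrightarrow> norm (q' i t) \<le> b"
      "\<And>i t. \<bar>t - t0\<bar> \<le> d \<Longrightarrow> ((\<lambda>s. G (q i s) (q' i s)) has_vector_derivative P' i t) (at t)"
      "\<And>i t u. \<bar>t - t0\<bar> \<le> d \<Longrightarrow> blinfun_apply (P' i t) u = DG (q i t) u (q' i t) (q' i t) / 2"
    and init: "q True t0 = q False t0" "q' True t0 = q' False t0"
  shows "\<exists>e>0. \<forall>t. \<bar>t - t0\<bar> \<le> e \<longrightarrow> q True t = q False t"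
proof -
  define f where "f t = (q True t - q False t, G (q True t) (q' True t) - G (q False t) (q' False t))" for t
  define f' where "f' t = (q' True t - q' False t, P' True t - P' False t)" for t
  define c where "c = (1 + K * b) / lam"
  have c: "c > 0" using K_pos lam_pos b by (simp add: c_def add_pos_pos)
  have "\<exists>e>0. \<forall>t. \<bar>t - t0\<bar> \<le> e \<longrightarrow> f t = 0"
  proof (rule gronwall_zero[of d "c + (K * b\<^sup>2 + 2 * K * b * c)"])
    show "0 < c + (K * b\<^sup>2 + 2 * K * b * c)" using c K_pos b by (simp add: add_pos_pos)
    fix t assume t: "\<bar>t - t0\<bar> \<le> d"
    show "(f has_vector_derivative f' t) (at t)"
      unfolding f_def f'_def using q(2,4)[OF t]
      by (intro has_vector_derivative_Pair has_vector_derivative_diff)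
    let ?dq = "q True t - q False t" and ?dv = "q' True t - q' False t"
    let ?dP = "G (q True t) (q' True t) - G (q False t) (q' False t)"
    have n: "norm ?dq \<le> norm (f t)" "norm ?dP \<le> norm (f t)"
      using norm_fst_le[of ?dq ?dP] norm_snd_le[of ?dP ?dq] by (auto simp: f_def)
    \<comment> \<open>The velocity is not a component of \<open>f\<close>; coercivity recovers its
      difference from the differences of momentum and position.\<close>
    have "lam * (norm ?dv)\<^sup>2 \<le> G (q True t) ?dv ?dv" by (rule G_coercive[OF q(1)[OF t]])
    also have "\<dots> = ?dP ?dv - (G (q True t) - G (q False t)) (q' False t) ?dv"
      by (simp add: blinfun.diff_left blinfun.diff_right)
    also have "\<dots> \<le> norm ?dP * norm ?dv + K * norm ?dq * b * norm ?dv"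
    proof -
      have "?dP ?dv \<le> norm ?dP * norm ?dv" using norm_blinfun[of ?dP ?dv] by auto
      moreover have "\<bar>(G (q True t) - G (q False t)) (q' False t) ?dv\<bar> \<le> K * norm ?dq * norm (q' False t) * norm ?dv"
        by (rule bilin_bound[OF G_lip[OF q(1)[OF t] q(1)[OF t]]])
      moreover have "K * norm ?dq * norm (q' False t) * norm ?dv \<le> K * norm ?dq * b * norm ?dv"
        using K_pos q(3)[OF t] by (intro mult_right_mono mult_left_mono) auto
      ultimately show ?thesis by linarith
    qed
    also have "\<dots> \<le> norm (f t) * norm ?dv + K * norm (f t) * b * norm ?dv"
      using n K_pos b by (intro add_mono mult_right_mono mult_left_mono) auto
    also have "\<dots> = lam * (c * norm (f t) * norm ?dv)"
      using lam_pos by (simp add: c_def field_simps)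
    finally have "norm ?dv * norm ?dv \<le> c * norm (f t) * norm ?dv"
      using lam_pos by (simp add: power2_eq_square)
    then have dv: "norm ?dv \<le> c * norm (f t)"
      using c by (cases "norm ?dv = 0") auto
    have "norm (P' True t - P' False t) \<le> (K * b\<^sup>2 + 2 * K * b * c) * norm (f t)"
    proof (rule norm_blinfun_bound)
      fix u
      let ?v1 = "q' True t" and ?v2 = "q' False t" and ?D1 = "DG (q True t) u" and ?D2 = "DG (q False t) u"
      \<comment> \<open>A telescoping sum that changes the base point, the first velocity argument
        and the second velocity argument one at a time.\<close>
      have "2 * (P' True t - P' False t) u = (?D1 - ?D2) ?v1 ?v1 + ?D2 ?dv ?v1 + ?D2 ?v2 ?dv"
        by (simp add: blinfun.diff_left blinfun.diff_right q(5)[OF t])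
      moreover have "\<bar>x\<bar> \<le> S" if "2 * x = x1 + x2 + x3" "\<bar>x1\<bar> \<le> y1" "\<bar>x2\<bar> \<le> y2" "\<bar>x3\<bar> \<le> y3"
          "S = y1 + y2 + y3" "0 \<le> S" for x x1 x2 x3 y1 y2 y3 S :: real
        using that by linarith
      moreover have "\<bar>(?D1 - ?D2) ?v1 ?v1\<bar> \<le> (K * norm (f t) * norm u) * b * b"
      proof -
        have "norm (?D1 - ?D2) \<le> K * norm ?dq * norm u" by (rule DG_lip[OF q(1)[OF t] q(1)[OF t]])
        also have "\<dots> \<le> K * norm (f t) * norm u" using n K_pos by (intro mult_right_mono mult_left_mono) auto
        finally have "\<bar>(?D1 - ?D2) ?v1 ?v1\<bar> \<le> (K * norm (f t) * norm u) * norm ?v1 * norm ?v1"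
          by (rule bilin_bound)
        also have "\<dots> \<le> (K * norm (f t) * norm u) * b * b"
          using K_pos q(3)[OF t] b by (intro mult_mono) auto
        finally show ?thesis .
      qed
      moreover have "\<bar>?D2 ?dv ?v1\<bar> \<le> (K * norm u) * (c * norm (f t)) * b"
      proof -
        have "\<bar>?D2 ?dv ?v1\<bar> \<le> (K * norm u) * norm ?dv * norm ?v1"
          by (rule bilin_bound[OF DG_bound[OF q(1)[OF t]]])
        also have "\<dots> \<le> (K * norm u) * (c * norm (f t)) * b"
          using K_pos q(3)[OF t] b dv c by (intro mult_mono) auto
        finally show ?thesis .
      qed
      moreover have "\<bar>?D2 ?v2 ?dv\<bar> \<le> (K * norm u) * b * (c * norm (f t))"
      proof -
        have "\<bar>?D2 ?v2 ?dv\<bar> \<le> (K * norm u) * norm ?v2 * norm ?dv"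
          by (rule bilin_bound[OF DG_bound[OF q(1)[OF t]]])
        also have "\<dots> \<le> (K * norm u) * b * (c * norm (f t))"
          using K_pos q(3)[OF t] b dv c by (intro mult_mono) auto
        finally show ?thesis .
      qed
      moreover have "(K * b\<^sup>2 + 2 * K * b * c) * norm (f t) * norm u
          = (K * norm (f t) * norm u) * b * b + (K * norm u) * (c * norm (f t)) * b + (K * norm u) * b * (c * norm (f t))"
        by (simp add: power2_eq_square algebra_simps)
      moreover have "0 \<le> (K * b\<^sup>2 + 2 * K * b * c) * norm (f t) * norm u"
        using K_pos b c by simp
      ultimately show "norm ((P' True t - P' False t) u) \<le> (K * b\<^sup>2 + 2 * K * b * c) * norm (f t) * norm u"
        unfolding real_norm_def by blast
    qed (use K_pos b c in simp)
    then show "norm (f' t) \<le> (c + (K * b\<^sup>2 + 2 * K * b * c)) * norm (f t)"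
      using norm_Pair_le[of ?dv "P' True t - P' False t"] dv unfolding f'_def by (simp add: algebra_simps)
  qed (use d init in \<open>auto simp: f_def zero_prod_def\<close>)
  then show ?thesis by (auto simp: f_def zero_prod_def)
qed

text \<open>The geodesic \<open>q0\<close> is run at the normalized arc length \<open>T\<close> of \<open>q1\<close> (made strictly increasing by adding
  \<open>e > 0\<close> to the speed), which turns the energy estimate into a length estimate. In \<open>F\<close> the boundary term
  of the first variation is corrected by \<open>k |eta|\<^sup>2\<close>, whose increasing weight absorbs the negative
  multiple of \<open>|eta|\<^sup>2\<close> in the expansion, so that no Poincare inequality is needed.\<close>

lemma length_lower:
  assumes q0: "\<And>t. t \<in> {0..1} \<Longrightarrow> q0 t \<in> ball p0 r"
      "\<And>t. t \<in> {0..1} \<Longrightarrow> (q0 has_vector_derivative q0' t) (at t within {0..1})"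
      "\<And>t. t \<in> {0..1} \<Longrightarrow> norm (q0' t) \<le> b"
      "\<And>t. t \<in> {0..1} \<Longrightarrow> G (q0 t) (q0' t) (q0' t) = a\<^sup>2"
      "\<And>t. t \<in> {0..1} \<Longrightarrow> ((\<lambda>s. G (q0 s) (q0' s)) has_vector_derivative P' t) (at t within {0..1})"
      "\<And>t u. t \<in> {0..1} \<Longrightarrow> blinfun_apply (P' t) u = DG (q0 t) u (q0' t) (q0' t) / 2"
    and q1: "\<And>t. t \<in> {0..1} \<Longrightarrow> q1 t \<in> ball p0 r"
      "\<And>t. t \<in> {0..1} \<Longrightarrow> (q1 has_vector_derivative q1' t) (at t within {0..1})"
      "continuous_on {0..1} q1'"
    and end1: "q1 1 = q0 1"
    and b: "K * b\<^sup>2 + 2 * K\<^sup>2 * b\<^sup>2 / lam \<le> lam / 32"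
  shows "a\<^sup>2 - 2 * G (q0 0) (q0' 0) (q1 0 - q0 0) + lam / 16 * (norm (q1 0 - q0 0))\<^sup>2
    \<le> (integral {0..1} (\<lambda>t. sqrt (G (q1 t) (q1' t) (q1' t))))\<^sup>2"
    (is "?X \<le> _")
proof -
  define ell where "ell t = sqrt (G (q1 t) (q1' t) (q1' t))" for t
  define L where "L = integral {0..1} ell"
  have "continuous_on {0..1} q1"
    using q1(2) by (meson continuous_on_eq_continuous_within has_vector_derivative_continuous)
  then have "continuous_on {0..1} (\<lambda>t. G (q1 t))"
    by (rule continuous_on_compose2[OF G_continuous]) (use q1(1) in blast)
  then have cont: "continuous_on {0..1} ell"
    unfolding ell_def by (intro continuous_intros q1(3))
  have Gnn: "0 \<le> G (q1 t) u u" if "t \<in> {0..1}" for t u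
    using G_coercive[OF q1(1)[OF that], of u] lam_pos by (smt (verit) mult_nonneg_nonneg zero_le_power2)
  have ell0: "0 \<le> ell t" if "t \<in> {0..1}" for t using Gnn[OF that] by (simp add: ell_def)
  have ell2: "(ell t)\<^sup>2 = G (q1 t) (q1' t) (q1' t)" if "t \<in> {0..1}" for t using Gnn[OF that] by (simp add: ell_def)
  have L0: "0 \<le> L" unfolding L_def using ell0 cont by (intro integral_nonneg integrable_continuous_real) auto
  have main: "?X \<le> (L + e)\<^sup>2" if e: "e > 0" for e
  proof -
    define T' where "T' t = (ell t + e) / (L + e)" for t
    define T where "T t = integral {0..t} T'" for t
    have Le: "L + e > 0" using L0 e by simp
    have contT: "continuous_on {0..1} T'" unfolding T'_def using Le by (intro continuous_intros cont) auto
    have T'pos: "T' t > 0" if "t \<in> {0..1}" for t using ell0[OF that] e Le by (simp add: T'_def)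
    have derT: "(T has_real_derivative T' t) (at t within {0..1})" if "t \<in> {0..1}" for t
      unfolding T_def[abs_def] by (rule integral_has_real_derivative[OF contT that])
    have T0: "T 0 = 0" by (simp add: T_def)
    have T1: "T 1 = 1"
    proof -
      have "integral {0..1} (\<lambda>t. ell t + e) = L + e"
        unfolding L_def using cont by (subst integral_add) (auto intro: integrable_continuous_real)
      then show ?thesis using Le by (simp add: T_def T'_def[abs_def])
    qed
    have Tr: "T t \<in> {0..1}" if t: "t \<in> {0..1}" for t
    proof -
      have "T 0 \<le> T t"
        by (rule Icc_mono_from_deriv[where f' = T']) (use t in \<open>auto intro!: DERIV_subset[OF derT] less_imp_le[OF T'pos]\<close>)
      moreover have "T t \<le> T 1"
        by (rule Icc_mono_from_deriv[where f' = T']) (use t in \<open>auto intro!: DERIV_subset[OF derT] less_imp_le[OF T'pos]\<close>)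
      ultimately show ?thesis using T0 T1 by simp
    qed
    have derTv: "(T has_vector_derivative T' t) (at t within {0..1})" if "t \<in> {0..1}" for t
      using derT[OF that] by (simp add: has_real_derivative_iff_has_vector_derivative)
    have sub: "T ` {0..1} \<subseteq> {0..1}" using Tr by auto
    define eta where "eta t = q1 t - q0 (T t)" for t
    define eta' where "eta' t = q1' t - T' t *\<^sub>R q0' (T t)" for t
    have dereta: "(eta has_vector_derivative eta' t) (at t within {0..1})" if t: "t \<in> {0..1}" for t
      unfolding eta_def eta'_def
      using vector_diff_chain_within[OF derTv[OF t] has_vector_derivative_within_subset[OF q0(2)[OF Tr[OF t]] sub]]
      by (intro has_vector_derivative_diff q1(2)[OF t]) (simp add: o_def)
    define P where "P t = G (q0 t) (q0' t)" for t
    have derP: "((\<lambda>t. P (T t)) has_vector_derivative T' t *\<^sub>R P' (T t)) (at t within {0..1})" if t: "t \<in> {0..1}" for t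
      unfolding P_def
      using vector_diff_chain_within[OF derTv[OF t] has_vector_derivative_within_subset[OF q0(5)[OF Tr[OF t]] sub]]
      by (simp add: o_def)
    define k where "k t = lam / 16 * (1 + T t)" for t
    define F where "F t = 2 * P (T t) (eta t) - k t * inner (eta t) (eta t)" for t
    define F' where "F' t = 2 * (P (T t) (eta' t) + T' t * P' (T t) (eta t))
        - (k t * (2 * inner (eta t) (eta' t)) + lam / 16 * T' t * inner (eta t) (eta t))" for t
    have derF: "(F has_real_derivative F' t) (at t within {0..1})" if t: "t \<in> {0..1}" for t
    proof -
      have 1: "((\<lambda>t. P (T t) (eta t)) has_vector_derivative (P (T t) (eta' t) + (T' t *\<^sub>R P' (T t)) (eta t))) (at t within {0..1})"
        by (rule bounded_bilinear.has_vector_derivative[OF bounded_bilinear_blinfun_apply derP[OF t] dereta[OF t]])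
      have 2: "((\<lambda>t. inner (eta t) (eta t)) has_vector_derivative (inner (eta t) (eta' t) + inner (eta' t) (eta t))) (at t within {0..1})"
        by (rule bounded_bilinear.has_vector_derivative[OF bounded_bilinear_inner dereta[OF t] dereta[OF t]])
      show ?thesis unfolding F_def F'_def k_def
        using 1 2 derT[OF t] unfolding has_real_derivative_iff_has_vector_derivative[symmetric]
        by (auto intro!: derivative_eq_intros simp: blinfun.scaleR_left inner_commute field_simps)
    qed
    have F'le: "F' t \<le> ((L + e)\<^sup>2 - a\<^sup>2) * T' t" if t: "t \<in> {0..1}" for t
    proof -
      \<comment> \<open>The difference of velocities once \<open>q1\<close> is also parametrized by
        \<open>T\<close>; in this parameter \<open>eta\<close> has derivative
        \<open>h\<close>.\<close>
      define h where "h = (1 / T' t) *\<^sub>R q1' t - q0' (T t)"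
      note Tt = Tr[OF t]
      have eta'h: "eta' t = T' t *\<^sub>R h" using T'pos[OF t] by (simp add: eta'_def h_def algebra_simps)
      have pe: "q0 (T t) + eta t = q1 t" by (simp add: eta_def)
      have uh: "q0' (T t) + h = (1 / T' t) *\<^sub>R q1' t" by (simp add: h_def)
      have k: "0 \<le> k t" "k t \<le> lam / 8" using Tt lam_pos by (auto simp: k_def)
      have "G (q0 (T t)) (q0' (T t)) (q0' (T t)) + DG (q0 (T t)) (eta t) (q0' (T t)) (q0' (T t)) + 2 * G (q0 (T t)) (q0' (T t)) h
          - (lam / 16 * (norm (eta t))\<^sup>2 + 2 * k t * inner (eta t) h) \<le> G (q1 t) ((1 / T' t) *\<^sub>R q1' t) ((1 / T' t) *\<^sub>R q1' t)"
        using energy_lower[OF q0(1)[OF Tt] _ q0(3)[OF Tt] b k, of "eta t" h] q1(1)[OF t] unfolding pe uh by simp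
      also have "\<dots> = (ell t / T' t)\<^sup>2"
        by (simp add: blinfun.scaleR_left blinfun.scaleR_right ell2[OF t, unfolded power2_eq_square] power2_eq_square)
      also have "\<dots> \<le> (L + e)\<^sup>2"
      proof (rule power_mono)
        \<comment> \<open>This is the purpose of the reparametrization: with respect to
          \<open>T\<close> the speed of \<open>q1\<close> never exceeds its total length plus
          \<open>e\<close>.\<close>
        show "ell t / T' t \<le> L + e" using ell0[OF t] e Le L0 by (simp add: T'_def field_simps)
        show "0 \<le> ell t / T' t" using ell0[OF t] T'pos[OF t] by simp
      qed
      finally have "a\<^sup>2 + 2 * P' (T t) (eta t) + 2 * P (T t) h - (lam / 16 * inner (eta t) (eta t) + 2 * k t * inner (eta t) h) \<le> (L + e)\<^sup>2"
        using q0(4)[OF Tt] q0(6)[OF Tt, of "eta t"] by (simp add: P_def power2_norm_eq_inner)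
      then have "T' t * (2 * P' (T t) (eta t) + 2 * P (T t) h - (lam / 16 * inner (eta t) (eta t) + 2 * k t * inner (eta t) h))
          \<le> T' t * ((L + e)\<^sup>2 - a\<^sup>2)" using T'pos[OF t] by (intro mult_left_mono) auto
      then show ?thesis by (simp add: F'_def eta'h blinfun.scaleR_right algebra_simps)
    qed
    have "((L + e)\<^sup>2 - a\<^sup>2) * T 0 - F 0 \<le> ((L + e)\<^sup>2 - a\<^sup>2) * T 1 - F 1"
    proof (rule Icc_mono_from_deriv[where f = "\<lambda>t. ((L + e)\<^sup>2 - a\<^sup>2) * T t - F t" and f' = "\<lambda>t. ((L + e)\<^sup>2 - a\<^sup>2) * T' t - F' t"])
      show "((\<lambda>t. ((L + e)\<^sup>2 - a\<^sup>2) * T t - F t) has_real_derivative ((L + e)\<^sup>2 - a\<^sup>2) * T' t - F' t) (at t within {0..1})"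
        if "t \<in> {0..1}" for t
        using derF[OF that] derT[OF that] by (auto intro!: derivative_eq_intros)
    qed (use F'le in auto)
    moreover have "F 1 = 0" using T1 end1 by (simp add: F_def eta_def)
    moreover have "F 0 = 2 * G (q0 0) (q0' 0) (q1 0 - q0 0) - lam / 16 * (norm (q1 0 - q0 0))\<^sup>2"
      using T0 by (simp add: F_def eta_def k_def P_def power2_norm_eq_inner)
    ultimately show ?thesis using T0 T1 by simp
  qed
  show ?thesis
  proof (cases "?X \<ge> 0")
    case True
    have "sqrt ?X \<le> L + e" if "e > 0" for e
      using main[OF that] L0 that by (intro real_le_lsqrt) auto
    then have "sqrt ?X \<le> L" by (rule field_le_epsilon)
    then have "(sqrt ?X)\<^sup>2 \<le> L\<^sup>2" using True by (intro power_mono) auto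
    then show ?thesis using True by (simp add: L_def ell_def[abs_def])
  next
    case False
    then show ?thesis by (meson le_less_linear order_trans less_imp_le zero_le_power2)
  qed
qed

end

section \<open>Riemannian Hilbert manifolds\<close>

locale riem =
  fixes M :: "('m::t2_space, 'h::{real_inner, banach, second_countable_topology}) riemannian"
  assumes rhm: "riemannian_hilbert_manifold M"
begin

section \<open>Charts and changes of coordinates\<close>

lemma atlas_chart:
  assumes "c \<in> atlas M"
  shows chart_open: "open (fst c)"
    and chart_image_open: "open (snd c ` fst c)"
    and chart_homeo: "homeomorphism (fst c) (snd c ` fst c) (snd c) (chart_inv c)"
  using rhm assms by (auto simp: riemannian_hilbert_manifold_def smooth_atlas_def is_chart_def)

lemma chart_inv_apply [simp]: "c \<in> atlas M \<Longrightarrow> p \<in> fst c \<Longrightarrow> chart_inv c (snd c p) = p"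
  using chart_homeo by (meson homeomorphism_apply1)

lemma apply_chart_inv [simp]: "c \<in> atlas M \<Longrightarrow> z \<in> snd c ` fst c \<Longrightarrow> snd c (chart_inv c z) = z"
  using chart_homeo by (meson homeomorphism_apply2)

lemma chart_inv_mem [simp]: "c \<in> atlas M \<Longrightarrow> z \<in> snd c ` fst c \<Longrightarrow> chart_inv c z \<in> fst c"
  by (auto)

lemma isCont_chart: "c \<in> atlas M \<Longrightarrow> p \<in> fst c \<Longrightarrow> isCont (snd c) p"
  using chart_homeo chart_open by (meson continuous_on_eq_continuous_at homeomorphism_cont1)

lemma isCont_chart_inv: "c \<in> atlas M \<Longrightarrow> z \<in> snd c ` fst c \<Longrightarrow> isCont (chart_inv c) z"
  using chart_homeo chart_image_open by (meson continuous_on_eq_continuous_at homeomorphism_cont2)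

lemma chart_at_atlas [simp]: "chart_at M x \<in> atlas M" and chart_at_mem [simp]: "x \<in> fst (chart_at M x)"
proof -
  have "(\<Union>c\<in>atlas M. fst c) = UNIV"
    using rhm by (simp add: riemannian_hilbert_manifold_def smooth_atlas_def)
  then have "\<exists>c. c \<in> atlas M \<and> x \<in> fst c" by blast
  from someI_ex[OF this] show "chart_at M x \<in> atlas M" "x \<in> fst (chart_at M x)"
    by (auto simp: chart_at_def)
qed

lemma transition_smooth:
  "c \<in> atlas M \<Longrightarrow> c' \<in> atlas M \<Longrightarrow> smooth_on (snd c ` (fst c \<inter> fst c')) (snd c' \<circ> chart_inv c)"
  using rhm by (auto simp: riemannian_hilbert_manifold_def smooth_atlas_def)

lemma coord_change_deriv:
  assumes "c \<in> atlas M" "c' \<in> atlas M" "x \<in> fst c" "x \<in> fst c'"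
  shows "((snd c' \<circ> chart_inv c) has_derivative coord_change c c' x) (at (snd c x))"
proof -
  have "snd c x \<in> snd c ` (fst c \<inter> fst c')" using assms by blast
  from smooth_on_locally_C11[OF transition_smooth[OF assms(1,2)] this]
  obtain f' where "((snd c' \<circ> chart_inv c) has_derivative f') (at (snd c x))"
    by (metis centre_in_ball)
  then show ?thesis unfolding coord_change_def
    using frechet_derivative_works differentiable_def by (metis (no_types, lifting) eta_contract_eq)
qed

lemma coord_change_linear:
  "c \<in> atlas M \<Longrightarrow> c' \<in> atlas M \<Longrightarrow> x \<in> fst c \<Longrightarrow> x \<in> fst c' \<Longrightarrow> bounded_linear (coord_change c c' x)"
  using coord_change_deriv has_derivative_bounded_linear by blast

lemma coord_change_same [simp]:
  assumes "c \<in> atlas M" "x \<in> fst c"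
  shows "coord_change c c x = (\<lambda>v. v)"
proof -
  have "((snd c \<circ> chart_inv c) has_derivative (\<lambda>v. v)) (at (snd c x))"
    by (rule has_derivative_transform_within_open[OF has_derivative_ident chart_image_open[OF assms(1)]])
      (use assms in auto)
  from has_derivative_unique[OF coord_change_deriv[OF assms(1,1,2,2)] this] show ?thesis .
qed

lemma eventually_in_chart:
  "c \<in> atlas M \<Longrightarrow> (g \<longlongrightarrow> x) F \<Longrightarrow> x \<in> fst c \<Longrightarrow> eventually (\<lambda>s. g s \<in> fst c) F"
  using chart_open topological_tendstoD by blast

lemma coord_change_comp:
  assumes c: "c \<in> atlas M" "c' \<in> atlas M" "c'' \<in> atlas M" and x: "x \<in> fst c" "x \<in> fst c'" "x \<in> fst c''"
  shows "coord_change c' c'' x (coord_change c c' x v) = coord_change c c'' x v"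
proof -
  have eq: "(snd c' \<circ> chart_inv c) (snd c x) = snd c' x" using c x by simp
  have d: "(((snd c'' \<circ> chart_inv c') \<circ> (snd c' \<circ> chart_inv c)) has_derivative
      (coord_change c' c'' x \<circ> coord_change c c' x)) (at (snd c x))"
    by (rule diff_chain_at[OF coord_change_deriv[OF c(1,2) x(1,2)]])
      (use coord_change_deriv[OF c(2,3) x(2,3)] eq in simp)
  have "((snd c'' \<circ> chart_inv c) has_derivative (coord_change c' c'' x \<circ> coord_change c c' x)) (at (snd c x))"
  proof (rule has_derivative_transform_within_open[OF d])
    show "open (snd c ` (fst c \<inter> fst c'))" using transition_smooth[OF c(1,2)] by (simp add: smooth_on_def)
    show "snd c x \<in> snd c ` (fst c \<inter> fst c')" using x by blast
  qed (use c in auto)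
  from has_derivative_unique[OF this coord_change_deriv[OF c(1,3) x(1,3)]] show ?thesis
    by (metis comp_apply)
qed

text \<open>Joint continuity in base point and vector. The preferred chart may jump from point to
  point, so continuity of velocities along a curve is always argued in a fixed chart and transferred
  by this statement.\<close>

lemma coord_change_tendsto:
  assumes c: "c \<in> atlas M" "c' \<in> atlas M" and x: "x \<in> fst c" "x \<in> fst c'"
    and g: "(g \<longlongrightarrow> x) F" and w: "(w \<longlongrightarrow> w0) F"
  shows "((\<lambda>s. coord_change c c' (g s) (w s)) \<longlongrightarrow> coord_change c c' x w0) F"
proof -
  have xs: "snd c x \<in> snd c ` (fst c \<inter> fst c')" using x by blast
  obtain r K f' where r: "r > 0" "K > 0" "ball (snd c x) r \<subseteq> snd c ` (fst c \<inter> fst c')"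
    and f': "\<And>y. y \<in> ball (snd c x) r \<Longrightarrow> ((snd c' \<circ> chart_inv c) has_derivative f' y) (at y)"
    "\<And>y v. y \<in> ball (snd c x) r \<Longrightarrow> norm (f' y v) \<le> K * norm v"
    "\<And>y z v. y \<in> ball (snd c x) r \<Longrightarrow> z \<in> ball (snd c x) r \<Longrightarrow> norm (f' y v - f' z v) \<le> K * norm (y - z) * norm v"
    using smooth_on_locally_C11[OF transition_smooth[OF c] xs] by metis
  have gs: "((\<lambda>s. snd c (g s)) \<longlongrightarrow> snd c x) F"
    using isCont_tendsto_compose[OF isCont_chart[OF c(1) x(1)] g] .
  have ev: "eventually (\<lambda>s. g s \<in> fst c \<and> g s \<in> fst c' \<and> snd c (g s) \<in> ball (snd c x) r) F"
    using eventually_in_chart[OF c(1) g x(1)] eventually_in_chart[OF c(2) g x(2)]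
      topological_tendstoD[OF gs open_ball, of "snd c x" r] r(1)
    by (auto intro: eventually_conj)
  have eqf: "coord_change c c' y = f' (snd c y)" if "y \<in> fst c" "y \<in> fst c'" "snd c y \<in> ball (snd c x) r" for y
    using has_derivative_unique[OF coord_change_deriv[OF c that(1,2)] f'(1)[OF that(3)]] .
  have lin: "bounded_linear (f' y)" if "y \<in> ball (snd c x) r" for y using f'(1)[OF that] has_derivative_bounded_linear by blast
  have "((\<lambda>s. coord_change c c' (g s) (w s) - coord_change c c' x w0) \<longlongrightarrow> 0) F"
  proof (rule Lim_null_comparison)
    show "((\<lambda>s. K * norm (snd c (g s) - snd c x) * norm (w s) + K * norm (w s - w0)) \<longlongrightarrow> 0) F"
      by (rule tendsto_eq_intros gs w refl | simp)+
    show "eventually (\<lambda>s. norm (coord_change c c' (g s) (w s) - coord_change c c' x w0)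
        \<le> K * norm (snd c (g s) - snd c x) * norm (w s) + K * norm (w s - w0)) F"
      using ev
    proof (rule eventually_mono)
      fix s assume s: "g s \<in> fst c \<and> g s \<in> fst c' \<and> snd c (g s) \<in> ball (snd c x) r"
      have x0: "snd c x \<in> ball (snd c x) r" using r by simp
      have "coord_change c c' (g s) (w s) - coord_change c c' x w0
          = (f' (snd c (g s)) (w s) - f' (snd c x) (w s)) + f' (snd c x) (w s - w0)"
        using eqf[of "g s"] eqf[OF x x0] s linear_diff[OF bounded_linear.linear[OF lin[OF x0]]] by simp
      also have "norm \<dots> \<le> K * norm (snd c (g s) - snd c x) * norm (w s) + K * norm (w s - w0)"
        using s x0 by (intro norm_triangle_le add_mono f'(2,3)) auto
      finally show "norm (coord_change c c' (g s) (w s) - coord_change c c' x w0)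
        \<le> K * norm (snd c (g s) - snd c x) * norm (w s) + K * norm (w s - w0)" .
    qed
  qed
  then show ?thesis by (simp add: LIM_zero_iff)
qed

section \<open>The metric in coordinates\<close>

lemma rmetric_inner: "hilbert_inner (rmetric M x)"
  using rhm by (simp add: riemannian_hilbert_manifold_def)

lemma rmetric_sym: "rmetric M x u v = rmetric M x v u"
  using rmetric_inner by (auto simp: hilbert_inner_def)

lemma rmetric_bilinear: "bounded_bilinear (rmetric M x)"
  using rmetric_inner by (auto simp: hilbert_inner_def)

lemma rmetric_nonneg: "0 \<le> rmetric M x v v"
proof -
  obtain m where "m > 0" "\<And>v. m * (norm v)\<^sup>2 \<le> rmetric M x v v"
    using rmetric_inner[of x] by (auto simp: hilbert_inner_def)
  then show ?thesis by (smt (verit) mult_nonneg_nonneg zero_le_power2)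
qed

lemma tnorm_nonneg: "0 \<le> tnorm M x v" by (simp add: tnorm_def rmetric_nonneg)

lemma tnorm_power2: "(tnorm M x v)\<^sup>2 = rmetric M x v v" by (simp add: tnorm_def rmetric_nonneg)

lemma tnorm_scaleR: "tnorm M x (e *\<^sub>R v) = \<bar>e\<bar> * tnorm M x v"
proof -
  interpret bounded_bilinear "rmetric M x" by (rule rmetric_bilinear)
  show ?thesis by (simp add: tnorm_def scaleR_left scaleR_right real_sqrt_mult flip: mult.assoc)
qed

text \<open>\<open>Blinfun\<close> returns its argument only for bounded linear maps, so both nested
  uses in \<open>local_metric\<close> have to be justified: the inner one by continuity in
  \<open>v\<close>, the outer one by a bound in operator norm.\<close>

lemma local_metric_apply:
  assumes c: "c \<in> atlas M" and x: "x \<in> fst c"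
  shows "local_metric M c (snd c x) u v =
    rmetric M x (coord_change c (chart_at M x) x u) (coord_change c (chart_at M x) x v)"
proof -
  let ?T = "coord_change c (chart_at M x) x"
  interpret b: bounded_bilinear "rmetric M x" by (rule rmetric_bilinear)
  have T: "bounded_linear ?T" using c x by (intro coord_change_linear) auto
  then interpret T: bounded_linear ?T .
  have bb: "bounded_bilinear (\<lambda>u v. rmetric M x (?T u) (?T v))"
    by (rule b.comp[OF T T])
  then interpret bb: bounded_bilinear "\<lambda>u v. rmetric M x (?T u) (?T v)" .
  obtain k where k: "k \<ge> 0" "\<And>u v. norm (rmetric M x (?T u) (?T v)) \<le> norm u * norm v * k"
    using bb.nonneg_bounded by blast
  have ap: "blinfun_apply (Blinfun (\<lambda>v. rmetric M x (?T u) (?T v))) = (\<lambda>v. rmetric M x (?T u) (?T v))" for u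
    by (rule bounded_linear_Blinfun_apply[OF bb.bounded_linear_right])
  have "bounded_linear (\<lambda>u. Blinfun (\<lambda>v. rmetric M x (?T u) (?T v)))"
  proof (rule bounded_linear_intro[where K = k])
    fix u
    show "norm (Blinfun (\<lambda>v. rmetric M x (?T u) (?T v))) \<le> norm u * k"
    proof (rule norm_blinfun_bound)
      show "norm (blinfun_apply (Blinfun (\<lambda>v. rmetric M x (?T u) (?T v))) v) \<le> norm u * k * norm v" for v
        using k(2)[of u v] by (simp add: ap mult_ac)
    qed (use k in simp)
  next
    fix u u'
    show "Blinfun (\<lambda>v. rmetric M x (?T (u + u')) (?T v)) = Blinfun (\<lambda>v. rmetric M x (?T u) (?T v)) + Blinfun (\<lambda>v. rmetric M x (?T u') (?T v))"
      by (rule blinfun_eqI) (unfold blinfun.add_left ap, rule bb.add_left)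
  next
    fix t u
    show "Blinfun (\<lambda>v. rmetric M x (?T (t *\<^sub>R u)) (?T v)) = t *\<^sub>R Blinfun (\<lambda>v. rmetric M x (?T u) (?T v))"
      by (rule blinfun_eqI) (unfold blinfun.scaleR_left ap, rule bb.scaleR_left)
  qed
  from bounded_linear_Blinfun_apply[OF this] show ?thesis
    using c x by (simp add: local_metric_def Let_def ap)
qed

lemma local_metric_sym:
  assumes c: "c \<in> atlas M" and x: "x \<in> fst c"
  shows "local_metric M c (snd c x) u v = local_metric M c (snd c x) v u"
  using assms by (simp add: local_metric_apply rmetric_sym)

lemma local_metric_at: "local_metric M (chart_at M x) (snd (chart_at M x) x) u v = rmetric M x u v"
  by (simp add: local_metric_apply)

text \<open>Coercivity passes to any chart because the coordinate change has a bounded inverse, the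
  reverse coordinate change; if \<open>k\<close> bounds the latter, the constant drops from
  \<open>m\<close> to \<open>m / k\<^sup>2\<close>.\<close>

lemma local_metric_hilbert:
  assumes c: "c \<in> atlas M" and x: "x \<in> fst c"
  shows "hilbert_inner (local_metric M c (snd c x))"
proof -
  let ?T = "coord_change c (chart_at M x) x"
  obtain m where m: "m > 0" "\<And>v. m * (norm v)\<^sup>2 \<le> rmetric M x v v"
    using rmetric_inner[of x] by (auto simp: hilbert_inner_def)
  have "bounded_linear (coord_change (chart_at M x) c x)" using c x by (intro coord_change_linear) auto
  then obtain k where k: "k > 0" "\<And>v. norm (coord_change (chart_at M x) c x v) \<le> norm v * k"
    using bounded_linear.pos_bounded by blast
  have "m / k\<^sup>2 * (norm v)\<^sup>2 \<le> local_metric M c (snd c x) v v" for v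
  proof -
    have "norm v = norm (coord_change (chart_at M x) c x (?T v))" using c x by (simp add: coord_change_comp)
    also have "\<dots> \<le> norm (?T v) * k" by (rule k)
    finally have "(norm v)\<^sup>2 \<le> (norm (?T v) * k)\<^sup>2" by (intro power_mono) auto
    then have "m / k\<^sup>2 * (norm v)\<^sup>2 \<le> m / k\<^sup>2 * (norm (?T v) * k)\<^sup>2" using m k by (intro mult_left_mono) auto
    also have "\<dots> = m * (norm (?T v))\<^sup>2" using k by (simp add: power_mult_distrib)
    also have "\<dots> \<le> local_metric M c (snd c x) v v" using m c x by (simp add: local_metric_apply)
    finally show ?thesis .
  qed
  moreover have "m / k\<^sup>2 > 0" using m k by simp
  ultimately show ?thesis unfolding hilbert_inner_def
    using local_metric_sym[OF c x] bounded_bilinear.comp1[OF bounded_bilinear_blinfun_apply blinfun.bounded_linear_right]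
    by blast
qed

text \<open>The entry point from manifold to coordinate estimates. The parameter \<open>rmax\<close>
  lets the radius be kept below one prescribed elsewhere.\<close>

lemma metric_ball_exists:
  assumes c: "c \<in> atlas M" and x: "x \<in> fst c" and "rmax > 0"
  shows "\<exists>r K lam. r \<le> rmax \<and> ball (snd c x) r \<subseteq> snd c ` fst c \<and>
    metric_ball (local_metric M c) (\<lambda>p. frechet_derivative (local_metric M c) (at p)) (snd c x) r K lam"
proof -
  let ?G = "local_metric M c" and ?D = "\<lambda>p. frechet_derivative (local_metric M c) (at p)" and ?p = "snd c x"
  have "smooth_on (snd c ` fst c) ?G" using rhm c by (auto simp: riemannian_hilbert_manifold_def)
  from smooth_on_locally_C11[OF this, of ?p] x
  obtain r K f' where r: "r > 0" "K > 0" "ball ?p r \<subseteq> snd c ` fst c"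
    and f': "\<And>y. y \<in> ball ?p r \<Longrightarrow> (?G has_derivative f' y) (at y)"
    "\<And>y v. y \<in> ball ?p r \<Longrightarrow> norm (f' y v) \<le> K * norm v"
    "\<And>y z v. y \<in> ball ?p r \<Longrightarrow> z \<in> ball ?p r \<Longrightarrow> norm (f' y v - f' z v) \<le> K * norm (y - z) * norm v"
    by blast
  have D: "?D y = f' y" if "y \<in> ball ?p r" for y
    using frechet_derivative_at[OF f'(1)[OF that]] by simp
  obtain m where m: "m > 0" "\<And>v. m * (norm v)\<^sup>2 \<le> ?G ?p v v"
    using local_metric_hilbert[OF c x] by (auto simp: hilbert_inner_def)
  have lip: "norm (?G y - ?G ?p) \<le> K * norm (y - ?p)" if "y \<in> ball ?p r" for y
  proof (rule differentiable_bound[of "ball ?p r" ?G f'])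
    show "onorm (f' z) \<le> K" if "z \<in> ball ?p r" for z
      using f'(2)[OF that] r by (intro onorm_bound) auto
  qed (use that r in \<open>auto intro: has_derivative_at_withinI[OF f'(1)]\<close>)
  \<comment> \<open>On a ball of radius \<open>m / (2 * K)\<close> the Lipschitz bound changes
    \<open>G\<close> by at most \<open>m / 2\<close>, which leaves coercivity with constant
    \<open>m / 2\<close>.\<close>
  define r' where "r' = min (min r rmax) (m / (2 * K))"
  define K' where "K' = norm (?G ?p) + K * r' + K"
  have r': "0 < r'" "r' \<le> r" "r' \<le> rmax"
    using r m \<open>rmax > 0\<close> by (auto simp: r'_def)
  have "r' \<le> m / (2 * K)" by (simp add: r'_def)
  then have Kr': "K * r' \<le> m / 2" using r by (simp add: field_simps)
  have K': "K \<le> K'" "0 < K'" using r r' by (auto simp: K'_def add_nonneg_pos)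
  have sub: "y \<in> ball ?p r" if "y \<in> ball ?p r'" for y using that r' by auto
  have lip': "norm (?G y - ?G ?p) \<le> K * r'" if "y \<in> ball ?p r'" for y
  proof -
    have "K * norm (y - ?p) \<le> K * r'" using that r by (intro mult_left_mono) (auto simp: dist_norm norm_minus_commute)
    then show ?thesis using lip[OF sub[OF that]] by linarith
  qed
  have "metric_ball ?G ?D ?p r' K' (m / 2)"
  proof
    fix y h :: 'h assume y: "y \<in> ball ?p r'"
    show "(?G has_derivative ?D y) (at y)" using f'(1) D sub[OF y] by simp
    have "K * norm h \<le> K' * norm h" using K' by (intro mult_right_mono) auto
    then show "norm (?D y h) \<le> K' * norm h" using f'(2)[OF sub[OF y], of h] D[OF sub[OF y]] by simp
    show "norm (?G y) \<le> K'"
      using lip'[OF y] norm_triangle_sub[of "?G y" "?G ?p"] r by (simp add: K'_def)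
  next
    fix y z h :: 'h assume y: "y \<in> ball ?p r'" and z: "z \<in> ball ?p r'"
    have "norm (?D y h - ?D z h) \<le> K * norm (y - z) * norm h" using f'(3) D sub y z by simp
    also have "\<dots> \<le> K' * norm (y - z) * norm h" using K' by (intro mult_right_mono) auto
    finally show "norm (?D y h - ?D z h) \<le> K' * norm (y - z) * norm h" .
  next
    fix y u v :: 'h assume y: "y \<in> ball ?p r'"
    then obtain z where z: "z \<in> fst c" "y = snd c z" using sub r by blast
    show "?G y u v = ?G y v u" using local_metric_sym[OF c z(1)] z by simp
    have "\<bar>(?G y - ?G ?p) u u\<bar> \<le> norm ((?G y - ?G ?p) u) * norm u"
      using norm_blinfun[of "(?G y - ?G ?p) u" u] by simp
    also have "\<dots> \<le> (norm (?G y - ?G ?p) * norm u) * norm u" by (intro mult_right_mono norm_blinfun) auto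
    also have "\<dots> \<le> ((m / 2) * norm u) * norm u"
      using lip'[OF y] Kr' by (intro mult_right_mono) auto
    finally have "\<bar>?G y u u - ?G ?p u u\<bar> \<le> m / 2 * (norm u)\<^sup>2"
      by (simp add: blinfun.diff_left power2_eq_square)
    moreover have "m / 2 * (norm u)\<^sup>2 + m / 2 * (norm u)\<^sup>2 = m * (norm u)\<^sup>2" by simp
    ultimately show "m / 2 * (norm u)\<^sup>2 \<le> ?G y u u"
      using m(2)[of u] by linarith
  qed (use r' K' m in auto)
  then show ?thesis using r' r by (intro exI[of _ r'] exI[of _ K'] exI[of _ "m/2"]) auto
qed

end

subsection \<open>Curves\<close>

text \<open>Squaring the truncated linear function smooths its corner at \<open>e\<close>, so that
  the cutoff is C^1; only nonnegative times matter.\<close>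

definition cutoff :: "real \<Rightarrow> real \<Rightarrow> real" where
  "cutoff e t = (max 0 (1 - t / e))\<^sup>2"

definition cutoff' :: "real \<Rightarrow> real \<Rightarrow> real" where
  "cutoff' e t = - (2 / e) * max 0 (1 - t / e)"

lemma max0_power2_deriv: "((\<lambda>x. (max 0 x)\<^sup>2) has_real_derivative 2 * max 0 x) (at (x::real))"
proof -
  have "((\<lambda>y. ((max 0 y)\<^sup>2 - (max 0 x)\<^sup>2) / (y - x) - 2 * max 0 x) \<longlongrightarrow> 0) (at x)"
  proof (rule Lim_null_comparison)
    show "((\<lambda>y. \<bar>y - x\<bar>) \<longlongrightarrow> 0) (at x)" by (rule tendsto_eq_intros refl | simp)+
    show "eventually (\<lambda>y. norm (((max 0 y)\<^sup>2 - (max 0 x)\<^sup>2) / (y - x) - 2 * max 0 x) \<le> \<bar>y - x\<bar>) (at x)"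
      unfolding eventually_at_filter
    proof (intro always_eventually allI impI)
      fix y assume "y \<noteq> x"
      have "\<bar>(max 0 y)\<^sup>2 - (max 0 x)\<^sup>2 - 2 * max 0 x * (y - x)\<bar> \<le> (y - x)\<^sup>2"
      proof (cases "y \<ge> 0"; cases "x \<ge> 0")
        assume *: "y \<ge> 0" "\<not> x \<ge> 0"
        have "y\<^sup>2 \<le> (y - x)\<^sup>2" using * by (intro power_mono) auto
        then show ?thesis using * by (simp add: max_def)
      next
        assume *: "\<not> y \<ge> 0" "x \<ge> 0"
        have "0 \<le> x * (x - 2 * y)" using * by (intro mult_nonneg_nonneg) auto
        then show ?thesis using * zero_le_power2[of y] by (simp add: max_def power2_eq_square algebra_simps abs_le_iff)
      next
        assume *: "y \<ge> 0" "x \<ge> 0"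
        then have "(max 0 y)\<^sup>2 - (max 0 x)\<^sup>2 - 2 * max 0 x * (y - x) = (y - x)\<^sup>2"
          by (simp add: max_def power2_eq_square algebra_simps)
        then show ?thesis by simp
      next
        assume *: "\<not> y \<ge> 0" "\<not> x \<ge> 0"
        then show ?thesis by (simp add: max_def)
      qed
      then have "\<bar>(max 0 y)\<^sup>2 - (max 0 x)\<^sup>2 - 2 * max 0 x * (y - x)\<bar> / \<bar>y - x\<bar> \<le> (y - x)\<^sup>2 / \<bar>y - x\<bar>"
        by (intro divide_right_mono) auto
      also have "\<dots> = \<bar>y - x\<bar>" using \<open>y \<noteq> x\<close> by (simp add: power2_eq_square divide_simps abs_mult_self_eq)
      finally show "norm (((max 0 y)\<^sup>2 - (max 0 x)\<^sup>2) / (y - x) - 2 * max 0 x) \<le> \<bar>y - x\<bar>"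
        using \<open>y \<noteq> x\<close> by (simp add: abs_divide[symmetric] diff_divide_distrib del: abs_divide)
    qed
  qed
  then show ?thesis by (simp add: has_field_derivative_iff LIM_zero_iff)
qed

lemma cutoff_deriv: "e > 0 \<Longrightarrow> (cutoff e has_real_derivative cutoff' e t) (at t within S)"
proof -
  assume "e > 0"
  then have "((\<lambda>t. 1 - t / e) has_real_derivative - (1 / e)) (at t within S)"
    by (auto intro!: derivative_eq_intros)
  from DERIV_chain2[OF max0_power2_deriv this] show ?thesis
    by (simp add: cutoff_def[abs_def] cutoff'_def mult_ac)
qed

lemma cutoff_props:
  assumes "e > 0"
  shows cutoff_0: "cutoff e 0 = 1"
    and cutoff_nonneg: "0 \<le> cutoff e t"
    and cutoff_le: "t \<ge> 0 \<Longrightarrow> cutoff e t \<le> 1"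
    and cutoff_zero: "t \<ge> e \<Longrightarrow> cutoff e t = 0" "t \<ge> e \<Longrightarrow> cutoff' e t = 0"
    and cutoff'_le: "t \<ge> 0 \<Longrightarrow> \<bar>cutoff' e t\<bar> \<le> 2 / e"
proof -
  have m: "\<bar>max 0 (1 - t / e)\<bar> \<le> 1" if "t \<ge> 0" using that assms by auto
  show "t \<ge> 0 \<Longrightarrow> cutoff e t \<le> 1" using m by (simp add: cutoff_def power_le_one)
  show "\<bar>cutoff' e t\<bar> \<le> 2 / e" if "t \<ge> 0"
    using mult_left_mono[OF m[OF that], of "2 / e"] assms by (simp add: cutoff'_def abs_mult)
qed (use assms in \<open>auto simp: cutoff_def cutoff'_def max_def field_simps\<close>)

context riem
begin

abbreviation unit_vel :: "('m, 'h) chart \<Rightarrow> (real \<Rightarrow> 'm) \<Rightarrow> real \<Rightarrow> 'h" where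
  "unit_vel c g t \<equiv> vector_derivative (snd c \<circ> g) (at t within {0..1})"

definition speed :: "(real \<Rightarrow> 'm) \<Rightarrow> real \<Rightarrow> real" where
  "speed g t = tnorm M (g t) (velocity_within M g {0..1} t)"

lemma curve_length_speed: "curve_length M g = integral {0..1} (speed g)"
  by (simp add: curve_length_def speed_def[abs_def])

lemma vel_change:
  assumes c: "c \<in> atlas M" "c' \<in> atlas M" and t: "t \<in> S" "g t \<in> fst c" "g t \<in> fst c'"
    and cont: "continuous (at t within S) g"
    and d: "((snd c \<circ> g) has_vector_derivative w) (at t within S)"
  shows "((snd c' \<circ> g) has_vector_derivative coord_change c c' (g t) w) (at t within S)"
proof -
  have "(((snd c' \<circ> chart_inv c) \<circ> (snd c \<circ> g)) has_derivative (coord_change c c' (g t) \<circ> (\<lambda>h. h *\<^sub>R w))) (at t within S)"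
    by (rule diff_chain_within[OF d[unfolded has_vector_derivative_def]])
      (use coord_change_deriv[OF c t(2,3)] has_derivative_at_withinI in simp)
  then have 1: "(((snd c' \<circ> chart_inv c) \<circ> (snd c \<circ> g)) has_vector_derivative coord_change c c' (g t) w) (at t within S)"
    using linear_scale[OF bounded_linear.linear[OF coord_change_linear[OF c t(2,3)]]]
    by (simp add: has_vector_derivative_def o_def)
  have "eventually (\<lambda>s. g s \<in> fst c) (at t within S)"
    using cont t(2) eventually_in_chart[OF c(1)] by (simp add: continuous_within)
  then obtain e where e: "e > 0" "\<And>s. s \<in> S \<Longrightarrow> s \<noteq> t \<Longrightarrow> dist s t < e \<Longrightarrow> g s \<in> fst c"
    by (auto simp: eventually_at)
  show ?thesis
    by (rule has_vector_derivative_transform_within[OF 1 e(1) t(1)]) (use e c t in \<open>metis chart_inv_apply comp_apply\<close>)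
qed

lemma unit_vel_eq:
  "t \<in> {0..1} \<Longrightarrow> ((snd c \<circ> g) has_vector_derivative w) (at t within {0..1}) \<Longrightarrow> unit_vel c g t = w"
  using vector_derivative_within_cbox[of 0 1 t] by fastforce

text \<open>The speed is defined through the preferred chart at the current point; the
  transformation rule for velocities shows that any chart gives the same value.\<close>

lemma speed_chart:
  assumes c: "c \<in> atlas M" and t: "t \<in> {0..1}" "g t \<in> fst c"
    and cont: "continuous (at t within {0..1}) g"
    and d: "((snd c \<circ> g) has_vector_derivative w) (at t within {0..1})"
  shows "speed g t = sqrt (local_metric M c (snd c (g t)) w w)"
proof -
  let ?c = "chart_at M (g t)"
  have "velocity_within M g {0..1} t = coord_change c ?c (g t) w"
    unfolding velocity_within_def
    by (rule unit_vel_eq[OF t(1) vel_change[OF c _ t(1) _ _ cont d]]) (use t in auto)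
  then show ?thesis using c t by (simp add: speed_def tnorm_def local_metric_apply)
qed

text \<open>\<open>C1_curve\<close> refers to all charts at once. One chart near each time suffices,
  because coordinate changes act continuously on velocities; the local velocity \<open>w\<close>
  needs to be continuous only at the chosen time \<open>t\<close>, since \<open>t\<close> is
  arbitrary.\<close>

lemma C1_curveI:
  assumes "\<And>t. t \<in> {0..1} \<Longrightarrow> \<exists>c\<in>atlas M. \<exists>w. \<exists>d>0.
    (\<forall>s\<in>{0..1}. \<bar>s - t\<bar> < d \<longrightarrow> g s \<in> fst c \<and> ((snd c \<circ> g) has_vector_derivative w s) (at s within {0..1})) \<and>
    (w \<longlongrightarrow> w t) (at t within {0..1})"
  shows "C1_curve M g"
proof -
  have cont: "continuous (at t within {0..1}) g" if t: "t \<in> {0..1}" for t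
  proof -
    obtain c w d where c: "c \<in> atlas M" and d: "d > 0"
      and w: "\<forall>s\<in>{0..1}. \<bar>s - t\<bar> < d \<longrightarrow> g s \<in> fst c \<and> ((snd c \<circ> g) has_vector_derivative w s) (at s within {0..1})"
      using assms[OF t] by blast
    have gt: "g t \<in> fst c" using w t d by auto
    have "continuous (at t within {0..1}) (snd c \<circ> g)"
      using w t d has_vector_derivative_continuous by (metis abs_zero diff_self)
    then have 1: "((\<lambda>s. chart_inv c (snd c (g s))) \<longlongrightarrow> chart_inv c (snd c (g t))) (at t within {0..1})"
      using isCont_tendsto_compose[OF isCont_chart_inv[OF c, of "snd c (g t)"]] gt
      by (simp add: continuous_within o_def)
    have "(g \<longlongrightarrow> g t) (at t within {0..1})"
    proof (rule Lim_transform_within[OF _ d])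
      show "((\<lambda>s. chart_inv c (snd c (g s))) \<longlongrightarrow> g t) (at t within {0..1})" using 1 c gt by simp
    qed (use w c in \<open>auto simp: dist_real_def\<close>)
    then show ?thesis by (simp add: continuous_within)
  qed
  have main: "\<exists>w. ((snd c' \<circ> g) has_vector_derivative w t) (at t within {0..1}) \<and>
      (w \<longlongrightarrow> w t) (at t within {0..1}) \<and> eventually (\<lambda>s. unit_vel c' g s = w s) (at t within {0..1})"
    if c': "c' \<in> atlas M" and t: "t \<in> {0..1}" "g t \<in> fst c'" for c' t
  proof -
    obtain c w d where c: "c \<in> atlas M" and d: "d > 0"
      and w: "\<forall>s\<in>{0..1}. \<bar>s - t\<bar> < d \<longrightarrow> g s \<in> fst c \<and> ((snd c \<circ> g) has_vector_derivative w s) (at s within {0..1})"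
      and wl: "(w \<longlongrightarrow> w t) (at t within {0..1})"
      using assms[OF t(1)] by blast
    have gt: "g t \<in> fst c" using w t d by auto
    have gl: "(g \<longlongrightarrow> g t) (at t within {0..1})" using cont[OF t(1)] by (simp add: continuous_within)
    let ?w = "\<lambda>s. coord_change c c' (g s) (w s)"
    have der: "((snd c' \<circ> g) has_vector_derivative ?w s) (at s within {0..1})"
      if "s \<in> {0..1}" "\<bar>s - t\<bar> < d" "g s \<in> fst c'" for s
      using that w vel_change[OF c c' that(1) _ that(3) cont[OF that(1)]] by blast
    have "eventually (\<lambda>s. s \<in> {0..1} \<and> \<bar>s - t\<bar> < d \<and> g s \<in> fst c') (at t within {0..1})"
      using eventually_in_chart[OF c' gl t(2)] d
      by (intro eventually_conj) (auto simp: eventually_at dist_real_def)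
    then have "eventually (\<lambda>s. unit_vel c' g s = ?w s) (at t within {0..1})"
      by (rule eventually_mono) (use der unit_vel_eq in blast)
    moreover have "((snd c' \<circ> g) has_vector_derivative ?w t) (at t within {0..1})"
      using der[OF t(1)] d t by simp
    moreover have "(?w \<longlongrightarrow> ?w t) (at t within {0..1})" by (rule coord_change_tendsto[OF c c' gt t(2) gl wl])
    ultimately show ?thesis by (intro exI[of _ ?w] conjI)
  qed
  show ?thesis unfolding C1_curve_def Let_def
  proof (intro conjI ballI)
    show "continuous_on {0..1} g" using cont by (simp add: continuous_on_eq_continuous_within)
  next
    fix c t assume c: "c \<in> atlas M" and t: "t \<in> {t \<in> {0..1}. g t \<in> fst c}"
    show "snd c \<circ> g differentiable at t within {0..1}"
      using main[OF c, of t] t by (auto simp: has_vector_derivative_def differentiable_def)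
  next
    fix c assume c: "c \<in> atlas M"
    show "continuous_on {t \<in> {0..1}. g t \<in> fst c} (\<lambda>t. unit_vel c g t)"
      unfolding continuous_on_def
    proof
      fix t assume "t \<in> {t \<in> {0..1}. g t \<in> fst c}"
      then have t: "t \<in> {0..1}" "g t \<in> fst c" by auto
      from main[OF c t] obtain w where w: "((snd c \<circ> g) has_vector_derivative w t) (at t within {0..1})"
        "(w \<longlongrightarrow> w t) (at t within {0..1})" "eventually (\<lambda>s. unit_vel c g s = w s) (at t within {0..1})" by blast
      have "(unit_vel c g \<longlongrightarrow> w t) (at t within {0..1})"
        using w(2,3) by (rule Lim_transform_eventually[OF _ eventually_mono]) auto
      then have "(unit_vel c g \<longlongrightarrow> unit_vel c g t) (at t within {0..1})" using unit_vel_eq[OF t(1) w(1)] by simp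
      then show "(unit_vel c g \<longlongrightarrow> unit_vel c g t) (at t within {t \<in> {0..1}. g t \<in> fst c})"
        by (rule tendsto_within_subset) auto
    qed
  qed
qed

lemma C1_curve_continuous: "C1_curve M g \<Longrightarrow> continuous_on {0..1} g"
  by (simp add: C1_curve_def)

lemma C1_curve_cont_at: "C1_curve M g \<Longrightarrow> t \<in> {0..1} \<Longrightarrow> continuous (at t within {0..1}) g"
  using C1_curve_continuous by (simp add: continuous_on_eq_continuous_within)

lemma C1_curve_vel:
  assumes "C1_curve M g" "c \<in> atlas M" "t \<in> {0..1}" "g t \<in> fst c"
  shows "((snd c \<circ> g) has_vector_derivative unit_vel c g t) (at t within {0..1})"
  using assms vector_derivative_works by (auto simp: C1_curve_def Let_def)

lemma C1_curve_nbhd: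
  assumes g: "C1_curve M g" and c: "c \<in> atlas M" and t: "t \<in> {0..1}" "g t \<in> fst c"
  shows "\<exists>d>0. \<forall>s\<in>{0..1}. \<bar>s - t\<bar> < d \<longrightarrow> g s \<in> fst c"
proof -
  have "eventually (\<lambda>s. g s \<in> fst c) (at t within {0..1})"
    using C1_curve_cont_at[OF g t(1)] t(2) eventually_in_chart[OF c] by (simp add: continuous_within)
  then show ?thesis using t by (auto simp: eventually_at dist_real_def)
qed

lemma C1_curve_vel_tendsto:
  assumes g: "C1_curve M g" and c: "c \<in> atlas M" and t: "t \<in> {0..1}" "g t \<in> fst c"
  shows "(unit_vel c g \<longlongrightarrow> unit_vel c g t) (at t within {0..1})"
proof -
  obtain d where d: "d > 0" "\<forall>s\<in>{0..1}. \<bar>s - t\<bar> < d \<longrightarrow> g s \<in> fst c" using C1_curve_nbhd[OF assms] by blast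
  have "at t within {t \<in> {0..1}. g t \<in> fst c} = at t within {0..1}"
    by (rule at_within_nhd[of t "ball t d"]) (use d in \<open>auto simp: dist_real_def\<close>)
  moreover have "continuous_on {t \<in> {0..1}. g t \<in> fst c} (unit_vel c g)"
    using g c unfolding C1_curve_def Let_def by blast
  ultimately show ?thesis using t unfolding continuous_on_def by force
qed

lemma isCont_local_metric:
  assumes c: "c \<in> atlas M" and x: "x \<in> fst c"
  shows "isCont (local_metric M c) (snd c x)"
proof -
  obtain r K lam where "metric_ball (local_metric M c) (\<lambda>p. frechet_derivative (local_metric M c) (at p)) (snd c x) r K lam"
    using metric_ball_exists[OF c x zero_less_one] by blast
  then show ?thesis using has_derivative_continuous[OF metric_ball.G_deriv] metric_ball.r_pos by fastforce
qed

lemma speed_C1: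
  assumes g: "C1_curve M g" and c: "c \<in> atlas M" and t: "t \<in> {0..1}" "g t \<in> fst c"
  shows "speed g t = sqrt (local_metric M c (snd c (g t)) (unit_vel c g t) (unit_vel c g t))"
  by (rule speed_chart[OF c t C1_curve_cont_at[OF g t(1)] C1_curve_vel[OF g c t]])

lemma speed_continuous:
  assumes g: "C1_curve M g"
  shows "continuous_on {0..1} (speed g)"
  unfolding continuous_on_def
proof
  fix t :: real assume t: "t \<in> {0..1}"
  let ?c = "chart_at M (g t)"
  have c: "?c \<in> atlas M" "g t \<in> fst ?c" by auto
  obtain d where d: "d > 0" "\<forall>s\<in>{0..1}. \<bar>s - t\<bar> < d \<longrightarrow> g s \<in> fst ?c" using C1_curve_nbhd[OF g c(1) t c(2)] by blast
  have gl: "(g \<longlongrightarrow> g t) (at t within {0..1})" using C1_curve_cont_at[OF g t] by (simp add: continuous_within)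
  have 1: "((\<lambda>s. local_metric M ?c (snd ?c (g s))) \<longlongrightarrow> local_metric M ?c (snd ?c (g t))) (at t within {0..1})"
    by (intro isCont_tendsto_compose[OF isCont_local_metric[OF c]] isCont_tendsto_compose[OF isCont_chart[OF c]] gl)
  have "((\<lambda>s. sqrt (local_metric M ?c (snd ?c (g s)) (unit_vel ?c g s) (unit_vel ?c g s))) \<longlongrightarrow>
     sqrt (local_metric M ?c (snd ?c (g t)) (unit_vel ?c g t) (unit_vel ?c g t))) (at t within {0..1})"
    by (intro tendsto_intros 1 C1_curve_vel_tendsto[OF g c(1) t c(2)])
  then have "((\<lambda>s. sqrt (local_metric M ?c (snd ?c (g s)) (unit_vel ?c g s) (unit_vel ?c g s))) \<longlongrightarrow> speed g t) (at t within {0..1})"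
    using speed_C1[OF g c(1) t c(2)] by simp
  then show "(speed g \<longlongrightarrow> speed g t) (at t within {0..1})"
    by (rule Lim_transform_within[OF _ d(1)]) (use d speed_C1[OF g c(1)] in \<open>auto simp: dist_real_def\<close>)
qed

lemma speed_nonneg: "0 \<le> speed g t" by (simp add: speed_def tnorm_nonneg)

lemma curve_length_nonneg: "0 \<le> curve_length M g"
  unfolding curve_length_speed
  by (cases "speed g integrable_on {0..1}") (auto intro: integral_nonneg speed_nonneg simp: not_integrable_integral)

lemma C1_curve_reverse:
  assumes g: "C1_curve M g"
  shows "C1_curve M (\<lambda>t. g (1 - t))" "t \<in> {0..1} \<Longrightarrow> speed (\<lambda>t. g (1 - t)) t = speed g (1 - t)"
proof -
  have im: "(\<lambda>s::real. 1 - s) ` {0..1} = {0..1}" by (auto simp: image_iff intro!: bexI[of _ "1 - _"])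
  have der: "((snd c \<circ> (\<lambda>t. g (1 - t))) has_vector_derivative - unit_vel c g (1 - s)) (at s within {0..1})"
    if c: "c \<in> atlas M" and s: "s \<in> {0..1}" "g (1 - s) \<in> fst c" for c s
  proof -
    have "((\<lambda>s. 1 - s) has_vector_derivative - 1) (at s within {0..1})"
      by (auto intro!: derivative_eq_intros)
    from vector_diff_chain_within[OF this, of "snd c \<circ> g" "unit_vel c g (1 - s)"] C1_curve_vel[OF g c, of "1 - s"] s im
    show ?thesis by (simp add: o_def)
  qed
  show C1: "C1_curve M (\<lambda>t. g (1 - t))"
  proof (rule C1_curveI)
    fix t :: real assume t: "t \<in> {0..1}"
    let ?c = "chart_at M (g (1 - t))"
    have t': "1 - t \<in> {0..1}" using t by auto
    have c: "?c \<in> atlas M" "g (1 - t) \<in> fst ?c" by auto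
    obtain d where d: "d > 0" "\<forall>s\<in>{0..1}. \<bar>s - (1 - t)\<bar> < d \<longrightarrow> g s \<in> fst ?c" using C1_curve_nbhd[OF g c(1) t' c(2)] by blast
    have "filterlim (\<lambda>s. 1 - s) (at (1 - t) within {0..1}) (at t within {0..1})"
      unfolding filterlim_at using t
      by (intro conjI) (auto intro!: tendsto_eq_intros simp: eventually_at intro: exI[of _ 1])
    from filterlim_compose[OF C1_curve_vel_tendsto[OF g c(1) t' c(2)] this]
    have "((\<lambda>s. - unit_vel ?c g (1 - s)) \<longlongrightarrow> - unit_vel ?c g (1 - t)) (at t within {0..1})" by (rule tendsto_minus)
    moreover have "\<forall>s\<in>{0..1}. \<bar>s - t\<bar> < d \<longrightarrow> g (1 - s) \<in> fst ?c" using d(2) by auto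
    ultimately show "\<exists>c\<in>atlas M. \<exists>w. \<exists>d>0.
      (\<forall>s\<in>{0..1}. \<bar>s - t\<bar> < d \<longrightarrow> g (1 - s) \<in> fst c \<and> ((snd c \<circ> (\<lambda>t. g (1 - t))) has_vector_derivative w s) (at s within {0..1})) \<and>
      (w \<longlongrightarrow> w t) (at t within {0..1})"
      using d(1) c der by (intro bexI[of _ ?c] exI[of _ "\<lambda>s. - unit_vel ?c g (1 - s)"] exI[of _ d]) auto
  qed
  show "speed (\<lambda>t. g (1 - t)) t = speed g (1 - t)" if t: "t \<in> {0..1}" for t
  proof -
    let ?c = "chart_at M (g (1 - t))"
    have t': "1 - t \<in> {0..1}" using t by auto
    have "speed (\<lambda>t. g (1 - t)) t = sqrt (local_metric M ?c (snd ?c (g (1 - t))) (- unit_vel ?c g (1 - t)) (- unit_vel ?c g (1 - t)))"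
      by (rule speed_chart[OF _ t _ C1_curve_cont_at[OF C1 t] der]) (use t in auto)
    also have "\<dots> = speed g (1 - t)" using speed_C1[OF g _ t', of ?c] by (simp add: blinfun.minus_left blinfun.minus_right)
    finally show ?thesis .
  qed
qed

lemma curve_length_reverse:
  assumes g: "C1_curve M g"
  shows "curve_length M (\<lambda>t. g (1 - t)) = curve_length M g"
proof -
  have "(speed g has_integral curve_length M g) {0..1}"
    unfolding curve_length_speed by (intro integrable_integral integrable_continuous_real speed_continuous g)
  from has_integral_affinity[OF this[folded box_real(2)], of "-1" 1]
  have "((\<lambda>t. speed g (1 - t)) has_integral curve_length M g) {0..1}"
    using image_diff_atLeastAtMost[of 1 0 "1::real"] by simp
  then have "((\<lambda>t. speed (\<lambda>t. g (1 - t)) t) has_integral curve_length M g) {0..1}"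
    by (rule has_integral_eq[rotated]) (use C1_curve_reverse(2)[OF g] in auto)
  then show ?thesis unfolding curve_length_speed[of "\<lambda>t. g (1 - t)"] by (rule integral_unique)
qed

lemma rdist_le:
  assumes "C1_curve M g"
  shows "rdist M (g 0) (g 1) \<le> curve_length M g"
  unfolding rdist_def
  by (rule cInf_lower) (use assms curve_length_nonneg in \<open>auto intro!: bdd_belowI[of _ 0]\<close>)

lemma rdist_sym: "rdist M x y = rdist M y x"
proof -
  have "{curve_length M g |g. C1_curve M g \<and> g 0 = x \<and> g 1 = y} \<subseteq> {curve_length M g |g. C1_curve M g \<and> g 0 = y \<and> g 1 = x}" for x y
  proof
    fix l assume "l \<in> {curve_length M g |g. C1_curve M g \<and> g 0 = x \<and> g 1 = y}"
    then obtain g where "l = curve_length M g" "C1_curve M g" "g 0 = x" "g 1 = y" by blast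
    then show "l \<in> {curve_length M g |g. C1_curve M g \<and> g 0 = y \<and> g 1 = x}"
      using C1_curve_reverse(1)[of g] curve_length_reverse[of g]
      by (intro CollectI exI[of _ "\<lambda>t. g (1 - t)"]) auto
  qed
  then show ?thesis unfolding rdist_def by (metis (no_types, lifting) subset_antisym)
qed

text \<open>Moves the starting point of a curve by \<open>\<xi>\<close> without creating a corner.
  The cutoff vanishes from time \<open>d / 2\<close> on while the chart formula is used up to
  \<open>d\<close>, so the two branches agree on an overlap and differentiability at the switch is
  automatic.\<close>

lemma perturb_start:
  assumes g: "C1_curve M g" and c: "c \<in> atlas M" and d: "0 < d" "d \<le> 1"
    and dom: "\<And>t. t \<in> {0..d} \<Longrightarrow> g t \<in> fst c"
    and img: "\<And>t. t \<in> {0..d} \<Longrightarrow> snd c (g t) + cutoff (d / 2) t *\<^sub>R \<xi> \<in> snd c ` fst c"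
    and h: "h = (\<lambda>t. if t < d then chart_inv c (snd c (g t) + cutoff (d / 2) t *\<^sub>R \<xi>) else g t)"
  shows perturb_C1: "C1_curve M h"
    and perturb_speed1: "t \<in> {0..1} \<Longrightarrow> t < d \<Longrightarrow> speed h t =
      (let p = snd c (g t) + cutoff (d / 2) t *\<^sub>R \<xi>; w = unit_vel c g t + cutoff' (d / 2) t *\<^sub>R \<xi>
       in sqrt (local_metric M c p w w))"
    and perturb_speed2: "t \<in> {0..1} \<Longrightarrow> d \<le> t \<Longrightarrow> speed h t = speed g t"
proof -
  have d2: "d / 2 > 0" using d by simp
  have h1: "h s \<in> fst c" "snd c (h s) = snd c (g s) + cutoff (d / 2) s *\<^sub>R \<xi>" if "s \<in> {0..1}" "s < d" for s
    using img[of s] that c by (auto simp: h simp del: image_eqI)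
  have h2: "h s = g s" if "d / 2 \<le> s" for s
    using cutoff_zero(1)[OF d2, of s] dom[of s] that c d2 by (auto simp: h)
  have der1: "((snd c \<circ> h) has_vector_derivative (unit_vel c g s + cutoff' (d / 2) s *\<^sub>R \<xi>)) (at s within {0..1})"
    if s: "s \<in> {0..1}" "s < d" for s
  proof (rule has_vector_derivative_transform_within[where f = "\<lambda>s. (snd c \<circ> g) s + cutoff (d / 2) s *\<^sub>R \<xi>" and d = "d - s"])
    have "g s \<in> fst c" using dom s by auto
    then show "((\<lambda>s. (snd c \<circ> g) s + cutoff (d / 2) s *\<^sub>R \<xi>) has_vector_derivative
        (unit_vel c g s + cutoff' (d / 2) s *\<^sub>R \<xi>)) (at s within {0..1})"
      using has_vector_derivative_scaleR[OF cutoff_deriv[OF d2, of s "{0..1}"] has_vector_derivative_const[of \<xi>]]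
      by (intro has_vector_derivative_add C1_curve_vel[OF g c s(1)]) simp_all
  qed (use h1 s in \<open>auto simp: dist_real_def\<close>)
  have der2: "((snd c' \<circ> h) has_vector_derivative unit_vel c' g s) (at s within {0..1})"
    if s: "s \<in> {0..1}" "d / 2 < s" and c': "c' \<in> atlas M" "g s \<in> fst c'" for s c'
    by (rule has_vector_derivative_transform_within[OF C1_curve_vel[OF g c'(1) s(1) c'(2)], of "s - d / 2"])
      (use s h2 in \<open>auto simp: dist_real_def\<close>)
  have cutoff'_tendsto: "(cutoff' (d / 2) \<longlongrightarrow> cutoff' (d / 2) t) (at t within S)" for t S
    unfolding cutoff'_def by (rule tendsto_eq_intros refl | use d2 in simp)+
  show C1: "C1_curve M h"
  proof (rule C1_curveI)
    fix t :: real assume t: "t \<in> {0..1}"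
    show "\<exists>c\<in>atlas M. \<exists>w. \<exists>d>0.
      (\<forall>s\<in>{0..1}. \<bar>s - t\<bar> < d \<longrightarrow> h s \<in> fst c \<and> ((snd c \<circ> h) has_vector_derivative w s) (at s within {0..1})) \<and>
      (w \<longlongrightarrow> w t) (at t within {0..1})"
    proof (cases "t < d")
      case True
      then have "g t \<in> fst c" using dom t by auto
      from C1_curve_vel_tendsto[OF g c t this]
      have "((\<lambda>s. unit_vel c g s + cutoff' (d / 2) s *\<^sub>R \<xi>) \<longlongrightarrow> (unit_vel c g t + cutoff' (d / 2) t *\<^sub>R \<xi>)) (at t within {0..1})"
        by (intro tendsto_intros cutoff'_tendsto)
      moreover have "\<forall>s\<in>{0..1}. \<bar>s - t\<bar> < d - t \<longrightarrow> h s \<in> fst c \<and>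
          ((snd c \<circ> h) has_vector_derivative (unit_vel c g s + cutoff' (d / 2) s *\<^sub>R \<xi>)) (at s within {0..1})"
        using h1(1) der1 by auto
      ultimately show ?thesis using c True
        by (intro bexI[of _ c] exI[of _ "\<lambda>s. unit_vel c g s + cutoff' (d / 2) s *\<^sub>R \<xi>"] exI[of _ "d - t"]) auto
    next
      case False
      let ?c = "chart_at M (g t)"
      have c': "?c \<in> atlas M" "g t \<in> fst ?c" by auto
      obtain e where e: "e > 0" "\<forall>s\<in>{0..1}. \<bar>s - t\<bar> < e \<longrightarrow> g s \<in> fst ?c"
        using C1_curve_nbhd[OF g c'(1) t c'(2)] by blast
      have "\<forall>s\<in>{0..1}. \<bar>s - t\<bar> < min e (d / 2) \<longrightarrow> h s \<in> fst ?c \<and>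
          ((snd ?c \<circ> h) has_vector_derivative unit_vel ?c g s) (at s within {0..1})"
      proof (intro ballI impI)
        fix s :: real assume s: "s \<in> {0..1}" "\<bar>s - t\<bar> < min e (d / 2)"
        then have "\<bar>s - t\<bar> < d / 2" "g s \<in> fst ?c" using e(2) by auto
        moreover from this have "d / 2 < s" using False unfolding abs_less_iff by linarith
        ultimately have "d / 2 < s" "g s \<in> fst ?c" by auto
        then show "h s \<in> fst ?c \<and> ((snd ?c \<circ> h) has_vector_derivative unit_vel ?c g s) (at s within {0..1})"
          using der2[OF s(1) _ c'(1)] h2[of s] by simp
      qed
      then show ?thesis using c' C1_curve_vel_tendsto[OF g c'(1) t c'(2)] e d2
        by (intro bexI[of _ ?c] exI[of _ "unit_vel ?c g"] exI[of _ "min e (d / 2)"]) auto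
    qed
  qed
  show "speed h t = (let p = snd c (g t) + cutoff (d / 2) t *\<^sub>R \<xi>; w = unit_vel c g t + cutoff' (d / 2) t *\<^sub>R \<xi>
       in sqrt (local_metric M c p w w))" if t: "t \<in> {0..1}" "t < d"
    using speed_chart[OF c t(1) h1(1)[OF t] C1_curve_cont_at[OF C1 t(1)] der1[OF t]] h1(2)[OF t]
    by (simp add: Let_def)
  show "speed h t = speed g t" if t: "t \<in> {0..1}" "d \<le> t"
  proof -
    let ?c = "chart_at M (g t)"
    have "((snd ?c \<circ> h) has_vector_derivative unit_vel ?c g t) (at t within {0..1})"
      using t d2 by (intro der2) auto
    from speed_chart[OF _ t(1) _ C1_curve_cont_at[OF C1 t(1)] this] speed_C1[OF g _ t(1), of ?c] h2[of t] t d2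
    show ?thesis by simp
  qed
qed

text \<open>Guarantees that the set of lengths in the definition of \<open>rdist\<close> is
  nonempty; the infimum of the empty set of reals says nothing about distance.\<close>

definition joinable :: "'m \<Rightarrow> 'm \<Rightarrow> bool" where
  "joinable y z \<longleftrightarrow> (\<exists>g. C1_curve M g \<and> g 0 = y \<and> g 1 = z)"

lemma joinable_sym: "joinable y z \<Longrightarrow> joinable z y"
  unfolding joinable_def using C1_curve_reverse(1) by (metis diff_self diff_zero)

lemma joinable_refl: "joinable y y"
proof -
  have "C1_curve M (\<lambda>_. y)"
    by (rule C1_curveI) (auto intro!: bexI[of _ "chart_at M y"] exI[of _ "\<lambda>_. 0"] exI[of _ 1] simp: o_def)
  then show ?thesis unfolding joinable_def by blast
qed

text \<open>A curve starting at \<open>b\<close> is made to start at \<open>b'\<close> by perturbing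
  it near time 0. This replaces prepending a segment, which would leave a corner.\<close>

lemma joinable_in_ball:
  assumes c: "c \<in> atlas M" and sub: "ball p r \<subseteq> snd c ` fst c"
    and b: "b \<in> fst c" "snd c b \<in> ball p r" and b': "b' \<in> fst c" "snd c b' \<in> ball p r"
    and j: "joinable b z"
  shows "joinable b' z"
proof -
  from j obtain g where g: "C1_curve M g" "g 0 = b" "g 1 = z" unfolding joinable_def by blast
  let ?\<xi> = "snd c b' - snd c b"
  \<comment> \<open>Both endpoints lie within \<open>r - m\<close> of the centre, hence so does the
    segment between them; the curve may then drift by less than \<open>m\<close> before the
    perturbed point could leave the ball.\<close>
  define m where "m = r - max (norm (snd c b - p)) (norm (snd c b' - p))"
  have m: "m > 0" using b b' by (auto simp: m_def dist_norm norm_minus_commute)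
  obtain d1 where d1: "d1 > 0" "\<forall>s\<in>{0..1}. \<bar>s - 0\<bar> < d1 \<longrightarrow> g s \<in> fst c"
    using C1_curve_nbhd[OF g(1) c, of 0] g b by auto
  have "((\<lambda>s. snd c (g s)) \<longlongrightarrow> snd c (g 0)) (at 0 within {0..1})"
    using isCont_tendsto_compose[OF isCont_chart[OF c, of "g 0"]] C1_curve_cont_at[OF g(1), of 0] g b
    by (simp add: continuous_within)
  from tendstoD[OF this m]
  obtain d2 where d2: "d2 > 0" "\<And>s. s \<in> {0..1} \<Longrightarrow> s \<noteq> 0 \<Longrightarrow> dist s 0 < d2 \<Longrightarrow> dist (snd c (g s)) (snd c (g 0)) < m"
    by (auto simp: eventually_at)
  define d where "d = min 1 (min (d1 / 2) (d2 / 2))"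
  have d: "0 < d" "d \<le> 1" "d < d1" "d < d2" using d1 d2 by (auto simp: d_def)
  have dom: "g t \<in> fst c" if "t \<in> {0..d}" for t using that d d1 by auto
  have img: "snd c (g t) + cutoff (d / 2) t *\<^sub>R ?\<xi> \<in> snd c ` fst c" if t: "t \<in> {0..d}" for t
  proof -
    let ?k = "cutoff (d / 2) t"
    have k: "0 \<le> ?k" "?k \<le> 1" using t d cutoff_nonneg[of "d/2" t] cutoff_le[of "d/2" t] by auto
    have "norm (snd c (g t) - snd c b) < m"
      using d2(2)[of t] t d m g by (cases "t = 0") (auto simp: dist_norm)
    moreover have "norm ((1 - ?k) *\<^sub>R (snd c b - p) + ?k *\<^sub>R (snd c b' - p)) \<le> r - m"
    proof -
      have "norm ((1 - ?k) *\<^sub>R (snd c b - p) + ?k *\<^sub>R (snd c b' - p)) \<le> (1 - ?k) * norm (snd c b - p) + ?k * norm (snd c b' - p)"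
        using k norm_triangle_ineq[of "(1 - ?k) *\<^sub>R (snd c b - p)" "?k *\<^sub>R (snd c b' - p)"] by simp
      also have "\<dots> \<le> (1 - ?k) * (r - m) + ?k * (r - m)"
        using k by (intro add_mono mult_left_mono) (auto simp: m_def)
      finally show ?thesis by (simp add: algebra_simps)
    qed
    moreover have "snd c (g t) + ?k *\<^sub>R ?\<xi> - p = (snd c (g t) - snd c b) + ((1 - ?k) *\<^sub>R (snd c b - p) + ?k *\<^sub>R (snd c b' - p))"
      by (simp add: algebra_simps)
    ultimately have "norm (snd c (g t) + ?k *\<^sub>R ?\<xi> - p) < r"
      by (smt (verit) norm_triangle_ineq)
    then show ?thesis using sub by (metis dist_norm mem_ball norm_minus_commute subsetD)
  qed
  define h where "h = (\<lambda>t. if t < d then chart_inv c (snd c (g t) + cutoff (d / 2) t *\<^sub>R ?\<xi>) else g t)"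
  have "C1_curve M h" by (rule perturb_C1[OF g(1) c d(1,2) dom img h_def])
  moreover have "h 0 = b'" using d g b' c cutoff_0[of "d/2"] by (simp add: h_def)
  moreover have "h 1 = z" using d g by (simp add: h_def)
  ultimately show ?thesis unfolding joinable_def by blast
qed

text \<open>Each point has a neighbourhood whose points are all joinable to \<open>y\<close> or all
  not, so the set of points joinable to \<open>y\<close> is open and closed.\<close>

lemma joinable_connected:
  assumes conn: "connected (UNIV :: 'm set)"
  shows "joinable y z"
proof -
  have nb: "\<exists>N. open N \<and> a \<in> N \<and> (\<forall>b\<in>N. \<forall>b'\<in>N. joinable y b \<longrightarrow> joinable y b')" for a
  proof -
    let ?c = "chart_at M a"
    have c: "?c \<in> atlas M" "a \<in> fst ?c" by auto
    obtain r where r: "r > 0" "ball (snd ?c a) r \<subseteq> snd ?c ` fst ?c"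
      using chart_image_open[OF c(1)] c(2) openE by blast
    let ?N = "{b \<in> fst ?c. snd ?c b \<in> ball (snd ?c a) r}"
    have "open ?N"
    proof -
      have "open (fst ?c \<inter> snd ?c -` ball (snd ?c a) r)"
        using homeomorphism_cont1[OF chart_homeo[OF c(1)]] chart_open[OF c(1)]
        by (intro continuous_open_preimage) auto
      moreover have "?N = fst ?c \<inter> snd ?c -` ball (snd ?c a) r" by auto
      ultimately show ?thesis by simp
    qed
    moreover have "a \<in> ?N" using r by simp
    moreover have "joinable y b'" if "b \<in> ?N" "b' \<in> ?N" "joinable y b" for b b'
      using joinable_sym[OF joinable_in_ball[OF c(1) r(2) _ _ _ _ joinable_sym[OF that(3)], of b']] that(1,2) by blast
    ultimately show ?thesis by blast
  qed
  have "open {z. joinable y z}" "open (- {z. joinable y z})"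
    by (subst open_subopen; use nb in fast)+
  then have "{z. joinable y z} = {} \<or> {z. joinable y z} = UNIV"
    using connectedD[OF conn, of "{z. joinable y z}" "- {z. joinable y z}"] by auto
  then show ?thesis using joinable_refl by blast
qed

lemma rdist_ge:
  assumes conn: "connected (UNIV :: 'm set)"
    and "\<And>g. C1_curve M g \<Longrightarrow> g 0 = y \<Longrightarrow> g 1 = z \<Longrightarrow> l \<le> curve_length M g"
  shows "l \<le> rdist M y z"
  unfolding rdist_def
  by (rule cInf_greatest) (use joinable_connected[OF conn, of y z] assms(2) in \<open>auto simp: joinable_def\<close>)

subsection \<open>The Levi-Civita connection\<close>

lemma local_metric_nondeg:
  assumes c: "c \<in> atlas M" "x \<in> fst c" and eq: "\<And>w. local_metric M c (snd c x) a w = local_metric M c (snd c x) b w"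
  shows "a = b"
proof -
  obtain m where m: "m > 0" "\<And>v. m * (norm v)\<^sup>2 \<le> local_metric M c (snd c x) v v"
    using local_metric_hilbert[OF c] by (auto simp: hilbert_inner_def)
  have "m * (norm (a - b))\<^sup>2 \<le> 0" using m(2)[of "a - b"] eq[of "a - b"] by (simp add: blinfun.diff_left blinfun.diff_right)
  then show ?thesis using m(1) by (simp add: mult_le_0_iff)
qed

abbreviation Dmetric :: "('m, 'h) chart \<Rightarrow> 'h \<Rightarrow> 'h \<Rightarrow> 'h \<Rightarrow>\<^sub>L 'h \<Rightarrow>\<^sub>L real" where
  "Dmetric c p \<equiv> frechet_derivative (local_metric M c) (at p)"

lemma local_metric_deriv:
  assumes c: "c \<in> atlas M" "x \<in> fst c"
  shows "(local_metric M c has_derivative Dmetric c (snd c x)) (at (snd c x))"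
    and "Dmetric c (snd c x) h u v = Dmetric c (snd c x) h v u"
proof -
  obtain r K lam where "metric_ball (local_metric M c) (Dmetric c) (snd c x) r K lam"
    using metric_ball_exists[OF c zero_less_one] by blast
  then interpret metric_ball "local_metric M c" "Dmetric c" "snd c x" r K lam .
  show "(local_metric M c has_derivative Dmetric c (snd c x)) (at (snd c x))"
    "Dmetric c (snd c x) h u v = Dmetric c (snd c x) h v u"
    using G_deriv DG_sym r_pos by auto
qed

text \<open>The definite description in \<open>christoffel\<close> has meaning only after existence
  and uniqueness. Both come from the Koszul formula: it determines
  \<open>2 * G (\<Gamma> u v) w\<close> for all \<open>w\<close>, hence \<open>\<Gamma> u v\<close>
  by nondegeneracy, and conversely the Riesz representation for the inner product \<open>G\<close>
  produces a vector with the prescribed pairings.\<close>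

lemma christoffel:
  assumes c: "c \<in> atlas M" "x \<in> fst c"
  shows christoffel_sym: "christoffel M c (snd c x) u v = christoffel M c (snd c x) v u"
    and christoffel_compat: "Dmetric c (snd c x) u v w
      = local_metric M c (snd c x) (christoffel M c (snd c x) u v) w
        + local_metric M c (snd c x) v (christoffel M c (snd c x) u w)"
proof -
  let ?G = "local_metric M c (snd c x)" and ?D = "Dmetric c (snd c x)"
  let ?P = "\<lambda>\<Gamma>. (\<forall>u v. \<Gamma> u v = \<Gamma> v u) \<and> (\<forall>u v w. ?D u v w = ?G (\<Gamma> u v) w + ?G v (\<Gamma> u w))"
  interpret D: bounded_linear ?D using local_metric_deriv(1)[OF c] has_derivative_bounded_linear by blast
  note Dsym = local_metric_deriv(2)[OF c] and Gsym = local_metric_sym[OF c]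
  have koszul: "2 * ?G (\<Gamma> u v) w = ?D u v w + ?D v u w - ?D w u v" if "?P \<Gamma>" for \<Gamma> u v w
  proof -
    have s: "\<Gamma> u v = \<Gamma> v u" for u v using that by blast
    have k: "?D u v w = ?G (\<Gamma> u v) w + ?G v (\<Gamma> u w)" for u v w using that by blast
    show ?thesis using k[of u v w] k[of v u w] k[of w u v] s[of u v] s[of w u] s[of w v] Gsym by simp
  qed
  have "\<exists>a. \<forall>w. 2 * ?G a w = ?D u v w + ?D v u w - ?D w u v" for u v
  proof -
    have "bounded_linear (\<lambda>w. (?D u v w + ?D v u w - ?D w u v) / 2)"
    proof -
      have "bounded_linear (\<lambda>w. ?D w u v)"
        by (intro bounded_linear_compose[OF blinfun.bounded_linear_left]
            bounded_linear_compose[OF blinfun.bounded_linear_left[of u]] D.bounded_linear_axioms)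
      then show ?thesis
        by (intro bounded_linear_compose[OF bounded_linear_divide] bounded_linear_sub bounded_linear_add blinfun.bounded_linear_right)
    qed
    from Riesz_coercive[OF local_metric_hilbert[OF c] this] show ?thesis
      by (auto simp: field_simps)
  qed
  then obtain \<Gamma> where \<Gamma>: "\<And>u v w. 2 * ?G (\<Gamma> u v) w = ?D u v w + ?D v u w - ?D w u v" by metis
  have ex: "?P \<Gamma>"
  proof (intro conjI allI)
    fix u v
    show "\<Gamma> u v = \<Gamma> v u"
    proof (rule local_metric_nondeg[OF c])
      fix w show "?G (\<Gamma> u v) w = ?G (\<Gamma> v u) w"
        using \<Gamma>[of u v w] \<Gamma>[of v u w] Dsym[of w u v] by simp
    qed
    fix w
    show "?D u v w = ?G (\<Gamma> u v) w + ?G v (\<Gamma> u w)"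
      using \<Gamma>[of u v w] \<Gamma>[of u w v] Dsym[of u v w] Dsym[of v u w] Dsym[of w u v] Gsym[of v "\<Gamma> u w"] by simp
  qed
  have "\<exists>!\<Gamma>. ?P \<Gamma>"
  proof (rule ex1I[where a = \<Gamma>])
    show "?P \<Gamma>" by (rule ex)
  next
    fix \<Gamma>' assume P': "?P \<Gamma>'"
    show "\<Gamma>' = \<Gamma>"
    proof (intro ext local_metric_nondeg[OF c])
      fix u v w show "?G (\<Gamma>' u v) w = ?G (\<Gamma> u v) w"
        using koszul[OF P', of u v w] koszul[OF ex, of u v w] by simp
    qed
  qed
  from theI'[OF this] have "?P (christoffel M c (snd c x))"
    unfolding christoffel_def Let_def .
  then show "christoffel M c (snd c x) u v = christoffel M c (snd c x) v u"
    "?D u v w = ?G (christoffel M c (snd c x) u v) w + ?G v (christoffel M c (snd c x) u w)" by blast+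
qed

lemma christoffel_koszul:
  assumes c: "c \<in> atlas M" "x \<in> fst c"
  shows "2 * local_metric M c (snd c x) (christoffel M c (snd c x) u v) w
    = Dmetric c (snd c x) u v w + Dmetric c (snd c x) v u w - Dmetric c (snd c x) w u v"
  using christoffel_compat[OF c, of u v w] christoffel_compat[OF c, of v u w] christoffel_compat[OF c, of w u v]
    christoffel_sym[OF c, of u v] christoffel_sym[OF c, of w u] christoffel_sym[OF c, of w v] local_metric_sym[OF c] by simp

text \<open>The defining conditions do not mention homogeneity; it is read off from the Koszul
  formula, whose right-hand side is homogeneous of degree two when both arguments are
  scaled.\<close>

lemma christoffel_scaleR:
  assumes c: "c \<in> atlas M" "x \<in> fst c"
  shows "christoffel M c (snd c x) (k *\<^sub>R u) (k *\<^sub>R u) = k\<^sup>2 *\<^sub>R christoffel M c (snd c x) u u"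
proof (rule local_metric_nondeg[OF c])
  fix w
  interpret D: bounded_linear "Dmetric c (snd c x)"
    using local_metric_deriv(1)[OF c] has_derivative_bounded_linear by blast
  let ?G = "local_metric M c (snd c x)"
  have "2 * ?G (christoffel M c (snd c x) (k *\<^sub>R u) (k *\<^sub>R u)) w = k\<^sup>2 * (2 * ?G (christoffel M c (snd c x) u u) w)"
    unfolding christoffel_koszul[OF c]
    by (simp add: D.scaleR blinfun.scaleR_left blinfun.scaleR_right power2_eq_square algebra_simps)
  then show "?G (christoffel M c (snd c x) (k *\<^sub>R u) (k *\<^sub>R u)) w = ?G (k\<^sup>2 *\<^sub>R christoffel M c (snd c x) u u) w"
    by (simp add: blinfun.scaleR_left blinfun.scaleR_right)
qed

subsection \<open>Geodesics\<close>

abbreviation geodesic :: "(real \<Rightarrow> 'm) \<Rightarrow> bool" where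
  "geodesic \<equiv> geodesic_on M UNIV"

abbreviation gvel :: "(real \<Rightarrow> 'm) \<Rightarrow> real \<Rightarrow> 'h" where
  "gvel g t \<equiv> velocity_within M g UNIV t"

abbreviation rvel :: "('m, 'h) chart \<Rightarrow> (real \<Rightarrow> 'm) \<Rightarrow> real \<Rightarrow> 'h" where
  "rvel c g t \<equiv> vector_derivative (snd c \<circ> g) (at t)"

lemma gvel_rvel: "gvel g t = rvel (chart_at M (g t)) g t"
  by (simp add: velocity_within_def)

lemma geodesicD:
  assumes g: "geodesic g"
  shows geodesic_cont: "isCont g t"
    and geodesic_vel: "c \<in> atlas M \<Longrightarrow> g t \<in> fst c \<Longrightarrow> ((snd c \<circ> g) has_vector_derivative rvel c g t) (at t)"
    and geodesic_eq: "c \<in> atlas M \<Longrightarrow> g t \<in> fst c \<Longrightarrow>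
      (rvel c g has_vector_derivative (- christoffel M c (snd c (g t)) (rvel c g t) (rvel c g t))) (at t)"
proof -
  show "isCont g t" using g by (simp add: geodesic_on_def continuous_on_eq_continuous_at)
  assume c: "c \<in> atlas M" "g t \<in> fst c"
  have *: "(snd c \<circ> g) differentiable (at t) \<and>
      (rvel c g has_vector_derivative (- christoffel M c ((snd c \<circ> g) t) (rvel c g t) (rvel c g t))) (at t)"
    using g c unfolding geodesic_on_def Let_def by blast
  show "((snd c \<circ> g) has_vector_derivative rvel c g t) (at t)"
    using conjunct1[OF *] by (simp only: vector_derivative_works)
  show "(rvel c g has_vector_derivative (- christoffel M c (snd c (g t)) (rvel c g t) (rvel c g t))) (at t)"
    using conjunct2[OF *] by (simp only: comp_apply)
qed

lemma geodesic_nbhd: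
  assumes g: "geodesic g" and c: "c \<in> atlas M" "g t \<in> fst c"
  shows "\<exists>d>0. \<forall>s. \<bar>s - t\<bar> < d \<longrightarrow> g s \<in> fst c"
proof -
  have "eventually (\<lambda>s. g s \<in> fst c) (at t)"
    using geodesic_cont[OF g, of t] c(2) eventually_in_chart[OF c(1)] by (simp add: isCont_def)
  then obtain d where "d > 0" "\<forall>s. s \<noteq> t \<and> dist s t < d \<longrightarrow> g s \<in> fst c"
    by (auto simp: eventually_at)
  then show ?thesis using c(2) by (metis dist_real_def)
qed

lemma rvel_change:
  assumes g: "geodesic g" and c: "c \<in> atlas M" "c' \<in> atlas M" "g t \<in> fst c" "g t \<in> fst c'"
  shows "rvel c' g t = coord_change c c' (g t) (rvel c g t)"
  using vel_change[OF c(1,2) UNIV_I c(3,4) geodesic_cont[OF g] geodesic_vel[OF g c(1,3)]]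
  by (simp add: vector_derivative_at)

text \<open>The product rule applied to the momentum \<open>G q'\<close>, with the acceleration
  replaced by means of the geodesic equation.\<close>

definition force :: "('m, 'h) chart \<Rightarrow> (real \<Rightarrow> 'm) \<Rightarrow> real \<Rightarrow> 'h \<Rightarrow>\<^sub>L real" where
  "force c g t = (let p = snd c (g t); w = rvel c g t in
     local_metric M c p (- christoffel M c p w w) + Dmetric c p w w)"

text \<open>The Euler-Lagrange equation of the energy. Metric compatibility and torsion-freeness
  cancel the Christoffel terms, so that only half the derivative of the metric in direction
  \<open>u\<close> remains.\<close>

lemma geodesic_momentum:
  assumes g: "geodesic g" and c: "c \<in> atlas M" "g t \<in> fst c"
  shows "((\<lambda>s. local_metric M c (snd c (g s)) (rvel c g s)) has_vector_derivative force c g t) (at t)"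
    and force_apply: "force c g t u = Dmetric c (snd c (g t)) u (rvel c g t) (rvel c g t) / 2"
proof -
  let ?p = "snd c (g t)" and ?w = "rvel c g t"
  let ?G = "local_metric M c ?p" and ?D = "Dmetric c ?p" and ?\<Gamma> = "christoffel M c ?p"
  have "((\<lambda>s. local_metric M c (snd c (g s))) has_vector_derivative ?D ?w) (at t)"
    using vector_derivative_diff_chain_within[OF geodesic_vel[OF g c], of "local_metric M c" ?D]
      has_derivative_at_withinI[OF local_metric_deriv(1)[OF c]] by (simp add: o_def)
  from bounded_bilinear.has_vector_derivative[OF bounded_bilinear_blinfun_apply this geodesic_eq[OF g c]]
  show "((\<lambda>s. local_metric M c (snd c (g s)) (rvel c g s)) has_vector_derivative force c g t) (at t)"
    unfolding force_def Let_def .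
  have "?D ?w ?w u = ?G (?\<Gamma> ?w ?w) u + ?G ?w (?\<Gamma> ?w u)" by (rule christoffel_compat[OF c])
  moreover have "?D u ?w ?w = 2 * ?G ?w (?\<Gamma> ?w u)"
    using christoffel_compat[OF c, of u ?w ?w] local_metric_sym[OF c, of "?\<Gamma> u ?w" ?w] christoffel_sym[OF c, of u ?w] by simp
  ultimately have "?D ?w ?w u - ?G (?\<Gamma> ?w ?w) u = ?D u ?w ?w / 2" by linarith
  then show "force c g t u = ?D u ?w ?w / 2"
    unfolding force_def Let_def blinfun.add_left blinfun.minus_right blinfun.minus_left by linarith
qed

lemma geodesic_kinetic_chart:
  assumes g: "geodesic g" and c: "c \<in> atlas M" "g t \<in> fst c"
  shows "rmetric M (g t) (gvel g t) (gvel g t) = local_metric M c (snd c (g t)) (rvel c g t) (rvel c g t)"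
  unfolding gvel_rvel using rvel_change[OF g c(1) _ c(2), of "chart_at M (g t)"] c
  by (simp add: local_metric_apply)

text \<open>Conservation of energy. Each time is treated in the chart chosen at that time, since the
  tangent coordinates in the statement vary with the preferred chart.\<close>

lemma geodesic_kinetic:
  assumes g: "geodesic g"
  shows "rmetric M (g t) (gvel g t) (gvel g t) = rmetric M (g 0) (gvel g 0) (gvel g 0)"
proof -
  have "((\<lambda>t. rmetric M (g t) (gvel g t) (gvel g t)) has_real_derivative 0) (at t)" for t
  proof -
    let ?c = "chart_at M (g t)"
    have c: "?c \<in> atlas M" "g t \<in> fst ?c" by auto
    obtain d where d: "d > 0" "\<forall>s. \<bar>s - t\<bar> < d \<longrightarrow> g s \<in> fst ?c" using geodesic_nbhd[OF g c] by blast
    let ?p = "snd ?c (g t)" and ?w = "rvel ?c g t"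
    from bounded_bilinear.has_vector_derivative[OF bounded_bilinear_blinfun_apply geodesic_momentum(1)[OF g c] geodesic_eq[OF g c]]
    have "((\<lambda>s. local_metric M ?c (snd ?c (g s)) (rvel ?c g s) (rvel ?c g s)) has_vector_derivative
        (local_metric M ?c ?p ?w (- christoffel M ?c ?p ?w ?w) + force ?c g t ?w)) (at t)" .
    moreover have "local_metric M ?c ?p ?w (- christoffel M ?c ?p ?w ?w) + force ?c g t ?w = 0"
      using force_apply[OF g c, of ?w] christoffel_compat[OF c, of ?w ?w ?w] local_metric_sym[OF c, of ?w "christoffel M ?c ?p ?w ?w"]
      unfolding blinfun.minus_right by linarith
    ultimately have "((\<lambda>s. local_metric M ?c (snd ?c (g s)) (rvel ?c g s) (rvel ?c g s)) has_real_derivative 0) (at t)"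
      by (simp add: has_real_derivative_iff_has_vector_derivative)
    then show ?thesis
    proof (rule has_field_derivative_transform_within[OF _ d(1)])
      show "local_metric M ?c (snd ?c (g s)) (rvel ?c g s) (rvel ?c g s) = rmetric M (g s) (gvel g s) (gvel g s)"
        if "dist s t < d" for s
        using d(2) that geodesic_kinetic_chart[OF g c(1), of s] by (simp add: dist_real_def)
    qed auto
  qed
  then show ?thesis
    by (intro DERIV_isconst_all[where f = "\<lambda>t. rmetric M (g t) (gvel g t) (gvel g t)"] allI)
qed

lemma geodesic_C1:
  assumes g: "geodesic g"
  shows "C1_curve M g"
    and geodesic_unit_vel: "t \<in> {0..1} \<Longrightarrow> c \<in> atlas M \<Longrightarrow> g t \<in> fst c \<Longrightarrow> unit_vel c g t = rvel c g t"
    and geodesic_speed: "t \<in> {0..1} \<Longrightarrow> speed g t = tnorm M (g 0) (gvel g 0)"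
proof -
  show uv: "unit_vel c g t = rvel c g t" if "t \<in> {0..1}" "c \<in> atlas M" "g t \<in> fst c" for c t
    by (rule unit_vel_eq[OF that(1) has_vector_derivative_at_within[OF geodesic_vel[OF g that(2,3)]]])
  show C1: "C1_curve M g"
  proof (rule C1_curveI)
    fix t :: real assume t: "t \<in> {0..1}"
    let ?c = "chart_at M (g t)"
    have c: "?c \<in> atlas M" "g t \<in> fst ?c" by auto
    obtain d where d: "d > 0" "\<forall>s. \<bar>s - t\<bar> < d \<longrightarrow> g s \<in> fst ?c" using geodesic_nbhd[OF g c] by blast
    have "isCont (rvel ?c g) t" using geodesic_eq[OF g c] has_vector_derivative_continuous by blast
    then have "(rvel ?c g \<longlongrightarrow> rvel ?c g t) (at t within {0..1})"
      using continuous_at_imp_continuous_at_within continuous_within by blast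
    moreover have "\<forall>s\<in>{0..1}. \<bar>s - t\<bar> < d \<longrightarrow> g s \<in> fst ?c \<and> ((snd ?c \<circ> g) has_vector_derivative rvel ?c g s) (at s within {0..1})"
      using d(2) has_vector_derivative_at_within[OF geodesic_vel[OF g c(1)]] by blast
    ultimately show "\<exists>c\<in>atlas M. \<exists>w. \<exists>d>0.
      (\<forall>s\<in>{0..1}. \<bar>s - t\<bar> < d \<longrightarrow> g s \<in> fst c \<and> ((snd c \<circ> g) has_vector_derivative w s) (at s within {0..1})) \<and>
      (w \<longlongrightarrow> w t) (at t within {0..1})"
      using d(1) c by (intro bexI[of _ ?c] exI[of _ "rvel ?c g"] exI[of _ d]) auto
  qed
  show "speed g t = tnorm M (g 0) (gvel g 0)" if t: "t \<in> {0..1}"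
  proof -
    let ?c = "chart_at M (g t)"
    have c: "?c \<in> atlas M" "g t \<in> fst ?c" by auto
    have "speed g t = sqrt (rmetric M (g t) (gvel g t) (gvel g t))"
      using speed_C1[OF C1 c(1) t c(2)] geodesic_kinetic_chart[OF g c] uv[OF t c] by simp
    then show ?thesis using geodesic_kinetic[OF g, of t] by (simp add: tnorm_def)
  qed
qed

text \<open>By continuity both geodesics stay for a short time in one coordinate ball with
  velocities bounded by \<open>b\<close>, where \<open>momentum_unique\<close> applies.\<close>

lemma geodesic_unique_local:
  assumes g: "geodesic g1" "geodesic g2" and eq: "g1 t0 = g2 t0" "gvel g1 t0 = gvel g2 t0"
  shows "\<exists>e>0. \<forall>t. \<bar>t - t0\<bar> < e \<longrightarrow> g1 t = g2 t"
proof -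
  let ?c = "chart_at M (g1 t0)"
  have c: "?c \<in> atlas M" "g1 t0 \<in> fst ?c" "g2 t0 \<in> fst ?c" by (auto simp: eq(1)[symmetric])
  define gg where "gg i = (if i then g1 else g2)" for i
  have gg: "geodesic (gg i)" "gg i t0 = g1 t0" for i using g eq by (auto simp: gg_def)
  have vel0: "rvel ?c (gg i) t0 = gvel g1 t0" for i
    using eq gvel_rvel[of g1 t0] gvel_rvel[of g2 t0] by (auto simp: gg_def)
  obtain r K lam where ball: "ball (snd ?c (g1 t0)) r \<subseteq> snd ?c ` fst ?c"
    and "metric_ball (local_metric M ?c) (Dmetric ?c) (snd ?c (g1 t0)) r K lam"
    using metric_ball_exists[OF c(1,2) zero_less_one] by blast
  then interpret metric_ball "local_metric M ?c" "Dmetric ?c" "snd ?c (g1 t0)" r K lam by blast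
  define b where "b = norm (gvel g1 t0) + 1"
  have "\<exists>d>0. \<forall>t. \<bar>t - t0\<bar> < d \<longrightarrow> gg i t \<in> fst ?c \<and> snd ?c (gg i t) \<in> ball (snd ?c (g1 t0)) r \<and> norm (rvel ?c (gg i) t) < b" for i
  proof -
    have gc: "gg i t0 \<in> fst ?c" using gg(2) c by simp
    have 1: "((\<lambda>t. snd ?c (gg i t)) \<longlongrightarrow> snd ?c (g1 t0)) (at t0)"
      using isCont_tendsto_compose[OF isCont_chart[OF c(1) gc] geodesic_cont[OF gg(1), unfolded isCont_def]] gg(2)[of i] by simp
    have "isCont (rvel ?c (gg i)) t0" using geodesic_eq[OF gg(1) c(1) gc] has_vector_derivative_continuous by blast
    then have 2: "((\<lambda>t. norm (rvel ?c (gg i) t)) \<longlongrightarrow> norm (gvel g1 t0)) (at t0)"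
      using vel0[of i] by (auto simp: isCont_def intro: tendsto_norm)
    have "eventually (\<lambda>t. gg i t \<in> fst ?c \<and> snd ?c (gg i t) \<in> ball (snd ?c (g1 t0)) r \<and> norm (rvel ?c (gg i) t) < b) (at t0)"
      using topological_tendstoD[OF 1 open_ball, of "snd ?c (g1 t0)" r] order_tendstoD(2)[OF 2, of b] r_pos
        eventually_in_chart[OF c(1) geodesic_cont[OF gg(1), unfolded isCont_def] gc]
      by (auto simp: b_def intro: eventually_conj)
    then obtain d where "d > 0" "\<And>t. t \<noteq> t0 \<Longrightarrow> dist t t0 < d \<Longrightarrow> gg i t \<in> fst ?c \<and> snd ?c (gg i t) \<in> ball (snd ?c (g1 t0)) r \<and> norm (rvel ?c (gg i) t) < b"
      by (auto simp: eventually_at)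
    moreover have "gg i t0 \<in> fst ?c \<and> snd ?c (gg i t0) \<in> ball (snd ?c (g1 t0)) r \<and> norm (rvel ?c (gg i) t0) < b"
      using gc gg(2)[of i] r_pos vel0[of i] by (simp add: b_def)
    ultimately show ?thesis by (metis dist_real_def)
  qed
  then obtain dd where dd: "\<And>i. dd i > 0" "\<And>i t. \<bar>t - t0\<bar> < dd i \<Longrightarrow> gg i t \<in> fst ?c"
    "\<And>i t. \<bar>t - t0\<bar> < dd i \<Longrightarrow> snd ?c (gg i t) \<in> ball (snd ?c (g1 t0)) r"
    "\<And>i t. \<bar>t - t0\<bar> < dd i \<Longrightarrow> norm (rvel ?c (gg i) t) < b" by metis
  define d where "d = min (dd True) (dd False) / 2"
  have d: "d > 0" "d < dd i" for i using dd(1)[of True] dd(1)[of False] by (cases i; simp add: d_def min_def)+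
  have dl: "\<bar>t - t0\<bar> < dd i" if "\<bar>t - t0\<bar> \<le> d" for i t using that d(2)[of i] by linarith
  have "\<exists>e>0. \<forall>t. \<bar>t - t0\<bar> \<le> e \<longrightarrow> (snd ?c \<circ> gg True) t = (snd ?c \<circ> gg False) t"
  proof (rule momentum_unique[where q = "\<lambda>i. snd ?c \<circ> gg i" and q' = "\<lambda>i. rvel ?c (gg i)" and P' = "\<lambda>i. force ?c (gg i)" and d = d and b = b])
    show "b > 0" by (simp add: b_def add_nonneg_pos)
    show "((snd ?c \<circ> gg i) has_vector_derivative rvel ?c (gg i) t) (at t)" if "\<bar>t - t0\<bar> \<le> d" for i t
      by (rule geodesic_vel[OF gg(1) c(1) dd(2)[OF dl[OF that]]])
    show "blinfun_apply (force ?c (gg i) t) u = Dmetric ?c ((snd ?c \<circ> gg i) t) u (rvel ?c (gg i) t) (rvel ?c (gg i) t) / 2"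
      if "\<bar>t - t0\<bar> \<le> d" for i t u
      using force_apply[OF gg(1) c(1) dd(2)[OF dl[OF that]]] by simp
    show "((\<lambda>s. local_metric M ?c ((snd ?c \<circ> gg i) s) (rvel ?c (gg i) s)) has_vector_derivative force ?c (gg i) t) (at t)"
      if "\<bar>t - t0\<bar> \<le> d" for i t
      using geodesic_momentum(1)[OF gg(1) c(1) dd(2)[OF dl[OF that]]] by (simp only: comp_def)
  qed (use d dd(3)[OF dl] dd(4)[OF dl] gg(2) vel0 in \<open>auto intro: less_imp_le\<close>)
  then obtain e where e: "e > 0" "\<And>t. \<bar>t - t0\<bar> \<le> e \<Longrightarrow> snd ?c (g1 t) = snd ?c (g2 t)"
    by (auto simp: gg_def)
  have "g1 t = g2 t" if t: "\<bar>t - t0\<bar> < min d e" for t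
  proof -
    have "g1 t \<in> fst ?c" "g2 t \<in> fst ?c"
      using dd(2)[OF dl, of t True] dd(2)[OF dl, of t False] t by (auto simp: gg_def)
    then show ?thesis using e(2)[of t] t c(1) by (metis chart_inv_apply less_imp_le min_less_iff_conj)
  qed
  then show ?thesis using d e by (intro exI[of _ "min d e"]) auto
qed

text \<open>The times at which positions and velocities agree form an open set by local uniqueness
  and a closed set by continuity; the real line is connected.\<close>

lemma geodesic_unique:
  assumes g: "geodesic g1" "geodesic g2" and eq: "g1 0 = g2 0" "gvel g1 0 = gvel g2 0"
  shows "g1 = g2"
proof -
  define A where "A = {t. g1 t = g2 t \<and> gvel g1 t = gvel g2 t}"
  have "open A" unfolding open_dist
  proof
    fix t0 assume "t0 \<in> A"
    then obtain e where e: "e > 0" "\<And>t. \<bar>t - t0\<bar> < e \<Longrightarrow> g1 t = g2 t"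
      using geodesic_unique_local[OF g] unfolding A_def by blast
    have "t \<in> A" if t: "\<bar>t - t0\<bar> < e" for t
    proof -
      let ?c = "chart_at M (g1 t)"
      have "((snd ?c \<circ> g2) has_vector_derivative rvel ?c g1 t) (at t)"
      proof (rule has_vector_derivative_transform_within_open[OF geodesic_vel[OF g(1)]])
        show "t \<in> ball t0 e" using t by (simp add: dist_real_def)
        show "(snd ?c \<circ> g1) s = (snd ?c \<circ> g2) s" if "s \<in> ball t0 e" for s
          using e(2)[of s] that by (simp add: dist_real_def)
      qed auto
      then have "rvel ?c g2 t = rvel ?c g1 t" by (rule vector_derivative_at)
      then show ?thesis using e(2)[OF t] by (simp add: A_def gvel_rvel)
    qed
    then show "\<exists>e>0. \<forall>t. dist t t0 < e \<longrightarrow> t \<in> A" using e(1) by (auto simp: dist_real_def)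
  qed
  moreover have "open (- A)" unfolding open_dist
  proof
    fix t0 assume t0: "t0 \<in> - A"
    show "\<exists>e>0. \<forall>t. dist t t0 < e \<longrightarrow> t \<in> - A"
    proof (cases "g1 t0 = g2 t0")
      case False
      have "open {t. g1 t \<noteq> g2 t}"
        using geodesic_cont g by (intro open_Collect_neq) (auto simp: continuous_on_eq_continuous_at)
      then obtain e where "e > 0" "\<forall>t. dist t t0 < e \<longrightarrow> t \<in> {t. g1 t \<noteq> g2 t}"
        using False unfolding open_dist by blast
      then show ?thesis by (auto simp: A_def)
    next
      case True
      let ?c = "chart_at M (g1 t0)"
      have c: "?c \<in> atlas M" "g1 t0 \<in> fst ?c" "g2 t0 \<in> fst ?c" using True by (auto simp: True[symmetric])
      \<comment> \<open>Here positions agree and velocities differ. In the fixed chart at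
        \<open>g1 t0\<close> the velocities are continuous and so differ nearby, and a difference in
        one chart excludes agreement in the preferred chart.\<close>
      have ne: "rvel ?c g1 t0 - rvel ?c g2 t0 \<noteq> 0"
        using t0 True by (auto simp: A_def gvel_rvel)
      have "isCont (\<lambda>t. rvel ?c g1 t - rvel ?c g2 t) t0"
        by (intro continuous_diff has_vector_derivative_continuous[OF geodesic_eq[OF g(1) c(1,2)]]
            has_vector_derivative_continuous[OF geodesic_eq[OF g(2) c(1,3)]])
      from continuous_at_avoid[OF this ne]
      obtain e where e: "e > 0" "\<And>t. dist t0 t < e \<Longrightarrow> rvel ?c g1 t - rvel ?c g2 t \<noteq> 0" by blast
      obtain d where d: "d > 0" "\<And>t. \<bar>t - t0\<bar> < d \<Longrightarrow> g1 t \<in> fst ?c" using geodesic_nbhd[OF g(1) c(1,2)] by blast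
      have "t \<in> - A" if t: "dist t t0 < min d e" for t
      proof
        assume "t \<in> A"
        then have a: "g1 t = g2 t" "rvel (chart_at M (g1 t)) g1 t = rvel (chart_at M (g1 t)) g2 t"
          by (auto simp: A_def gvel_rvel)
        have "g1 t \<in> fst ?c" "g2 t \<in> fst ?c" using d(2)[of t] t a by (auto simp: dist_real_def)
        have "g2 t \<in> fst (chart_at M (g1 t))" unfolding a(1) by simp
        have "rvel ?c g1 t = coord_change (chart_at M (g1 t)) ?c (g1 t) (rvel (chart_at M (g1 t)) g1 t)"
          by (rule rvel_change[OF g(1) chart_at_atlas c(1) chart_at_mem \<open>g1 t \<in> fst ?c\<close>])
        also have "\<dots> = coord_change (chart_at M (g1 t)) ?c (g2 t) (rvel (chart_at M (g1 t)) g2 t)"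
          unfolding a(2) by (simp only: a(1))
        also have "\<dots> = rvel ?c g2 t"
          by (rule rvel_change[OF g(2) chart_at_atlas c(1) \<open>g2 t \<in> fst (chart_at M (g1 t))\<close> \<open>g2 t \<in> fst ?c\<close>, symmetric])
        finally have "rvel ?c g1 t = rvel ?c g2 t" .
        then show False using e(2)[of t] t by (simp add: dist_commute)
      qed
      then show ?thesis using d e by (intro exI[of _ "min d e"]) auto
    qed
  qed
  ultimately have "A = UNIV"
    using connectedD[OF connected_UNIV, of A "- A"] eq by (auto simp: A_def)
  then show ?thesis by (auto simp: A_def)
qed

lemma geodesic_scale:
  assumes g: "geodesic g"
  shows "geodesic (\<lambda>t. g (k * t))" "gvel (\<lambda>t. g (k * t)) 0 = k *\<^sub>R gvel g 0"
proof -
  let ?h = "\<lambda>t. g (k * t)"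
  have vel: "((snd c \<circ> ?h) has_vector_derivative k *\<^sub>R rvel c g (k * t)) (at t)"
    if "c \<in> atlas M" "?h t \<in> fst c" for c t
  proof -
    have "((\<lambda>t. k * t) has_vector_derivative k) (at t)" by (auto intro!: derivative_eq_intros)
    from vector_diff_chain_at[OF this geodesic_vel[OF g that]] show ?thesis by (simp add: o_def)
  qed
  then have rv: "rvel c ?h t = k *\<^sub>R rvel c g (k * t)" if "c \<in> atlas M" "?h t \<in> fst c" for c t
    using vector_derivative_at that by blast
  show "gvel ?h 0 = k *\<^sub>R gvel g 0" by (simp add: gvel_rvel rv)
  have cont: "isCont ?h t" for t
    by (rule isCont_o2[OF _ geodesic_cont[OF g]]) (intro continuous_intros)
  show "geodesic ?h" unfolding geodesic_on_def Let_def
  proof (intro conjI ballI impI)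
    show "continuous_on UNIV ?h" using cont by (simp add: continuous_at_imp_continuous_on)
    fix c t assume c: "c \<in> atlas M" "?h t \<in> fst c"
    show "(snd c \<circ> ?h) differentiable at t" using vel[OF c] by (auto simp: has_vector_derivative_def differentiable_def)
    have "eventually (\<lambda>s. ?h s \<in> fst c) (at t)"
      using cont[of t] c(2) eventually_in_chart[OF c(1)] by (simp add: isCont_def)
    then obtain d where d: "d > 0" "\<And>s. s \<noteq> t \<Longrightarrow> dist s t < d \<Longrightarrow> ?h s \<in> fst c" by (auto simp: eventually_at)
    have "((\<lambda>t. k * t) has_vector_derivative k) (at t)" by (auto intro!: derivative_eq_intros)
    from vector_diff_chain_at[OF this geodesic_eq[OF g c]]
    have "((\<lambda>s. rvel c g (k * s)) has_vector_derivative k *\<^sub>R - christoffel M c (snd c (?h t)) (rvel c g (k * t)) (rvel c g (k * t))) (at t)"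
      by (simp add: o_def)
    from bounded_linear.has_vector_derivative[OF bounded_linear_scaleR_right this, of k]
    have "((\<lambda>s. k *\<^sub>R rvel c g (k * s)) has_vector_derivative
        - christoffel M c (snd c (?h t)) (rvel c ?h t) (rvel c ?h t)) (at t)"
      unfolding rv[OF c] christoffel_scaleR[OF c] by (simp add: power2_eq_square)
    then have "((\<lambda>s. rvel c ?h s) has_vector_derivative
        - christoffel M c (snd c (?h t)) (rvel c ?h t) (rvel c ?h t)) (at t)"
    proof (rule has_vector_derivative_transform_within[where f = "\<lambda>s. k *\<^sub>R rvel c g (k * s)" and d = d])
      fix s assume "dist s t < d"
      then have "?h s \<in> fst c" using d(2)[of s] c(2) by (cases "s = t") simp_all
      then show "k *\<^sub>R rvel c g (k * s) = rvel c ?h s" by (rule rv[OF c(1), symmetric])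
    qed (rule d(1) UNIV_I)+
    then show "((\<lambda>s. rvel c ?h s) has_vector_derivative
        - christoffel M c ((snd c \<circ> ?h) t) (rvel c ?h t) (rvel c ?h t)) (at t)"
      by (simp only: comp_def)
  qed (rule open_UNIV is_interval_univ UNIV_not_empty)+
qed

lemma geodesic_const: "geodesic (\<lambda>_. x)" "gvel (\<lambda>_. x) 0 = 0"
proof -
  show "gvel (\<lambda>_. x) 0 = 0" by (simp add: gvel_rvel o_def)
  have "christoffel M c (snd c x) 0 0 = 0" if "c \<in> atlas M" "x \<in> fst c" for c
    using christoffel_scaleR[OF that, of 0 0] by simp
  then show "geodesic (\<lambda>_. x)"
    by (auto simp: geodesic_on_def Let_def o_def)
qed

end

section \<open>The exponential chart and proximal normals\<close>

locale riem_exp = riem M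
  for M :: "('m::t2_space, 'h::{real_inner, banach, second_countable_topology}) riemannian" +
  fixes x :: 'm and V :: "'h set"
  assumes dom: "exp_chart_domain M x V"
begin

abbreviation chx :: "('m, 'h) chart" where "chx \<equiv> chart_at M x"
abbreviation phi :: "'m \<Rightarrow> 'h" where "phi \<equiv> snd (chart_at M x)"
abbreviation Gx :: "'h \<Rightarrow> 'h \<Rightarrow>\<^sub>L 'h \<Rightarrow>\<^sub>L real" where "Gx \<equiv> local_metric M (chart_at M x)"

lemma exp_domain: "0 \<in> V" "open V" "inj_on (rexp M x) V"
  using dom by (auto simp: exp_chart_domain_def diffeo_onto_def bij_betw_def)

text \<open>Were there no geodesic with initial velocity \<open>v \<noteq> 0\<close>, then by rescaling there would be none
  with initial velocity \<open>k *\<^sub>R v\<close> either, and \<^term>\<open>rexp M x\<close> would take the same junk value at all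
  these vectors, contradicting its injectivity on \<open>V\<close>.\<close>

lemma geodesic_exists: "\<exists>g. geodesic g \<and> g 0 = x \<and> gvel g 0 = v"
proof (rule ccontr)
  assume none: "\<not> ?thesis"
  then have v: "v \<noteq> 0" using geodesic_const[of x] by auto
  have none': "\<not> (geodesic g \<and> g 0 = x \<and> gvel g 0 = k *\<^sub>R v)" if k: "k \<noteq> 0" for k g
  proof
    assume g: "geodesic g \<and> g 0 = x \<and> gvel g 0 = k *\<^sub>R v"
    then have "geodesic (\<lambda>t. g (1 / k * t)) \<and> g (1 / k * 0) = x \<and> gvel (\<lambda>t. g (1 / k * t)) 0 = v"
      using geodesic_scale[of g "1 / k"] k by simp
    then show False using none by blast
  qed
  have junk: "rexp M x (k *\<^sub>R v) = (THE g :: real \<Rightarrow> 'm. False) 1" if "k \<noteq> 0" for k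
  proof -
    have "(\<lambda>g. geodesic g \<and> g 0 = x \<and> gvel g 0 = k *\<^sub>R v) = (\<lambda>_. False)"
      using none'[OF that] by (intro ext) simp
    then show ?thesis by (simp only: rexp_def geod_def)
  qed
  have "((\<lambda>k. k *\<^sub>R v) \<longlongrightarrow> 0 *\<^sub>R v) (at (0::real))" by (intro tendsto_intros)
  then have "eventually (\<lambda>k. k *\<^sub>R v \<in> V) (at (0::real))"
    by (rule topological_tendstoD) (use exp_domain in auto)
  then obtain d where d: "d > 0" "\<And>k::real. k \<noteq> 0 \<Longrightarrow> dist k 0 < d \<Longrightarrow> k *\<^sub>R v \<in> V"
    unfolding eventually_at by blast
  have "(d / 2) *\<^sub>R v \<in> V" "(d / 4) *\<^sub>R v \<in> V" using d by (auto simp: dist_real_def)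
  moreover have "rexp M x ((d / 2) *\<^sub>R v) = rexp M x ((d / 4) *\<^sub>R v)"
    using junk[of "d/2"] junk[of "d/4"] d by simp
  ultimately have "(d / 2) *\<^sub>R v = (d / 4) *\<^sub>R v" using exp_domain(3) by (meson inj_onD)
  then show False using v d by simp
qed

lemma geod:
  shows geod_geodesic: "geodesic (geod M x v)"
    and geod_0: "geod M x v 0 = x"
    and geod_gvel: "gvel (geod M x v) 0 = v"
proof -
  have "\<exists>!g. geodesic g \<and> g 0 = x \<and> gvel g 0 = v"
  proof (rule ex_ex1I[OF geodesic_exists])
    fix g g' assume "geodesic g \<and> g 0 = x \<and> gvel g 0 = v" "geodesic g' \<and> g' 0 = x \<and> gvel g' 0 = v"
    then show "g = g'" by (intro geodesic_unique) auto
  qed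
  from theI'[OF this] show "geodesic (geod M x v)" "geod M x v 0 = x" "gvel (geod M x v) 0 = v"
    unfolding geod_def by blast+
qed

lemma geod_scale: "geod M x (k *\<^sub>R v) t = geod M x v (k * t)"
proof -
  have "geod M x (k *\<^sub>R v) = (\<lambda>t. geod M x v (k * t))"
    using geodesic_scale[OF geod_geodesic, of v k] geod
    by (intro geodesic_unique) auto
  then show ?thesis by simp
qed

lemma rexp_geod: "rexp M x (k *\<^sub>R v) = geod M x v k"
  by (simp add: rexp_def geod_scale)

lemma rexp_0: "rexp M x 0 = x"
  using rexp_geod[of 0 0] geod_0[of 0] by simp

lemma geod_rvel: "rvel chx (geod M x v) 0 = v"
  using geod_gvel[of v] geod_0[of v] by (simp add: gvel_rvel)

section \<open>The exponential map in the preferred chart at its base point\<close>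

lemma exp_expansion:
  "\<exists>d>0. \<exists>K>0. \<forall>s. norm s < d \<longrightarrow> rexp M x s \<in> fst chx \<and> norm (phi (rexp M x s) - phi x - s) \<le> K * (norm s)\<^sup>2"
proof -
  let ?S = "{v \<in> V. rexp M x v \<in> fst chx}" and ?f = "phi \<circ> rexp M x"
  have sm: "smooth_on ?S ?f" using dom by (auto simp: exp_chart_domain_def diffeo_onto_def)
  have S0: "0 \<in> ?S" using exp_domain rexp_0 by simp
  obtain r K f' where r: "r > 0" "K > 0" "ball 0 r \<subseteq> ?S"
    and f': "\<And>y. y \<in> ball 0 r \<Longrightarrow> (?f has_derivative f' y) (at y)"
    "\<And>y v. y \<in> ball 0 r \<Longrightarrow> norm (f' y v) \<le> K * norm v"
    "\<And>y z v. y \<in> ball 0 r \<Longrightarrow> z \<in> ball 0 r \<Longrightarrow> norm (f' y v - f' z v) \<le> K * norm (y - z) * norm v"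
    by (rule smooth_on_locally_C11[OF sm S0], rule that)
  \<comment> \<open>The image of the line \<open>t *\<^sub>R v\<close> is the geodesic with initial
    velocity \<open>v\<close>, so the differential of the exponential map at 0 is the
    identity.\<close>
  have f'0: "f' 0 v = v" for v
  proof -
    have "((\<lambda>t. t *\<^sub>R v) has_vector_derivative v) (at (0::real))" by (auto intro!: derivative_eq_intros)
    from vector_derivative_diff_chain_within[OF this, of ?f "f' 0"] f'(1)[of 0] r(1)
    have "((\<lambda>t. ?f (t *\<^sub>R v)) has_vector_derivative f' 0 v) (at 0)"
      by (simp add: o_def has_derivative_at_withinI)
    moreover have "((phi \<circ> geod M x v) has_vector_derivative rvel chx (geod M x v) 0) (at 0)"
      by (rule geodesic_vel[OF geod_geodesic]) (simp_all add: geod_0)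
    ultimately show ?thesis unfolding comp_def rexp_geod geod_rvel[unfolded comp_def]
      using vector_derivative_unique_at by blast
  qed
  have "rexp M x s \<in> fst chx \<and> norm (phi (rexp M x s) - phi x - s) \<le> K * (norm s)\<^sup>2" if s: "norm s < r" for s
  proof
    show "rexp M x s \<in> fst chx" using s r(3) by (auto simp: subset_iff)
    have "norm (?f s - ?f 0 - f' 0 (s - 0)) \<le> K * (norm (s - 0))\<^sup>2"
      by (rule C11_taylor[where f = ?f and ?p0.0 = 0 and r = r, OF _ f'(1) f'(3)]) (use r s in auto)
    then show "norm (phi (rexp M x s) - phi x - s) \<le> K * (norm s)\<^sup>2" by (simp add: f'0 rexp_0)
  qed
  then show ?thesis using r by blast
qed

text \<open>Continuity of the inverse exponential map at \<open>x\<close>, with closeness to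
  \<open>x\<close> measured in the chart \<open>phi\<close>. It is obtained from smoothness of the
  inverse in these coordinates.\<close>

lemma exp_inverse_nbhd:
  assumes W: "open W" "0 \<in> W"
  shows "\<exists>d>0. \<forall>z\<in>fst chx. norm (phi z - phi x) < d \<longrightarrow>
    z \<in> rexp M x ` V \<and> inv_into V (rexp M x) z \<in> W"
proof -
  let ?U = "rexp M x ` V" and ?i = "inv_into V (rexp M x)"
  let ?S = "phi ` (?U \<inter> fst chx)"
  have sm: "smooth_on ?S (?i \<circ> chart_inv chx)" using dom by (auto simp: exp_chart_domain_def diffeo_onto_def)
  have xU: "x \<in> ?U" using exp_domain rexp_0 by (metis image_eqI)
  then have xS: "phi x \<in> ?S" by simp
  obtain r K f' where "r > 0" "K > 0" "ball (phi x) r \<subseteq> ?S"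
    "\<And>y. y \<in> ball (phi x) r \<Longrightarrow> ((?i \<circ> chart_inv chx) has_derivative f' y) (at y)"
    "\<And>y v. y \<in> ball (phi x) r \<Longrightarrow> norm (f' y v) \<le> K * norm v"
    "\<And>y z v. y \<in> ball (phi x) r \<Longrightarrow> z \<in> ball (phi x) r \<Longrightarrow> norm (f' y v - f' z v) \<le> K * norm (y - z) * norm v"
    by (rule smooth_on_locally_C11[OF sm xS], rule that)
  then have "((?i \<circ> chart_inv chx) has_derivative f' (phi x)) (at (phi x))" by simp
  then have "isCont (?i \<circ> chart_inv chx) (phi x)" by (rule has_derivative_continuous)
  moreover have "?i x = 0" using inv_into_f_f[OF exp_domain(3,1)] rexp_0 by simp
  ultimately have "((?i \<circ> chart_inv chx) \<longlongrightarrow> 0) (at (phi x))" by (simp add: isCont_def)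
  from topological_tendstoD[OF this W]
  obtain d1 where d1: "d1 > 0" "\<And>p. p \<noteq> phi x \<Longrightarrow> dist p (phi x) < d1 \<Longrightarrow> (?i \<circ> chart_inv chx) p \<in> W"
    by (auto simp: eventually_at)
  have "open ?S" using sm unfolding smooth_on_def by (rule conjunct1)
  then obtain d2 where d2: "d2 > 0" "ball (phi x) d2 \<subseteq> ?S" by (rule openE[OF _ xS])
  have "z \<in> ?U \<and> ?i z \<in> W" if z: "z \<in> fst chx" "norm (phi z - phi x) < min d1 d2" for z
  proof
    have "phi z \<in> ?S" using d2 z by (auto simp: dist_norm norm_minus_commute)
    then obtain u where u: "u \<in> ?U" "u \<in> fst chx" "phi z = phi u" by blast
    then have "z = u" using z(1) chart_inv_apply[OF chart_at_atlas] by metis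
    then show "z \<in> ?U" using u by simp
    show "?i z \<in> W"
    proof (cases "phi z = phi x")
      case True
      then have "z = x" using z(1) chart_inv_apply[OF chart_at_atlas] chart_at_mem by metis
      then show ?thesis using \<open>?i x = 0\<close> W by simp
    next
      case False
      then show ?thesis using d1(2)[of "phi z"] z by (simp add: dist_norm)
    qed
  qed
  then show ?thesis using d1 d2 by (intro exI[of _ "min d1 d2"]) auto
qed

lemma Gx_at: "Gx (phi x) u v = rmetric M x u v"
  by (rule local_metric_at)

text \<open>The competitor is \<open>g\<close> with its start displaced to \<open>z\<close> by the
  cutoff. Keeping \<open>g\<close> in the ball of radius \<open>r / 2\<close> and
  \<open>\<xi>\<close> shorter than \<open>r / 2\<close> leaves the displaced curve in the metric
  ball.\<close>

lemma rdist_upper: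
  assumes a: "tnorm M x w = a" "a > 0"
  shows "\<exists>C d. d > 0 \<and> C \<ge> 0 \<and> (\<forall>z\<in>fst chx. norm (phi z - phi x) < d \<longrightarrow>
    rdist M z (geod M x w 1) \<le> a + (C * (norm (phi z - phi x))\<^sup>2 - 2 * rmetric M x w (phi z - phi x)) / (2 * a))"
proof -
  define g where "g = geod M x w"
  have g: "geodesic g" "g 0 = x" "gvel g 0 = w" by (simp_all add: g_def geod)
  have c: "chx \<in> atlas M" "x \<in> fst chx" by auto
  obtain r K lam where ball: "ball (phi x) r \<subseteq> phi ` fst chx" and "metric_ball Gx (Dmetric chx) (phi x) r K lam"
    using metric_ball_exists[OF c zero_less_one] by blast
  then interpret metric_ball Gx "Dmetric chx" "phi x" r K lam by blast
  have "((\<lambda>t. phi (g t)) \<longlongrightarrow> phi (g 0)) (at 0)"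
    by (rule isCont_tendsto_compose[OF isCont_chart]) (use g c geodesic_cont[OF g(1), of 0] in \<open>auto simp: isCont_def\<close>)
  then have "eventually (\<lambda>t. phi (g t) \<in> ball (phi x) (r / 2)) (at 0)"
    by (rule topological_tendstoD) (use g r_pos in auto)
  moreover have "eventually (\<lambda>t. g t \<in> fst chx) (at 0)"
    by (rule eventually_in_chart[OF c(1) geodesic_cont[OF g(1), unfolded isCont_def]]) (use g c in auto)
  ultimately have "eventually (\<lambda>t. g t \<in> fst chx \<and> phi (g t) \<in> ball (phi x) (r / 2)) (at 0)"
    by (simp add: eventually_conj_iff)
  then obtain d0 where d0: "d0 > 0" "\<And>t. t \<noteq> 0 \<Longrightarrow> dist t 0 < d0 \<Longrightarrow> g t \<in> fst chx \<and> phi (g t) \<in> ball (phi x) (r / 2)"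
    unfolding eventually_at by blast
  define d where "d = min 1 (d0 / 2)"
  have d: "0 < d" "d \<le> 1" "d / 2 > 0" "d < d0" using d0 by (auto simp: d_def min_def)
  have dom: "g t \<in> fst chx" "phi (g t) \<in> ball (phi x) (r / 2)" if "t \<in> {0..d}" for t
    using d0(2)[of t] that d g c r_pos by (cases "t = 0"; auto)+
  have C1g: "C1_curve M g" and spg: "\<And>t. t \<in> {0..1} \<Longrightarrow> speed g t = a"
    using geodesic_C1[OF g(1)] geodesic_speed[OF g(1)] g a by auto
  \<comment> \<open>The velocity bound that follows from conservation of energy and
    coercivity.\<close>
  define b where "b = a / sqrt lam"
  \<comment> \<open>The bound \<open>2 / (d / 2)\<close> for the derivative of the cutoff of width
    \<open>d / 2\<close>.\<close>
  define X where "X = 4 / d"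
  define C where "C = K * (b + X)\<^sup>2"
  have C0: "C \<ge> 0" using K_pos by (simp add: C_def)
  have kin: "Gx (phi (g t)) (rvel chx g t) (rvel chx g t) = a\<^sup>2" if "g t \<in> fst chx" for t
    using geodesic_kinetic_chart[OF g(1) c(1) that] geodesic_kinetic[OF g(1), of t] g a tnorm_power2[of x w] by simp
  have vb: "norm (rvel chx g t) \<le> b" if "t \<in> {0..d}" for t
  proof -
    have "lam * (norm (rvel chx g t))\<^sup>2 \<le> a\<^sup>2"
      using G_coercive[of "phi (g t)" "rvel chx g t"] kin[OF dom(1)[OF that]] dom(2)[OF that] r_pos by auto
    then have "(norm (rvel chx g t))\<^sup>2 \<le> b\<^sup>2"
      using lam_pos by (simp add: b_def power_divide field_simps)
    then show ?thesis using a lam_pos by (simp add: b_def power2_le_iff_abs_le)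
  qed
  have main: "rdist M z (g 1) \<le> a + (C * (norm (phi z - phi x))\<^sup>2 - 2 * rmetric M x w (phi z - phi x)) / (2 * a)"
    if z: "z \<in> fst chx" "norm (phi z - phi x) < r / 2" for z
  proof -
    define \<xi> where "\<xi> = phi z - phi x"
    let ?k = "cutoff (d / 2)" and ?k' = "cutoff' (d / 2)"
    have k: "0 \<le> ?k t" "?k t \<le> 1" "\<bar>?k' t\<bar> \<le> X" if "t \<ge> 0" for t
      using cutoff_nonneg[OF d(3)] cutoff_le[OF d(3) that] cutoff'_le[OF d(3) that] by (auto simp: X_def)
    have pball: "phi (g t) + ?k t *\<^sub>R \<xi> \<in> ball (phi x) r" if t: "t \<in> {0..d}" for t
    proof -
      have "norm (?k t *\<^sub>R \<xi>) \<le> norm \<xi>" using k[of t] t by (auto intro!: mult_left_le_one_le)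
      then have "norm (phi (g t) - phi x + ?k t *\<^sub>R \<xi>) < r"
        using dom(2)[OF t] z(2) norm_triangle_ineq[of "phi (g t) - phi x" "?k t *\<^sub>R \<xi>"]
        by (simp add: \<xi>_def dist_norm norm_minus_commute)
      then show ?thesis by (simp add: dist_norm norm_minus_commute algebra_simps)
    qed
    then have img: "phi (g t) + ?k t *\<^sub>R \<xi> \<in> phi ` fst chx" if "t \<in> {0..d}" for t
      using that ball by blast
    define h where "h = (\<lambda>t. if t < d then chart_inv chx (phi (g t) + ?k t *\<^sub>R \<xi>) else g t)"
    have h: "C1_curve M h"
      "\<And>t. t \<in> {0..1} \<Longrightarrow> t < d \<Longrightarrow> speed h t =
        (let p = phi (g t) + ?k t *\<^sub>R \<xi>; w = unit_vel chx g t + ?k' t *\<^sub>R \<xi> in sqrt (Gx p w w))"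
      "\<And>t. t \<in> {0..1} \<Longrightarrow> d \<le> t \<Longrightarrow> speed h t = speed g t"
      by (rule perturb_start[OF C1g c(1) d(1,2) dom(1) img h_def]; assumption)+
    have h01: "h 0 = z" "h 1 = g 1"
      using d g z c cutoff_0[OF d(3)] by (simp_all add: h_def \<xi>_def)
    \<comment> \<open>Twice the momentum paired with the variation field. By the momentum equation
      its derivative is the first-order part of the change of energy, so after integration only the
      value at the start remains.\<close>
    define \<Psi> where "\<Psi> t = (if t < d then 2 * Gx (phi (g t)) (rvel chx g t) (?k t *\<^sub>R \<xi>) else 0)" for t
    define \<Psi>' where "\<Psi>' t = (if t < d then 2 * (Gx (phi (g t)) (rvel chx g t) (?k' t *\<^sub>R \<xi>) + force chx g t (?k t *\<^sub>R \<xi>)) else 0)" for t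
    have der\<Psi>: "(\<Psi> has_real_derivative \<Psi>' t) (at t within {0..1})" if t: "t \<in> {0..1}" for t
    proof (cases "t < d")
      case True
      have gt: "g t \<in> fst chx" using dom t True by auto
      have "((\<lambda>t. ?k t *\<^sub>R \<xi>) has_vector_derivative ?k' t *\<^sub>R \<xi>) (at t within {0..1})"
        using has_vector_derivative_scaleR[OF cutoff_deriv[OF d(3), of t "{0..1}"] has_vector_derivative_const[of \<xi>]] by simp
      from bounded_bilinear.has_vector_derivative[OF bounded_bilinear_blinfun_apply
          has_vector_derivative_at_within[OF geodesic_momentum(1)[OF g(1) c(1) gt]] this]
      have "((\<lambda>t. Gx (phi (g t)) (rvel chx g t) (?k t *\<^sub>R \<xi>)) has_real_derivative
          (Gx (phi (g t)) (rvel chx g t) (?k' t *\<^sub>R \<xi>) + force chx g t (?k t *\<^sub>R \<xi>))) (at t within {0..1})"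
        by (simp only: has_real_derivative_iff_has_vector_derivative)
      from DERIV_cmult[OF this, of 2]
      have "((\<lambda>t. 2 * Gx (phi (g t)) (rvel chx g t) (?k t *\<^sub>R \<xi>)) has_real_derivative \<Psi>' t) (at t within {0..1})"
        using True by (simp only: \<Psi>'_def if_True)
      then show ?thesis
        by (rule has_field_derivative_transform_within[where d = "d - t"]) (use True t in \<open>auto simp: \<Psi>_def dist_real_def\<close>)
    next
      case False
      have "((\<lambda>_. 0) has_real_derivative \<Psi>' t) (at t within {0..1})" using False by (simp add: \<Psi>'_def)
      then show ?thesis
      proof (rule has_field_derivative_transform_within[where d = "d / 2"])
        fix s assume "s \<in> {0..1}" "dist s t < d / 2"
        then have "d / 2 \<le> s" using False unfolding dist_real_def abs_less_iff by linarith
        then show "0 = \<Psi> s" using cutoff_zero(1)[OF d(3)] by (simp add: \<Psi>_def)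
      qed (use d t in auto)
    qed
    define f where "f t = a * t + (\<Psi> t + C * (norm \<xi>)\<^sup>2 * t) / (2 * a)" for t
    define f' where "f' t = a + (\<Psi>' t + C * (norm \<xi>)\<^sup>2) / (2 * a)" for t
    have derf: "(f has_vector_derivative f' t) (at t within {0..1})" if "t \<in> {0..1}" for t
    proof -
      have "(f has_real_derivative a * 1 + (\<Psi>' t + C * (norm \<xi>)\<^sup>2 * 1) / (2 * a)) (at t within {0..1})"
        unfolding f_def by (intro DERIV_add DERIV_cdivide DERIV_cmult DERIV_ident der\<Psi> that)
      then show ?thesis by (simp add: f'_def has_real_derivative_iff_has_vector_derivative)
    qed
    have int: "(f' has_integral (f 1 - f 0)) {0..1}"
      by (rule fundamental_theorem_of_calculus) (use derf in auto)
    have le: "speed h t \<le> f' t" if t: "t \<in> {0..1}" for t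
    proof (cases "t < d")
      case True
      then have td: "t \<in> {0..d}" using t by auto
      define E where "E = Gx (phi (g t) + ?k t *\<^sub>R \<xi>) (rvel chx g t + ?k' t *\<^sub>R \<xi>) (rvel chx g t + ?k' t *\<^sub>R \<xi>)"
      have sp: "speed h t = sqrt E"
        using h(2)[OF t True] geodesic_unit_vel[OF g(1) t c(1) dom(1)[OF td]] by (simp add: E_def Let_def)
      have qball: "phi (g t) \<in> ball (phi x) r" using dom(2)[OF td] r_pos by auto
      have "E \<le> Gx (phi (g t)) (rvel chx g t) (rvel chx g t) + Dmetric chx (phi (g t)) (?k t *\<^sub>R \<xi>) (rvel chx g t) (rvel chx g t)
          + 2 * Gx (phi (g t)) (rvel chx g t) (?k' t *\<^sub>R \<xi>) + K * (b + X)\<^sup>2 * (norm \<xi>)\<^sup>2"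
        unfolding E_def
      proof (rule energy_upper[OF qball pball[OF td] vb[OF td]])
        show "norm (?k t *\<^sub>R \<xi>) \<le> norm \<xi>" using k[of t] t by (auto intro!: mult_left_le_one_le)
        show "norm (?k' t *\<^sub>R \<xi>) \<le> X * norm \<xi>" using k[of t] t by (auto intro!: mult_right_mono)
        show "X \<ge> 0" using d by (simp add: X_def)
      qed
      also have "\<dots> = a\<^sup>2 + (\<Psi>' t + C * (norm \<xi>)\<^sup>2)"
        using kin[OF dom(1)[OF td]] force_apply[OF g(1) c(1) dom(1)[OF td], of "?k t *\<^sub>R \<xi>"] True
        by (simp add: \<Psi>'_def C_def)
      finally have E: "E \<le> a\<^sup>2 + (\<Psi>' t + C * (norm \<xi>)\<^sup>2)" .
      have "0 \<le> lam * (norm (rvel chx g t + ?k' t *\<^sub>R \<xi>))\<^sup>2" using lam_pos by simp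
      also have "\<dots> \<le> E" unfolding E_def by (rule G_coercive[OF pball[OF td]])
      finally have "(sqrt E)\<^sup>2 = E" by simp
      moreover have "0 \<le> (sqrt E - a)\<^sup>2" by simp
      \<comment> \<open>The tangent line of the square root at \<open>a\<^sup>2\<close> removes the
        root from the length integrand; this is where \<open>a > 0\<close> enters.\<close>
      ultimately have "2 * a * sqrt E \<le> E + a\<^sup>2" by (simp add: power2_diff mult_ac)
      also have "\<dots> \<le> 2 * a\<^sup>2 + (\<Psi>' t + C * (norm \<xi>)\<^sup>2)" using E by simp
      also have "\<dots> = 2 * a * f' t" using a(2) unfolding f'_def distrib_left by (simp add: power2_eq_square)
      finally show ?thesis using a sp by simp
    next
      case False
      then show ?thesis using h(3)[OF t] spg[OF t] C0 a by (simp add: f'_def \<Psi>'_def)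
    qed
    have "(speed h has_integral curve_length M h) {0..1}"
      unfolding curve_length_speed by (intro integrable_integral integrable_continuous_real speed_continuous h(1))
    from has_integral_le[OF this int le] have "curve_length M h \<le> f 1 - f 0" by simp
    moreover have "\<Psi> 0 = 2 * rmetric M x w \<xi>"
      using d g cutoff_0[OF d(3)] geod_rvel[of w] by (simp add: \<Psi>_def Gx_at g_def)
    moreover have "\<Psi> 1 = 0" using d by (simp add: \<Psi>_def)
    ultimately have "curve_length M h \<le> a + (C * (norm \<xi>)\<^sup>2 - 2 * rmetric M x w \<xi>) / (2 * a)"
      by (simp add: f_def diff_divide_distrib add_divide_distrib)
    then show ?thesis using rdist_le[OF h(1)] h01 by (simp add: \<xi>_def)
  qed
  show ?thesis
    by (rule exI[of _ C], rule exI[of _ "r / 2"]) (use C0 r_pos main in \<open>auto simp: g_def\<close>)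
qed

end

section \<open>Curves leaving a coordinate ball, and nearest points\<close>

context riem
begin

text \<open>Finite length makes the coordinates of a curve converge up to the first exit time, so the curve
  cannot leave the chart without its coordinates reaching the boundary of the ball.\<close>

lemma exit_length:
  assumes c: "c \<in> atlas M" and mb: "metric_ball (local_metric M c) (Dmetric c) p r K lam"
    and sub: "ball p r \<subseteq> snd c ` fst c"
    and k: "C1_curve M k" and k0: "k 0 \<in> fst c" "norm (snd c (k 0) - p) < r / 2"
    and ex: "t1 \<in> {0..1}" "\<not> (k t1 \<in> fst c \<and> snd c (k t1) \<in> ball p r)"
  shows "sqrt lam * (r / 2) \<le> curve_length M k"
proof (rule ccontr)
  interpret metric_ball "local_metric M c" "Dmetric c" p r K lam by (rule mb)
  assume "\<not> ?thesis"
  then have L: "curve_length M k < sqrt lam * (r / 2)" by simp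
  have sl: "sqrt lam > 0" using lam_pos by simp
  define N where "N = fst c \<inter> snd c -` ball p r"
  have N: "open N" unfolding N_def
    using homeomorphism_cont1[OF chart_homeo[OF c]] chart_open[OF c] by (intro continuous_open_preimage) auto
  define A where "A = {0..1} \<inter> k -` (- N)"
  have "closed A" unfolding A_def
    using N C1_curve_continuous[OF k] by (intro continuous_closed_preimage) auto
  moreover have "A \<noteq> {}" "bdd_below A" using ex by (auto simp: A_def N_def intro: bdd_belowI[of _ 0])
  ultimately have TA: "Inf A \<in> A" by (intro closed_contains_Inf)
  \<comment> \<open>The first exit time. It is attained because \<open>N\<close> is open, so
    \<open>k T\<close> lies outside \<open>N\<close> while all earlier points lie inside.\<close>
  define T where "T = Inf A"
  have T: "T \<in> {0..1}" "k T \<notin> N" using TA by (auto simp: A_def T_def)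
  have inN: "k s \<in> N" if "0 \<le> s" "s < T" for s
  proof (rule ccontr)
    assume "k s \<notin> N"
    then have "s \<in> A" using that T(1) by (auto simp: A_def)
    then have "T \<le> s" unfolding T_def using \<open>bdd_below A\<close> by (rule cInf_lower)
    then show False using that by simp
  qed
  have "T \<noteq> 0" using T(2) k0 r_pos by (auto simp: N_def dist_norm norm_minus_commute)
  then have T0: "T > 0" using T(1) by simp
  define ell where "ell t = integral {0..t} (speed k)" for t
  have derl: "(ell has_real_derivative speed k t) (at t within {0..1})" if "t \<in> {0..1}" for t
    unfolding ell_def[abs_def] by (rule integral_has_real_derivative[OF speed_continuous[OF k] that])
  have mono: "ell s \<le> ell s'" if "0 \<le> s" "s \<le> s'" "s' \<le> 1" for s s'
    by (rule Icc_mono_from_deriv[where f' = "speed k"])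
      (use that in \<open>auto intro!: DERIV_subset[OF derl] simp: speed_nonneg\<close>)
  have ell01: "ell 0 = 0" "ell 1 = curve_length M k" by (simp_all add: ell_def curve_length_speed)
  have contl: "continuous_on {0..1} ell"
    using derl by (meson DERIV_continuous continuous_on_eq_continuous_within)
  let ?q = "snd c \<circ> k"
  have est: "norm (?q s' - ?q s) \<le> (ell s' - ell s) / sqrt lam" if s: "0 \<le> s" "s < s'" "s' < T" for s s'
  proof -
    have vel: "(?q has_vector_derivative unit_vel c k t) (at t within {0..1})" if "t \<in> {s..s'}" for t
      using C1_curve_vel[OF k c] inN[of t] that s T(1) by (auto simp: N_def)
    have "norm (?q s' - ?q s) \<le> ell s' / sqrt lam - ell s / sqrt lam"
    proof (rule differentiable_bound_general[where f' = "unit_vel c k" and \<phi>' = "\<lambda>t. speed k t / sqrt lam"])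
      have "continuous (at t within {s..s'}) ?q" if "t \<in> {s..s'}" for t
        by (rule continuous_within_subset[OF has_vector_derivative_continuous[OF vel[OF that]]]) (use s T(1) in auto)
      then show "continuous_on {s..s'} ?q" by (intro continuous_on_eq_continuous_within[THEN iffD2] ballI)
      show "continuous_on {s..s'} (\<lambda>t. ell t / sqrt lam)"
        using sl s T(1) by (intro continuous_intros continuous_on_subset[OF contl]) auto
      fix t assume t: "s < t" "t < s'"
      then have t01: "t \<in> {0..1}" "t \<in> {s..s'}" "at t within {0..1} = at t"
        using s T(1) by (auto simp: at_within_Icc_at)
      show "(?q has_vector_derivative unit_vel c k t) (at t)" using vel[OF t01(2)] t01(3) by simp
      have "((\<lambda>t. ell t / sqrt lam) has_real_derivative speed k t / sqrt lam) (at t)"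
        using DERIV_cdivide[OF derl[OF t01(1)]] t01(3) by simp
      then show "((\<lambda>t. ell t / sqrt lam) has_vector_derivative speed k t / sqrt lam) (at t)"
        by (simp add: has_real_derivative_iff_has_vector_derivative)
      have kt: "k t \<in> fst c" "snd c (k t) \<in> ball p r" using inN[of t] t s by (auto simp: N_def)
      have "lam * (norm (unit_vel c k t))\<^sup>2 \<le> local_metric M c (snd c (k t)) (unit_vel c k t) (unit_vel c k t)"
        by (rule G_coercive[OF kt(2)])
      then have "sqrt (lam * (norm (unit_vel c k t))\<^sup>2) \<le> speed k t"
        unfolding speed_C1[OF k c t01(1) kt(1)] by (rule real_sqrt_le_mono)
      then show "norm (unit_vel c k t) \<le> speed k t / sqrt lam"
        using sl by (simp add: real_sqrt_mult field_simps)
    qed (use s in auto)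
    then show ?thesis by (simp add: diff_divide_distrib)
  qed
  have est': "norm (?q s' - ?q s) \<le> \<bar>ell s' - ell s\<bar> / sqrt lam" if "0 \<le> s" "s < T" "0 \<le> s'" "s' < T" for s s'
  proof (cases s s' rule: linorder_cases)
    case less
    have "norm (?q s' - ?q s) \<le> (ell s' - ell s) / sqrt lam" by (rule est) (use that less in auto)
    also have "\<dots> \<le> \<bar>ell s' - ell s\<bar> / sqrt lam" using sl by (intro divide_right_mono) auto
    finally show ?thesis .
  next
    case greater
    have "norm (?q s' - ?q s) = norm (?q s - ?q s')" by (rule norm_minus_commute)
    also have "\<dots> \<le> (ell s - ell s') / sqrt lam" by (rule est) (use that greater in auto)
    also have "\<dots> \<le> \<bar>ell s' - ell s\<bar> / sqrt lam" using sl by (intro divide_right_mono) auto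
    finally show ?thesis .
  qed simp
  \<comment> \<open>Times increasing to \<open>T\<close> but staying strictly below it, where the
    coordinates of the curve are still meaningful.\<close>
  define u where "u n = T * (1 - 1 / real (Suc n))" for n
  have u: "0 \<le> u n" "u n < T" for n using T0 by (auto simp: u_def field_simps)
  have "u \<longlonglongrightarrow> T * (1 - 0)" unfolding u_def by (intro tendsto_intros LIMSEQ_Suc[OF lim_1_over_n])
  moreover have "u n \<in> {0..1} \<and> u n \<noteq> T" for n using u[of n] T(1) by auto
  ultimately have ul: "filterlim u (at T within {0..1}) sequentially"
    by (simp add: filterlim_at)
  have ellu: "(\<lambda>n. ell (u n)) \<longlonglongrightarrow> ell T"
    by (rule filterlim_compose[OF _ ul]) (use contl T(1) in \<open>auto simp: continuous_on_def\<close>)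
  have ku: "(\<lambda>n. k (u n)) \<longlonglongrightarrow> k T"
    by (rule filterlim_compose[OF _ ul]) (use C1_curve_continuous[OF k] T(1) in \<open>auto simp: continuous_on_def\<close>)
  have "Cauchy (\<lambda>n. ?q (u n))"
  proof (rule metric_CauchyI)
    fix e :: real assume "e > 0"
    then have "e * sqrt lam > 0" using sl by simp
    from metric_CauchyD[OF LIMSEQ_imp_Cauchy[OF ellu] this]
    obtain m where m: "\<And>i j. i \<ge> m \<Longrightarrow> j \<ge> m \<Longrightarrow> dist (ell (u i)) (ell (u j)) < e * sqrt lam" by blast
    have "dist (?q (u i)) (?q (u j)) < e" if "i \<ge> m" "j \<ge> m" for i j
    proof -
      have "norm (?q (u i) - ?q (u j)) \<le> \<bar>ell (u i) - ell (u j)\<bar> / sqrt lam" by (rule est') (rule u)+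
      also have "\<dots> < e" using m[OF that] sl by (simp add: dist_real_def field_simps)
      finally show ?thesis by (simp add: dist_norm)
    qed
    then show "\<exists>m. \<forall>i\<ge>m. \<forall>j\<ge>m. dist (?q (u i)) (?q (u j)) < e" by blast
  qed
  then obtain z where z: "(\<lambda>n. ?q (u n)) \<longlonglongrightarrow> z" using Cauchy_convergent_iff convergent_def by blast
  have "norm (?q (u n) - ?q 0) \<le> curve_length M k / sqrt lam" for n
  proof -
    have "norm (?q (u n) - ?q 0) \<le> \<bar>ell (u n) - ell 0\<bar> / sqrt lam" by (rule est') (use u T0 in auto)
    also have "\<dots> \<le> curve_length M k / sqrt lam"
      using mono[of 0 "u n"] mono[of "u n" 1] u[of n] T(1) ell01 sl by (intro divide_right_mono) auto
    finally show ?thesis .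
  qed
  then have "norm (z - ?q 0) \<le> curve_length M k / sqrt lam"
    by (intro Lim_norm_ubound[OF _ tendsto_diff[OF z tendsto_const]]) (auto intro: always_eventually)
  also have "\<dots> < r / 2" using L sl by (simp add: field_simps)
  finally have "norm (z - ?q 0) < r / 2" .
  moreover have "norm (z - p) \<le> norm (z - ?q 0) + norm (?q 0 - p)"
    using norm_triangle_ineq[of "z - ?q 0" "?q 0 - p"] by simp
  ultimately have "norm (z - p) < r" using k0(2) by simp
  then have zb: "z \<in> ball p r" by (simp add: dist_norm norm_minus_commute)
  then have zi: "z \<in> snd c ` fst c" using sub by blast
  have "(\<lambda>n. chart_inv c (?q (u n))) \<longlonglongrightarrow> chart_inv c z"
    by (rule isCont_tendsto_compose[OF isCont_chart_inv[OF c zi] z])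
  moreover have "chart_inv c (?q (u n)) = k (u n)" for n
    using inN[OF u] c by (simp add: N_def)
  ultimately have "(\<lambda>n. k (u n)) \<longlonglongrightarrow> chart_inv c z" by simp
  \<comment> \<open>The coordinates converge by completeness of the model space, and the Hausdorff
    property identifies \<open>k T\<close> with the point having the limit coordinates.\<close>
  from LIMSEQ_unique[OF ku this] have "k T = chart_inv c z" .
  then have "k T \<in> N" using zi zb c by (simp add: N_def)
  then show False using T(2) by simp
qed

lemma rdist_nonneg: "connected (UNIV :: 'm set) \<Longrightarrow> 0 \<le> rdist M y z"
  by (rule rdist_ge) (auto intro: curve_length_nonneg)

text \<open>Distances are bounded below by 0, so for a point of \<open>C\<close> attaining the
  infimum means being nearest.\<close>

lemma metric_proj_dist:
  assumes conn: "connected (UNIV :: 'm set)"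
  shows "z \<in> metric_proj M C y \<longleftrightarrow> z \<in> C \<and> (\<forall>c\<in>C. rdist M y z \<le> rdist M y c)"
proof -
  have bdd: "bdd_below (rdist M y ` C)" using rdist_nonneg[OF conn] by (auto intro!: bdd_belowI[of _ 0])
  have "rdist M y z = (INF c\<in>C. rdist M y c) \<longleftrightarrow> (\<forall>c\<in>C. rdist M y z \<le> rdist M y c)" if z: "z \<in> C"
  proof
    assume "rdist M y z = (INF c\<in>C. rdist M y c)"
    then show "\<forall>c\<in>C. rdist M y z \<le> rdist M y c" using cINF_lower[OF bdd] by simp
  next
    assume "\<forall>c\<in>C. rdist M y z \<le> rdist M y c"
    then show "rdist M y z = (INF c\<in>C. rdist M y c)"
      using z cINF_lower[OF bdd z] by (intro antisym cINF_greatest) auto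
  qed
  then show ?thesis by (auto simp: metric_proj_def)
qed

end

section \<open>The two inclusions between the cones\<close>

context riem_exp
begin

lemma rmetric_bounds:
  obtains m B where "m > 0" "B > 0" "\<And>u. m * (norm u)\<^sup>2 \<le> rmetric M x u u"
    "\<And>u v. \<bar>rmetric M x u v\<bar> \<le> B * norm u * norm v"
proof -
  obtain m where m: "m > 0" "\<And>u. m * (norm u)\<^sup>2 \<le> rmetric M x u u"
    using rmetric_inner[of x] by (auto simp: hilbert_inner_def)
  obtain B where B: "B > 0" "\<And>u v. norm (rmetric M x u v) \<le> norm u * norm v * B"
    using bounded_bilinear.pos_bounded[OF rmetric_bilinear[of x]] by blast
  have B': "\<bar>rmetric M x u v\<bar> \<le> B * norm u * norm v" for u v using B(2)[of u v] by (simp add: mult_ac)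
  show thesis by (rule that[OF m(1) B(1) m(2) B'])
qed

lemma tnorm_eq_0: "tnorm M x v = 0 \<Longrightarrow> v = 0"
proof -
  assume 0: "tnorm M x v = 0"
  obtain m B where m: "m > 0" "\<And>u. m * (norm u)\<^sup>2 \<le> rmetric M x u u" by (rule rmetric_bounds) blast
  have "m * (norm v)\<^sup>2 \<le> 0" using m(2)[of v] 0 tnorm_power2[of x v] by simp
  then show "v = 0" using m(1) by (simp add: mult_le_0_iff)
qed

text \<open>No point of \<open>C\<close> is closer to \<open>g 1\<close> than \<open>a\<close>, so
  the upper bound forces \<open>C |\<xi>|\<^sup>2 - 2 \<langle>w, \<xi>\<rangle>\<close> to be
  nonnegative for nearby points of the set. The zero vector is treated apart because the estimate
  divides by \<open>a\<close>.\<close>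

lemma normal_cone_subset:
  assumes conn: "connected (UNIV :: 'm set)" and v: "v \<in> metric_normal_cone M C x"
  shows "v \<in> exp_proximal_cone M V C x"
proof (cases "v = 0")
  case True
  have "rmetric M x 0 u = 0" for u using bounded_bilinear.zero_left[OF rmetric_bilinear] .
  then show ?thesis using True rmetric_nonneg
    unfolding exp_proximal_cone_def proximal_cone_def by (auto intro!: exI[of _ 1] exI[of _ UNIV])
next
  case False
  from v obtain e where e: "e > 0" "rdist M x (geod M x v e) = e * tnorm M x v"
    "x \<in> metric_proj M C (geod M x v e)" unfolding metric_normal_cone_def by blast
  define w where "w = e *\<^sub>R v"
  define a where "a = tnorm M x w"
  have y: "geod M x v e = geod M x w 1" by (simp add: w_def geod_scale)
  have "w \<noteq> 0" using False e by (simp add: w_def)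
  then have a: "a > 0" using tnorm_eq_0[of w] tnorm_nonneg[of x w] by (auto simp: a_def less_le)
  \<comment> \<open>The minimizing condition in \<open>metric_normal_cone\<close> identifies the
    distance from \<open>x\<close> with \<open>a\<close>, the length that appears in
    \<open>rdist_upper\<close>.\<close>
  have near: "a \<le> rdist M z (geod M x w 1)" if "z \<in> C" for z
  proof -
    have "a = rdist M (geod M x w 1) x" using e(1,2) y rdist_sym[of x] by (simp add: a_def w_def tnorm_scaleR)
    also have "\<dots> \<le> rdist M (geod M x w 1) z" using e(3) that unfolding y metric_proj_dist[OF conn] by blast
    finally show ?thesis by (simp add: rdist_sym)
  qed
  obtain D d where D: "d > 0" "D \<ge> 0" "\<And>z. z \<in> fst chx \<Longrightarrow> norm (phi z - phi x) < d \<Longrightarrow>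
      rdist M z (geod M x w 1) \<le> a + (D * (norm (phi z - phi x))\<^sup>2 - 2 * rmetric M x w (phi z - phi x)) / (2 * a)"
    using rdist_upper[OF a_def[symmetric] a] by auto
  obtain d' K where K: "d' > 0" "K > 0" "\<And>s. norm s < d' \<Longrightarrow> rexp M x s \<in> fst chx \<and> norm (phi (rexp M x s) - phi x - s) \<le> K * (norm s)\<^sup>2"
    using exp_expansion by auto
  obtain m B where mB: "m > 0" "B > 0" "\<And>u. m * (norm u)\<^sup>2 \<le> rmetric M x u u"
    "\<And>u v. \<bar>rmetric M x u v\<bar> \<le> B * norm u * norm v" by (rule rmetric_bounds) (rule that)
  interpret b: bounded_bilinear "rmetric M x" by (rule rmetric_bilinear)
  \<comment> \<open>Since \<open>norm \<xi> \<le> 2 * norm s\<close>, half of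
    \<open>D * (norm \<xi>)\<^sup>2\<close> is at most \<open>2 * D * (norm s)\<^sup>2\<close>; the
    other summand is the error of replacing \<open>\<xi>\<close> by \<open>s\<close>.\<close>
  define E where "E = 2 * D + B * norm w * K"
  have E: "E \<ge> 0" using D K mB by (simp add: E_def)
  \<comment> \<open>The radius \<open>d'\<close> admits the expansion of the exponential map,
    \<open>1 / K\<close> gives \<open>norm \<xi> \<le> 2 * norm s\<close>, and \<open>d / 2\<close>
    then places \<open>\<xi>\<close> in the range of the distance estimate.\<close>
  define W where "W = ball (0::'h) (min d' (min (d / 2) (1 / K)))"
  have "rmetric M x v s \<le> (E / (e * m) + 1) * rmetric M x s s"
    if s: "s \<in> inv_into V (rexp M x) ` (rexp M x ` V \<inter> C)" "s \<in> W" for s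
  proof -
    obtain z where z: "z \<in> rexp M x ` V" "z \<in> C" "s = inv_into V (rexp M x) z" using s(1) by blast
    then have zs: "rexp M x s = z" by (simp add: f_inv_into_f)
    have sn: "norm s < d'" "norm s < d / 2" "norm s < 1 / K" using s(2) by (auto simp: W_def)
    define \<xi> where "\<xi> = phi z - phi x"
    have zc: "z \<in> fst chx" "norm (\<xi> - s) \<le> K * (norm s)\<^sup>2" using K(3)[OF sn(1)] zs by (auto simp: \<xi>_def)
    have "K * norm s \<le> 1" using sn(3) K(2) by (simp add: field_simps)
    then have "K * norm s * norm s \<le> 1 * norm s" by (intro mult_right_mono) auto
    then have \<xi>2: "norm \<xi> \<le> 2 * norm s" using zc(2) norm_triangle_ineq[of "\<xi> - s" s] by (simp add: power2_eq_square)
    then have "norm (phi z - phi x) < d" using sn(2) by (simp add: \<xi>_def)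
    from order_trans[OF near[OF z(2)] D(3)[OF zc(1) this]]
    have "0 \<le> (D * (norm \<xi>)\<^sup>2 - 2 * rmetric M x w \<xi>) / (2 * a)" by (simp add: \<xi>_def)
    then have 1: "2 * rmetric M x w \<xi> \<le> D * (norm \<xi>)\<^sup>2" using a by (simp add: zero_le_divide_iff)
    have "D * (norm \<xi>)\<^sup>2 \<le> D * (2 * norm s)\<^sup>2" using \<xi>2 D by (intro mult_left_mono power_mono) auto
    then have 2: "rmetric M x w \<xi> \<le> 2 * D * (norm s)\<^sup>2" using 1 by (simp add: power_mult_distrib)
    have "\<bar>rmetric M x w (\<xi> - s)\<bar> \<le> B * norm w * norm (\<xi> - s)" by (rule mB)
    also have "\<dots> \<le> B * norm w * (K * (norm s)\<^sup>2)" using zc mB by (intro mult_left_mono) auto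
    finally have "rmetric M x w s \<le> E * (norm s)\<^sup>2" using 2 by (simp add: E_def b.diff_right algebra_simps)
    also have "\<dots> \<le> E * (rmetric M x s s / m)" using mB(1) mB(3)[of s] E by (intro mult_left_mono) (auto simp: field_simps)
    finally have "e * rmetric M x v s \<le> E / m * rmetric M x s s" by (simp add: w_def b.scaleR_left)
    then have "rmetric M x v s \<le> (E / m * rmetric M x s s) / e" using e(1) by (simp only: pos_le_divide_eq mult.commute)
    then have "rmetric M x v s \<le> E / (e * m) * rmetric M x s s" by (simp add: mult.commute)
    then show ?thesis using rmetric_nonneg[of x s] by (simp add: algebra_simps)
  qed
  moreover have "E / (e * m) + 1 > 0" using E e mB by (simp add: add_nonneg_pos)
  moreover have "open W" "0 \<in> W" using D K by (auto simp: W_def)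
  ultimately show ?thesis unfolding exp_proximal_cone_def proximal_cone_def
    by (intro CollectI exI[of _ "E / (e * m) + 1"] conjI exI[of _ W]) auto
qed

text \<open>Proximality is defined in exponential coordinates, but lengths are estimated in the
  chart \<open>phi\<close>. The two coordinates agree to second order, so the change only enlarges
  the quadratic constant.\<close>

lemma proximal_cone_chart:
  assumes v: "v \<in> exp_proximal_cone M V C x"
  shows "\<exists>d>0. \<exists>D\<ge>0. \<forall>z\<in>C \<inter> fst chx. norm (phi z - phi x) < d \<longrightarrow>
    rmetric M x v (phi z - phi x) \<le> D * (norm (phi z - phi x))\<^sup>2"
proof -
  let ?i = "inv_into V (rexp M x)"
  from v obtain \<sigma> W where \<sigma>: "\<sigma> > 0" and W: "open W" "0 \<in> W"
    and prox: "\<And>s. s \<in> ?i ` (rexp M x ` V \<inter> C) \<Longrightarrow> s \<in> W \<Longrightarrow> rmetric M x v s \<le> \<sigma> * rmetric M x s s"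
    unfolding exp_proximal_cone_def proximal_cone_def by auto
  obtain d' K where K: "d' > 0" "K > 0" "\<And>s. norm s < d' \<Longrightarrow> rexp M x s \<in> fst chx \<and> norm (phi (rexp M x s) - phi x - s) \<le> K * (norm s)\<^sup>2"
    using exp_expansion by auto
  obtain m B where mB: "m > 0" "B > 0" "\<And>u. m * (norm u)\<^sup>2 \<le> rmetric M x u u"
    "\<And>u v. \<bar>rmetric M x u v\<bar> \<le> B * norm u * norm v" by (rule rmetric_bounds) (rule that)
  interpret b: bounded_bilinear "rmetric M x" by (rule rmetric_bilinear)
  \<comment> \<open>The radius \<open>1 / (2 * K)\<close> makes the quadratic error at most half of
    \<open>norm s\<close>, whence \<open>norm s \<le> 2 * norm \<xi>\<close>; squaring this produces
    the factor 4 in \<open>D\<close>.\<close>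
  define W' where "W' = W \<inter> ball 0 (min d' (1 / (2 * K)))"
  have "open W'" "0 \<in> W'" using W K by (auto simp: W'_def)
  from exp_inverse_nbhd[OF this] obtain d where d: "d > 0"
    "\<And>z. z \<in> fst chx \<Longrightarrow> norm (phi z - phi x) < d \<Longrightarrow> z \<in> rexp M x ` V \<and> ?i z \<in> W'" by blast
  define D where "D = 4 * (\<sigma> * B + B * norm v * K)"
  have D: "D \<ge> 0" using \<sigma> mB K by (simp add: D_def)
  have "rmetric M x v (phi z - phi x) \<le> D * (norm (phi z - phi x))\<^sup>2"
    if z: "z \<in> C" "z \<in> fst chx" "norm (phi z - phi x) < d" for z
  proof -
    define s where "s = ?i z"
    define \<xi> where "\<xi> = phi z - phi x"
    have zV: "z \<in> rexp M x ` V" "s \<in> W'" using d(2)[OF z(2,3)] by (auto simp: s_def)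
    then have zs: "rexp M x s = z" by (simp add: s_def f_inv_into_f)
    have sn: "norm s < d'" "norm s < 1 / (2 * K)" "s \<in> W" using zV(2) by (auto simp: W'_def)
    have \<xi>s: "norm (\<xi> - s) \<le> K * (norm s)\<^sup>2" using K(3)[OF sn(1)] zs by (simp add: \<xi>_def)
    have "K * norm s \<le> 1 / 2" using sn(2) K(2) by (simp add: field_simps)
    then have "K * norm s * norm s \<le> 1 / 2 * norm s" by (intro mult_right_mono) auto
    then have "norm s \<le> 2 * norm \<xi>"
      using \<xi>s norm_triangle_ineq2[of s \<xi>] by (simp add: power2_eq_square norm_minus_commute)
    then have s2: "(norm s)\<^sup>2 \<le> 4 * (norm \<xi>)\<^sup>2"
      using power_mono[of "norm s" "2 * norm \<xi>" 2] by (simp add: power_mult_distrib)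
    have "rmetric M x v s \<le> \<sigma> * rmetric M x s s"
      using z(1) zV(1) sn(3) by (intro prox) (auto simp: s_def)
    also have "\<dots> \<le> \<sigma> * (B * (norm s)\<^sup>2)"
      using mB(4)[of s s] \<sigma> by (intro mult_left_mono) (auto simp: power2_eq_square)
    finally have 1: "rmetric M x v s \<le> \<sigma> * B * (norm s)\<^sup>2" by simp
    have "\<bar>rmetric M x v (\<xi> - s)\<bar> \<le> B * norm v * norm (\<xi> - s)" by (rule mB)
    also have "\<dots> \<le> B * norm v * (K * (norm s)\<^sup>2)" using \<xi>s mB by (intro mult_left_mono) auto
    finally have "rmetric M x v \<xi> \<le> (\<sigma> * B + B * norm v * K) * (norm s)\<^sup>2"
      using 1 by (simp add: b.diff_right algebra_simps)
    also have "\<dots> \<le> (\<sigma> * B + B * norm v * K) * (4 * (norm \<xi>)\<^sup>2)"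
      using s2 \<sigma> mB K by (intro mult_left_mono) auto
    finally show ?thesis by (simp add: \<xi>_def D_def algebra_simps)
  qed
  then show ?thesis using d(1) D by (intro exI[of _ d] conjI exI[of _ D]) auto
qed

text \<open>A competing curve from a point of \<open>C\<close> to \<open>g 1\<close> either stays in
  the coordinate ball, where \<open>length_lower\<close> and the proximal inequality apply, or
  leaves it and is then too long.\<close>

lemma proximal_cone_subset:
  assumes conn: "connected (UNIV :: 'm set)" and xC: "x \<in> C" and v: "v \<in> exp_proximal_cone M V C x"
  shows "v \<in> metric_normal_cone M C x"
proof -
  obtain d D where d: "d > 0" and D: "D \<ge> 0"
    and prox: "\<And>z. z \<in> C \<Longrightarrow> z \<in> fst chx \<Longrightarrow> norm (phi z - phi x) < d \<Longrightarrow>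
      rmetric M x v (phi z - phi x) \<le> D * (norm (phi z - phi x))\<^sup>2"
    using proximal_cone_chart[OF v] by auto
  have c: "chx \<in> atlas M" "x \<in> fst chx" by auto
  obtain r K lam where r: "r \<le> d" "ball (phi x) r \<subseteq> phi ` fst chx" and mb: "metric_ball Gx (Dmetric chx) (phi x) r K lam"
    using metric_ball_exists[OF c d] by blast
  interpret metric_ball Gx "Dmetric chx" "phi x" r K lam by (rule mb)
  interpret b: bounded_bilinear "rmetric M x" by (rule rmetric_bilinear)
  have sl: "sqrt lam > 0" using lam_pos by simp
  define n where "n = tnorm M x v"
  have n: "n \<ge> 0" by (simp add: n_def tnorm_nonneg)
  define bb where "bb e = e * n / sqrt lam" for e
  note gv = geod_geodesic[of v] geod_0[of v]
  have "((\<lambda>t. phi (geod M x v t)) \<longlongrightarrow> phi (geod M x v 0)) (at 0)"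
    by (rule isCont_tendsto_compose[OF isCont_chart]) (use gv c geodesic_cont[OF gv(1), of 0] in \<open>auto simp: isCont_def\<close>)
  then have "eventually (\<lambda>t. phi (geod M x v t) \<in> ball (phi x) (r / 2)) (at 0)"
    by (rule topological_tendstoD) (use gv r_pos in auto)
  moreover have "eventually (\<lambda>t. geod M x v t \<in> fst chx) (at 0)"
    by (rule eventually_in_chart[OF c(1) geodesic_cont[OF gv(1), unfolded isCont_def]]) (use gv c in auto)
  ultimately have "eventually (\<lambda>t. geod M x v t \<in> fst chx \<and> phi (geod M x v t) \<in> ball (phi x) (r / 2)) (at 0)"
    by (simp add: eventually_conj_iff)
  then obtain d0 where d0: "d0 > 0" "\<And>t. t \<noteq> 0 \<Longrightarrow> dist t 0 < d0 \<Longrightarrow> geod M x v t \<in> fst chx \<and> phi (geod M x v t) \<in> ball (phi x) (r / 2)"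
    unfolding eventually_at by blast
  \<comment> \<open>Four smallness conditions on \<open>e\<close>: the geodesic stays in the half
    ball, its velocity satisfies the hypothesis of \<open>length_lower\<close>, its length is below
    the exit length, and \<open>lam / 16\<close> absorbs the proximal error.\<close>
  have "eventually (\<lambda>e. e < d0) (at_right (0::real))" using d0(1) by (intro eventually_at_rightI[of 0 d0]) auto
  moreover have "eventually (\<lambda>e. K * (bb e)\<^sup>2 + 2 * K\<^sup>2 * (bb e)\<^sup>2 / lam < lam / 32) (at_right 0)"
  proof (rule order_tendstoD)
    show "((\<lambda>e. K * (bb e)\<^sup>2 + 2 * K\<^sup>2 * (bb e)\<^sup>2 / lam) \<longlongrightarrow> 0) (at_right 0)"
      unfolding bb_def using sl by (auto intro!: tendsto_eq_intros)
  qed (use lam_pos in simp)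
  moreover have "eventually (\<lambda>e. e * n < sqrt lam * (r / 2)) (at_right 0)"
  proof (rule order_tendstoD)
    show "((\<lambda>e. e * n) \<longlongrightarrow> 0) (at_right 0)" by (auto intro!: tendsto_eq_intros)
  qed (use sl r_pos in simp)
  moreover have "eventually (\<lambda>e. 2 * e * D < lam / 16) (at_right 0)"
  proof (rule order_tendstoD)
    show "((\<lambda>e. 2 * e * D) \<longlongrightarrow> 0) (at_right 0)" by (auto intro!: tendsto_eq_intros)
  qed (use lam_pos in simp)
  moreover have "eventually (\<lambda>e. e > 0) (at_right (0::real))" by (simp add: eventually_at_right_less)
  ultimately have "eventually (\<lambda>e. e < d0 \<and> K * (bb e)\<^sup>2 + 2 * K\<^sup>2 * (bb e)\<^sup>2 / lam < lam / 32 \<and>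
      e * n < sqrt lam * (r / 2) \<and> 2 * e * D < lam / 16 \<and> e > 0) (at_right 0)"
    by (intro eventually_conj)
  then obtain e where e: "e < d0" "K * (bb e)\<^sup>2 + 2 * K\<^sup>2 * (bb e)\<^sup>2 / lam < lam / 32"
      "e * n < sqrt lam * (r / 2)" "2 * e * D < lam / 16" "e > 0"
    using eventually_happens'[OF trivial_limit_at_right_real] by blast
  define w where "w = e *\<^sub>R v"
  define g where "g = geod M x w"
  define a where "a = e * n"
  have aw: "tnorm M x w = a" using e(5) by (simp add: w_def tnorm_scaleR a_def n_def)
  have a0: "a \<ge> 0" using n e by (simp add: a_def)
  have g: "geodesic g" "g 0 = x" "gvel g 0 = w" by (simp_all add: g_def geod)
  have C1g: "C1_curve M g" by (rule geodesic_C1(1)[OF g(1)])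
  have dom: "g t \<in> fst chx" "phi (g t) \<in> ball (phi x) (r / 2)" if "t \<in> {0..1}" for t
  proof -
    have "e * t \<le> e * 1" using that e(5) by (intro mult_left_mono) auto
    then have "e * t < d0" using e(1) by simp
    moreover have "g t = geod M x v (e * t)" by (simp add: g_def w_def geod_scale mult.commute)
    ultimately show "g t \<in> fst chx" "phi (g t) \<in> ball (phi x) (r / 2)"
      using d0(2)[of "e * t"] that e(5) gv c r_pos by (cases "e * t = 0"; auto)+
  qed
  have dom': "phi (g t) \<in> ball (phi x) r" if "t \<in> {0..1}" for t using dom(2)[OF that] r_pos by auto
  have kin: "Gx (phi (g t)) (rvel chx g t) (rvel chx g t) = a\<^sup>2" if "t \<in> {0..1}" for t
    using geodesic_kinetic_chart[OF g(1) c(1) dom(1)[OF that]] geodesic_kinetic[OF g(1), of t] g aw tnorm_power2[of x w] by simp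
  have vb: "norm (rvel chx g t) \<le> bb e" if "t \<in> {0..1}" for t
  proof -
    have "lam * (norm (rvel chx g t))\<^sup>2 \<le> a\<^sup>2"
      using G_coercive[OF dom'[OF that], of "rvel chx g t"] kin[OF that] by simp
    then have "(norm (rvel chx g t))\<^sup>2 \<le> (bb e)\<^sup>2"
      using lam_pos by (simp add: bb_def a_def power_divide field_simps)
    then show ?thesis using a0 sl by (simp add: bb_def a_def power2_le_iff_abs_le)
  qed
  have lower: "a \<le> rdist M z (g 1)" if zC: "z \<in> C" for z
  proof (rule rdist_ge[OF conn])
    fix h assume h: "C1_curve M h" "h 0 = z" "h 1 = g 1"
    show "a \<le> curve_length M h"
    proof (cases "\<forall>t\<in>{0..1}. h t \<in> fst chx \<and> phi (h t) \<in> ball (phi x) r")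
      case True
      then have hd: "h t \<in> fst chx" "phi (h t) \<in> ball (phi x) r" if "t \<in> {0..1}" for t using that by auto
      let ?\<xi> = "phi z - phi x"
      have len: "curve_length M h = integral {0..1} (\<lambda>t. sqrt (Gx ((phi \<circ> h) t) (unit_vel chx h t) (unit_vel chx h t)))"
        unfolding curve_length_speed using speed_C1[OF h(1) c(1) _ hd(1)] by (intro Henstock_Kurzweil_Integration.integral_cong) simp
      have "a\<^sup>2 - 2 * Gx ((phi \<circ> g) 0) (rvel chx g 0) ((phi \<circ> h) 0 - (phi \<circ> g) 0) + lam / 16 * (norm ((phi \<circ> h) 0 - (phi \<circ> g) 0))\<^sup>2
        \<le> (curve_length M h)\<^sup>2"
        unfolding len
      proof (rule length_lower[where P' = "force chx g" and b = "bb e"])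
        fix t :: real assume t: "t \<in> {0..1}"
        show "((phi \<circ> g) has_vector_derivative rvel chx g t) (at t within {0..1})"
          by (rule has_vector_derivative_at_within[OF geodesic_vel[OF g(1) c(1) dom(1)[OF t]]])
        show "((\<lambda>s. Gx ((phi \<circ> g) s) (rvel chx g s)) has_vector_derivative force chx g t) (at t within {0..1})"
          using has_vector_derivative_at_within[OF geodesic_momentum(1)[OF g(1) c(1) dom(1)[OF t]]]
          by (simp only: comp_def)
        show "force chx g t u = Dmetric chx ((phi \<circ> g) t) u (rvel chx g t) (rvel chx g t) / 2" for u
          using force_apply[OF g(1) c(1) dom(1)[OF t]] by simp
        show "((phi \<circ> h) has_vector_derivative unit_vel chx h t) (at t within {0..1})"
          by (rule C1_curve_vel[OF h(1) c(1) t hd(1)[OF t]])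
        show "(phi \<circ> g) t \<in> ball (phi x) r" "(phi \<circ> h) t \<in> ball (phi x) r"
          using dom'[OF t] hd(2)[OF t] by simp_all
        show "norm (rvel chx g t) \<le> bb e" by (rule vb[OF t])
        show "Gx ((phi \<circ> g) t) (rvel chx g t) (rvel chx g t) = a\<^sup>2" using kin[OF t] by simp
      next
        show "continuous_on {0..1} (unit_vel chx h)"
          unfolding continuous_on_def using C1_curve_vel_tendsto[OF h(1) c(1) _ hd(1)] by blast
        show "(phi \<circ> h) 1 = (phi \<circ> g) 1" using h by simp
        show "K * (bb e)\<^sup>2 + 2 * K\<^sup>2 * (bb e)\<^sup>2 / lam \<le> lam / 32" using e(2) by simp
      qed
      then have "a\<^sup>2 - 2 * rmetric M x w ?\<xi> + lam / 16 * (norm ?\<xi>)\<^sup>2 \<le> (curve_length M h)\<^sup>2"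
        using g h geod_rvel[of w] by (simp add: Gx_at g_def)
      moreover have "2 * rmetric M x w ?\<xi> \<le> lam / 16 * (norm ?\<xi>)\<^sup>2"
      proof -
        \<comment> \<open>The ball was chosen with \<open>r \<le> d\<close>, so a curve that stays
          in it starts where the proximal inequality is valid.\<close>
        have zc: "z \<in> fst chx" "norm ?\<xi> < d" using hd[of 0] h(2) r(1) by (auto simp: dist_norm norm_minus_commute)
        have "2 * rmetric M x w ?\<xi> = 2 * e * rmetric M x v ?\<xi>" by (simp add: w_def b.scaleR_left)
        also have "\<dots> \<le> 2 * e * (D * (norm ?\<xi>)\<^sup>2)" using e(5) prox[OF zC zc] by (intro mult_left_mono) auto
        also have "\<dots> = (2 * e * D) * (norm ?\<xi>)\<^sup>2" by simp
        also have "\<dots> \<le> lam / 16 * (norm ?\<xi>)\<^sup>2" using e(4) by (intro mult_right_mono) auto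
        finally show ?thesis .
      qed
      ultimately have "a\<^sup>2 \<le> (curve_length M h)\<^sup>2" by linarith
      then show ?thesis using curve_length_nonneg by (rule power2_le_imp_le)
    next
      case False
      then obtain t where t: "t \<in> {0..1}" "\<not> (h t \<in> fst chx \<and> phi (h t) \<in> ball (phi x) r)" by blast
      \<comment> \<open>Reversal is essential: \<open>z\<close> may be far away or outside the
        chart, whereas \<open>g 1\<close> lies in the half ball from which exit is measured.\<close>
      have "sqrt lam * (r / 2) \<le> curve_length M (\<lambda>t. h (1 - t))"
      proof (rule exit_length[OF c(1) mb r(2) C1_curve_reverse(1)[OF h(1)], where ?t1.0 = "1 - t"])
        show "norm (phi (h (1 - 0)) - phi x) < r / 2"
          using dom(2)[of 1] h(3) by (simp add: dist_norm norm_minus_commute)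
      qed (use t h(3) dom(1)[of 1] in auto)
      then show ?thesis using curve_length_reverse[OF h(1)] e(3) by (simp add: a_def)
    qed
  qed
  have "curve_length M g = integral {0..1::real} (\<lambda>_. a)"
    unfolding curve_length_speed by (rule Henstock_Kurzweil_Integration.integral_cong) (use geodesic_speed[OF g(1)] g aw in simp)
  then have "curve_length M g = a" by simp
  \<comment> \<open>Taking the point \<open>x\<close> of \<open>C\<close> itself in the lower bound
    shows that the geodesic is minimizing, as the definition of the cone demands.\<close>
  then have xy: "rdist M x (g 1) = a" using lower[OF xC] rdist_le[OF C1g] g(2) by simp
  have "g 1 = geod M x v e" by (simp add: g_def w_def geod_scale)
  moreover have "x \<in> metric_proj M C (g 1)"
    unfolding metric_proj_dist[OF conn] using lower xy xC rdist_sym[of "g 1"] by simp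
  ultimately show ?thesis using e(5) xy unfolding metric_normal_cone_def a_def n_def by auto
qed

end

theorem corollary3p19:
  fixes M :: "('m::t2_space, 'h::{real_inner, banach, second_countable_topology}) riemannian"
    and C :: "'m set" and x :: 'm and V :: "'h set"
  assumes "standing_assumption M"
    and "closed C" and "x \<in> C"
    and "exp_chart_domain M x V"
  shows "exp_proximal_cone M V C x = metric_normal_cone M C x"
proof -
  interpret riem_exp M x V
    using assms by unfold_locales (auto simp: standing_assumption_def)
  have "connected (UNIV :: 'm set)" using assms(1) by (simp add: standing_assumption_def)
  then show ?thesis using normal_cone_subset proximal_cone_subset[OF _ assms(3)] by blast
qed

end
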